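(* In the Bradley–Terry model, let $r>2$ be a fixed integer and suppose $b_n^{11}/c_n^6=o\big(n^{1/2}/(\log n)^{5/2}\big)$. Under the homogeneous null $H_0:\beta_2=\cdots=\beta_r$ (true parameter satisfying it), with $\hat{\boldsymbol\beta}^0$ the maximizer of $\ell_{bt}$ over $\{\boldsymbol\gamma\in\mathbb R^{n-1}:\gamma_2=\cdots=\gamma_r\}$, the statistic $2\{\ell_{bt}(\hat{\boldsymbol\beta})-\ell_{bt}(\hat{\boldsymbol\beta}^0)\}$ converges in distribution to the chi-square distribution with $r-2$ degrees of freedom as $n\to\infty$.
   Context: All quantities may depend on $n$; asymptotics are as $n\to\infty$. Bradley–Terry model: $n$ items; for each pair $1\le i<j\le n$ a number of comparisons $k_{ij}=k_{ji}\in\{1,\dots,K\}$ with $K$ a fixed constant; $a_{ij}\sim\mathrm{Binomial}(k_{ij},p_{ij})$ with $p_{ij}=e^{\beta_i-\beta_j}/(1+e^{\beta_i-\beta_j})$, $a_{ji}=k_{ij}-a_{ij}$, and $a_{ij}$, $1\le i<j\le n$, mutually independent. $\beta_1=0$; the parameter is $\boldsymbol\beta=(\beta_2,\dots,\beta_n)^\top$. $d_i=\sum_{j\ne i}a_{ij}$. $\ell_{bt}(\boldsymbol\gamma)=\sum_{i=1}^n\gamma_id_i-\sum_{1\le i<j\le n}k_{ij}\log(e^{\gamma_i}+e^{\gamma_j})$ with $\gamma_1=0$; $\hat{\boldsymbol\beta}$ is its maximizer over $\mathbb R^{n-1}$. $b_n=\max_{i\ne j}(1+e^{\beta_i-\beta_j})^2/e^{\beta_i-\beta_j}$,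 $c_n=\min_{i\ne j}(1+e^{\beta_i-\beta_j})^2/e^{\beta_i-\beta_j}$ at the true parameter. *)

theory Defs
  imports "HOL-Probability.Probability" "HOL-Library.Landau_Symbols"
begin

definition bt_pairs :: "nat \<Rightarrow> (nat \<times> nat) set" where
  "bt_pairs n = {(i, j). 1 \<le> i \<and> i < j \<and> j \<le> n}"

definition bt_prob :: "(nat \<Rightarrow> real) \<Rightarrow> nat \<Rightarrow> nat \<Rightarrow> real" where
  "bt_prob \<beta> i j = exp (\<beta> i - \<beta> j) / (1 + exp (\<beta> i - \<beta> j))"

definition bt_data :: "nat \<Rightarrow> (nat \<Rightarrow> nat \<Rightarrow> nat) \<Rightarrow> (nat \<Rightarrow> real) \<Rightarrow> (nat \<times> nat \<Rightarrow> nat) pmf" where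
  "bt_data n k \<beta> = Pi_pmf (bt_pairs n) 0 (\<lambda>(i, j). binomial_pmf (k i j) (bt_prob \<beta> i j))"

definition bt_win :: "(nat \<Rightarrow> nat \<Rightarrow> nat) \<Rightarrow> (nat \<times> nat \<Rightarrow> nat) \<Rightarrow> nat \<Rightarrow> nat \<Rightarrow> nat" where
  "bt_win k a i j = (if i < j then a (i, j) else k j i - a (j, i))"

definition bt_degree :: "nat \<Rightarrow> (nat \<Rightarrow> nat \<Rightarrow> nat) \<Rightarrow> (nat \<times> nat \<Rightarrow> nat) \<Rightarrow> nat \<Rightarrow> nat" where
  "bt_degree n k a i = (\<Sum>j\<in>{1..n} - {i}. bt_win k a i j)"

definition bt_loglik :: "nat \<Rightarrow> (nat \<Rightarrow> nat \<Rightarrow> nat) \<Rightarrow> (nat \<times> nat \<Rightarrow> nat) \<Rightarrow> (nat \<Rightarrow> real) \<Rightarrow> real" where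
  "bt_loglik n k a \<gamma> =
     (\<Sum>i=1..n. \<gamma> i * real (bt_degree n k a i))
     - (\<Sum>(i, j)\<in>bt_pairs n. real (k i j) * ln (exp (\<gamma> i) + exp (\<gamma> j)))"

(* parameter space R^{n-1}: gamma_1 = 0; only coordinates 1..n matter *)
definition bt_param_space :: "(nat \<Rightarrow> real) set" where
  "bt_param_space = {\<gamma>. \<gamma> 1 = 0}"

definition bt_null_space :: "nat \<Rightarrow> (nat \<Rightarrow> real) set" where
  "bt_null_space r = {\<gamma>. \<gamma> 1 = 0 \<and> (\<forall>i\<in>{2..r}. \<gamma> i = \<gamma> 2)}"

(* likelihood ratio statistic 2 { l(beta_hat) - l(beta_hat^0) }, written with the suprema
   of l over the two parameter sets (= values at the maximizers whenever these exist) *)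
definition bt_lr_stat :: "nat \<Rightarrow> nat \<Rightarrow> (nat \<Rightarrow> nat \<Rightarrow> nat) \<Rightarrow> (nat \<times> nat \<Rightarrow> nat) \<Rightarrow> real" where
  "bt_lr_stat n r k a =
     2 * ((SUP \<gamma>\<in>bt_param_space. bt_loglik n k a \<gamma>) - (SUP \<gamma>\<in>bt_null_space r. bt_loglik n k a \<gamma>))"

definition bt_b :: "nat \<Rightarrow> (nat \<Rightarrow> real) \<Rightarrow> real" where
  "bt_b n \<beta> = Max {(1 + exp (\<beta> i - \<beta> j))^2 / exp (\<beta> i - \<beta> j) | i j. i \<in> {1..n} \<and> j \<in> {1..n} \<and> i \<noteq> j}"

definition bt_c :: "nat \<Rightarrow> (nat \<Rightarrow> real) \<Rightarrow> real" where
  "bt_c n \<beta> = Min {(1 + exp (\<beta> i - \<beta> j))^2 / exp (\<beta> i - \<beta> j) | i j. i \<in> {1..n} \<and> j \<in> {1..n} \<and> i \<noteq> j}"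

definition chi_square_density :: "nat \<Rightarrow> real \<Rightarrow> real" where
  "chi_square_density m x =
     (if x > 0 then x powr (real m / 2 - 1) * exp (- x / 2) / (2 powr (real m / 2) * Gamma (real m / 2))
      else 0)"

definition chi_square :: "nat \<Rightarrow> real measure" where
  "chi_square m = density lborel (\<lambda>x. ennreal (chi_square_density m x))"

end

theory Submission
  imports Defs
begin

text \<open>With high probability the maximum likelihood estimator stays within \<open>O(b (log n / n)^(1/2))\<close> of the true
  merits, where \<open>b = bt_b n \<beta>\<close>: the likelihood equations balance a flow on the complete graph, and the flow
  through the two extreme items keeps a maximiser over a box away from its boundary. Near the estimator the
  log-likelihood is a Dirichlet form up to factors \<open>1 + o(1)\<close>, so the likelihood ratio is the energy needed to
  make the estimated merits of the items \<open>2, \<dots>, r\<close> equal. Since each of them is tied to the remaining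
  \<open>n - r + 1\<close> items much more strongly than to each other, this energy is asymptotically the weighted variance of
  the \<open>r - 1\<close> estimated merits, with the Fisher information of each merit as its weight. To first order an
  estimated merit is the noise in the comparisons of its item with the remaining ones, divided by that
  information, and these noises are independent. Lindeberg's replacement of the binomial noise by Gaussian noise
  yields the Laplace transform \<open>(1 + 2 l)^(-(r-2)/2)\<close> of the chi-square distribution, and Laplace transforms
  determine weak limits on the half-line.\<close>

section \<open>The logistic function and its Bregman divergence\<close>

definition logistic :: "real \<Rightarrow> real" where
  "logistic t = exp t / (1 + exp t)"

definition softplus :: "real \<Rightarrow> real" where
  "softplus t = ln (1 + exp t)"

definition dlogistic :: "real \<Rightarrow> real" where
  "dlogistic t = exp t / (1 + exp t)\<^sup>2"

lemma one_plus_exp_pos [simp]: "1 + exp t > (0::real)" "1 + exp t \<noteq> (0::real)"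
proof -
  show "1 + exp t > (0::real)" by (rule add_pos_pos) auto
  then show "1 + exp t \<noteq> (0::real)" by simp
qed

lemma logistic_bounds: "0 < logistic t" "logistic t < 1"
  unfolding logistic_def by (auto simp: field_simps intro: add_pos_pos)

lemma logistic_minus: "logistic (- t) = 1 - logistic t"
  unfolding logistic_def by (simp add: exp_minus field_simps)

lemma dlogistic_eq: "dlogistic t = logistic t * (1 - logistic t)"
  unfolding dlogistic_def logistic_def by (simp add: field_simps power2_eq_square)

lemma dlogistic_minus: "dlogistic (- t) = dlogistic t"
  by (simp add: dlogistic_eq logistic_minus)

lemma dlogistic_pos: "dlogistic t > 0"
  unfolding dlogistic_eq using logistic_bounds[of t] by simp

lemma dlogistic_le: "dlogistic t \<le> 1 / 4"
proof -
  have "0 \<le> (logistic t - 1 / 2)\<^sup>2" by simp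
  then show ?thesis unfolding dlogistic_eq by (simp add: power2_eq_square algebra_simps)
qed

lemma DERIV_softplus: "(softplus has_real_derivative logistic t) (at t)"
  unfolding softplus_def[abs_def] logistic_def
  by (auto intro!: derivative_eq_intros simp: field_simps)

lemma DERIV_logistic: "(logistic has_real_derivative dlogistic t) (at t)"
  unfolding logistic_def[abs_def] dlogistic_def
  by (auto intro!: derivative_eq_intros simp: field_simps power2_eq_square)

lemma DERIV_dlogistic: "(dlogistic has_real_derivative dlogistic t * (1 - 2 * logistic t)) (at t)"
  unfolding dlogistic_eq[abs_def]
  by (auto intro!: derivative_eq_intros DERIV_logistic simp: dlogistic_eq algebra_simps)

lemma mono_logistic: "mono logistic"
proof (rule monoI)
  fix x y :: real assume "x \<le> y"
  then show "logistic x \<le> logistic y"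
    by (rule DERIV_nonneg_imp_nondecreasing) (blast intro: DERIV_logistic less_imp_le[OF dlogistic_pos])
qed

lemma softplus_ge: "0 \<le> softplus t" "t \<le> softplus t"
  using ln_mono[of 1 "1 + exp t"] ln_mono[of "exp t" "1 + exp t"] by (simp_all add: softplus_def)

text \<open>Self-concordance: it gives the quadratic expansion of the likelihood a multiplicative error.\<close>

lemma dlogistic_shift_le: "dlogistic s \<le> exp \<bar>s - t\<bar> * dlogistic t"
proof -
  have ordered: "dlogistic x \<le> exp (y - x) * dlogistic y" "dlogistic y \<le> exp (y - x) * dlogistic x"
    if "x \<le> y" for x y
  proof -
    have "(1 + exp y)\<^sup>2 \<le> (exp (y - x) * (1 + exp x))\<^sup>2"
      using that by (intro power_mono) (auto simp: distrib_left intro: add_nonneg_nonneg simp flip: exp_add)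
    then have "exp x * (1 + exp y)\<^sup>2 \<le> exp x * (exp (y - x) * exp (y - x) * (1 + exp x)\<^sup>2)"
      by (simp add: power2_eq_square mult_ac)
    also have "\<dots> = exp (y - x) * exp y * (1 + exp x)\<^sup>2"
      by (simp flip: exp_add mult.assoc)
    finally show "dlogistic x \<le> exp (y - x) * dlogistic y"
      unfolding dlogistic_def by (simp add: field_simps)
    have "exp y * (1 + exp x)\<^sup>2 \<le> exp y * (1 + exp y)\<^sup>2"
      using that by (intro mult_left_mono power_mono) (auto intro: add_nonneg_nonneg)
    also have "\<dots> = exp (y - x) * exp x * (1 + exp y)\<^sup>2"
      by (simp flip: exp_add)
    finally show "dlogistic y \<le> exp (y - x) * dlogistic x"
      unfolding dlogistic_def by (simp add: field_simps)
  qed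
  show ?thesis
    using ordered[of s t] ordered[of t s] by (cases "s \<le> t") auto
qed

lemma dlogistic_shift_ge: "exp (- \<bar>s - t\<bar>) * dlogistic t \<le> dlogistic s"
  using dlogistic_shift_le[of t s] by (simp add: exp_minus abs_minus_commute field_simps)

lemma logistic_increment_ge:
  assumes "h \<ge> 0"
  shows "dlogistic t * (1 - exp (- h)) \<le> logistic (t + h) - logistic t"
proof -
  define \<phi> where "\<phi> s = logistic (t + s) + dlogistic t * exp (- s)" for s
  have "\<phi> 0 \<le> \<phi> h"
  proof (rule DERIV_nonneg_imp_nondecreasing[OF assms], intro exI conjI)
    fix s :: real assume "0 \<le> s"
    show "(\<phi> has_real_derivative dlogistic (t + s) - dlogistic t * exp (- s)) (at s)"
      unfolding \<phi>_def[abs_def]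
      by (auto intro!: derivative_eq_intros DERIV_chain2[OF DERIV_logistic])
    show "0 \<le> dlogistic (t + s) - dlogistic t * exp (- s)"
      using dlogistic_shift_ge[of "t + s" t] \<open>0 \<le> s\<close> by (simp add: mult.commute)
  qed
  then show ?thesis by (simp add: \<phi>_def algebra_simps)
qed

lemma taylor_lagrange_2:
  fixes f f' f'' :: "real \<Rightarrow> real"
  assumes "\<And>s. (f has_real_derivative f' s) (at s)" "\<And>s. (f' has_real_derivative f'' s) (at s)"
  obtains \<xi> where "\<bar>\<xi> - t\<bar> \<le> \<bar>h\<bar>" "f (t + h) = f t + f' t * h + f'' \<xi> * h\<^sup>2 / 2"
proof -
  define D where "D m s = (if m = 0 then f (t + s) else if m = 1 then f' (t + s) else f'' (t + s))"
    for m :: nat and s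
  have "(D m has_real_derivative D (Suc m) s) (at s)" if "m < 2" for m s
    using that assms[of "t + s"] DERIV_shift[of f _ s t] DERIV_shift[of f' _ s t]
    by (auto simp: D_def[abs_def] less_2_cases_iff add.commute)
  moreover have "D 0 = (\<lambda>s. f (t + s))" by (simp add: D_def fun_eq_iff)
  ultimately obtain s where "\<bar>s\<bar> \<le> \<bar>h\<bar>"
      "f (t + h) = (\<Sum>m<2. D m 0 / fact m * h ^ m) + D 2 s / fact 2 * h ^ 2"
    using Maclaurin_bi_le[of D "\<lambda>s. f (t + s)" 2 h] by blast
  then show ?thesis
    using that[of "t + s"] by (simp add: D_def numeral_2_eq_2)
qed

lemma logistic_taylor: "\<bar>logistic (t + h) - logistic t - dlogistic t * h\<bar> \<le> h\<^sup>2 / 8"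
proof -
  obtain \<xi> where \<xi>: "logistic (t + h) = logistic t + dlogistic t * h + dlogistic \<xi> * (1 - 2 * logistic \<xi>) * h\<^sup>2 / 2"
    using taylor_lagrange_2[OF DERIV_logistic DERIV_dlogistic] by metis
  have "dlogistic \<xi> * \<bar>1 - 2 * logistic \<xi>\<bar> \<le> 1 / 4 * 1"
    using dlogistic_le[of \<xi>] logistic_bounds[of \<xi>] by (intro mult_mono) auto
  then have "dlogistic \<xi> * \<bar>1 - 2 * logistic \<xi>\<bar> * (h\<^sup>2 / 2) \<le> 1 / 4 * (h\<^sup>2 / 2)"
    by (intro mult_right_mono) auto
  then show ?thesis
    using dlogistic_pos[of \<xi>] by (simp add: \<xi> abs_mult)
qed

definition bregman :: "real \<Rightarrow> real \<Rightarrow> real" where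
  "bregman t h = softplus (t + h) - softplus t - logistic t * h"

lemma bregman_0 [simp]: "bregman t 0 = 0"
  by (simp add: bregman_def)

lemma bregman_minus: "bregman (- t) (- h) = bregman t h"
proof -
  have "softplus (- s) = softplus s - s" for s
  proof -
    have "1 + exp (- s) = (1 + exp s) / exp s" by (simp add: exp_minus field_simps)
    then show ?thesis by (simp add: softplus_def ln_div)
  qed
  from this[of t] this[of "t + h"] show ?thesis
    by (simp add: bregman_def logistic_minus algebra_simps)
qed

lemma bregman_lagrange:
  obtains \<xi> where "\<bar>\<xi> - t\<bar> \<le> \<bar>h\<bar>" "2 * bregman t h = dlogistic \<xi> * h\<^sup>2"
proof -
  obtain \<xi> where "\<bar>\<xi> - t\<bar> \<le> \<bar>h\<bar>"
      "softplus (t + h) = softplus t + logistic t * h + dlogistic \<xi> * h\<^sup>2 / 2"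
    by (rule taylor_lagrange_2[OF DERIV_softplus DERIV_logistic])
  then show ?thesis using that[of \<xi>] by (simp add: bregman_def)
qed

lemma bregman_nonneg: "bregman t h \<ge> 0"
proof -
  obtain \<xi> where "2 * bregman t h = dlogistic \<xi> * h\<^sup>2" using bregman_lagrange by blast
  moreover have "0 \<le> dlogistic \<xi> * h\<^sup>2" using dlogistic_pos[of \<xi>] by simp
  ultimately show ?thesis by linarith
qed

lemma bregman_quadratic_bounds:
  shows "2 * bregman t h \<le> exp (\<bar>t - s\<bar> + \<bar>h\<bar>) * (dlogistic s * h\<^sup>2)"
    and "exp (- (\<bar>t - s\<bar> + \<bar>h\<bar>)) * (dlogistic s * h\<^sup>2) \<le> 2 * bregman t h"
proof -
  obtain \<xi> where \<xi>: "\<bar>\<xi> - t\<bar> \<le> \<bar>h\<bar>" "2 * bregman t h = dlogistic \<xi> * h\<^sup>2"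
    using bregman_lagrange by blast
  have "dlogistic \<xi> \<le> exp \<bar>\<xi> - s\<bar> * dlogistic s" by (rule dlogistic_shift_le)
  also have "\<dots> \<le> exp (\<bar>t - s\<bar> + \<bar>h\<bar>) * dlogistic s"
    using \<xi>(1) dlogistic_pos[of s] by (intro mult_right_mono) auto
  finally show "2 * bregman t h \<le> exp (\<bar>t - s\<bar> + \<bar>h\<bar>) * (dlogistic s * h\<^sup>2)"
    unfolding \<xi>(2) by (simp add: mult_right_mono flip: mult.assoc)
  have "exp (- (\<bar>t - s\<bar> + \<bar>h\<bar>)) * dlogistic s \<le> exp (- \<bar>\<xi> - s\<bar>) * dlogistic s"
    using \<xi>(1) dlogistic_pos[of s] by (intro mult_right_mono) auto
  also have "\<dots> \<le> dlogistic \<xi>" by (rule dlogistic_shift_ge)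
  finally show "exp (- (\<bar>t - s\<bar> + \<bar>h\<bar>)) * (dlogistic s * h\<^sup>2) \<le> 2 * bregman t h"
    unfolding \<xi>(2) by (simp add: mult_right_mono flip: mult.assoc)
qed

lemma bregman_scale_le:
  assumes "0 \<le> c" "c \<le> 1"
  shows "bregman t (c * h) \<le> bregman t h"
proof -
  have "bregman t (c * h) \<le> bregman t (1 * h)"
  proof (rule DERIV_nonneg_imp_nondecreasing[OF assms(2)], intro exI conjI)
    fix s assume "c \<le> s"
    show "((\<lambda>s. bregman t (s * h)) has_real_derivative (logistic (t + s * h) - logistic t) * h) (at s)"
      unfolding bregman_def
      by (auto intro!: derivative_eq_intros DERIV_chain2[OF DERIV_softplus] simp: algebra_simps)
    have "0 \<le> s" using \<open>c \<le> s\<close> assms by simp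
    show "0 \<le> (logistic (t + s * h) - logistic t) * h"
    proof (cases "h \<ge> 0")
      case True
      with \<open>0 \<le> s\<close> show ?thesis
        by (intro mult_nonneg_nonneg) (auto intro: monoD[OF mono_logistic])
    next
      case False
      with \<open>0 \<le> s\<close> have "s * h \<le> 0" by (simp add: mult_le_0_iff)
      with False show ?thesis
        by (intro mult_nonpos_nonpos) (auto intro: monoD[OF mono_logistic])
    qed
  qed
  then show ?thesis by simp
qed

section \<open>Oscillation and weighted variance\<close>

definition osc_le :: "'a set \<Rightarrow> ('a \<Rightarrow> real) \<Rightarrow> real \<Rightarrow> bool" where
  "osc_le I f w \<longleftrightarrow> (\<forall>i\<in>I. \<forall>j\<in>I. \<bar>f i - f j\<bar> \<le> w)"

lemma osc_leD: "osc_le I f w \<Longrightarrow> i \<in> I \<Longrightarrow> j \<in> I \<Longrightarrow> \<bar>f i - f j\<bar> \<le> w"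
  by (simp add: osc_le_def)

lemma osc_le_subset: "osc_le I f w \<Longrightarrow> J \<subseteq> I \<Longrightarrow> osc_le J f w"
  by (auto simp: osc_le_def)

definition weighted_mean :: "('a \<Rightarrow> real) \<Rightarrow> 'a set \<Rightarrow> ('a \<Rightarrow> real) \<Rightarrow> real" where
  "weighted_mean A R f = (\<Sum>i\<in>R. A i * f i) / sum A R"

definition weighted_var :: "('a \<Rightarrow> real) \<Rightarrow> 'a set \<Rightarrow> ('a \<Rightarrow> real) \<Rightarrow> real" where
  "weighted_var A R f = (\<Sum>i\<in>R. A i * (f i - weighted_mean A R f)\<^sup>2)"

lemma weighted_var_cong:
  assumes "\<And>i. i \<in> R \<Longrightarrow> f i = g i"
  shows "weighted_var A R f = weighted_var A R g"
proof -
  have "weighted_mean A R f = weighted_mean A R g" using assms by (simp add: weighted_mean_def)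
  then show ?thesis using assms by (simp add: weighted_var_def)
qed

lemma weighted_mean_affine:
  assumes "sum A R \<noteq> 0"
  shows "weighted_mean A R (\<lambda>i. c + s * f i) = c + s * weighted_mean A R f"
proof -
  have "(\<Sum>i\<in>R. A i * (c + s * f i)) = c * sum A R + s * (\<Sum>i\<in>R. A i * f i)"
    by (simp add: distrib_left sum.distrib sum_distrib_left mult_ac)
  then show ?thesis using assms by (simp add: weighted_mean_def add_divide_distrib)
qed

lemma weighted_var_affine:
  assumes "sum A R \<noteq> 0"
  shows "weighted_var A R (\<lambda>i. c + s * f i) = s\<^sup>2 * weighted_var A R f"
  unfolding weighted_var_def weighted_mean_affine[OF assms] sum_distrib_left
  by (intro sum.cong refl) (simp add: power2_eq_square algebra_simps)

lemma weighted_var_nonneg: "(\<And>i. i \<in> R \<Longrightarrow> 0 \<le> A i) \<Longrightarrow> 0 \<le> weighted_var A R f"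
  unfolding weighted_var_def by (intro sum_nonneg mult_nonneg_nonneg) auto

lemma sum_weighted_sq_dist:
  assumes "sum A R \<noteq> 0"
  shows "(\<Sum>i\<in>R. A i * (f i - c)\<^sup>2) = weighted_var A R f + sum A R * (weighted_mean A R f - c)\<^sup>2"
proof -
  define m where "m = weighted_mean A R f"
  have "(\<Sum>i\<in>R. A i * f i) = m * sum A R" using assms by (simp add: m_def weighted_mean_def)
  then have centred: "(\<Sum>i\<in>R. A i * (f i - m)) = 0"
    by (simp add: right_diff_distrib sum_subtractf sum_distrib_left mult.commute)
  have "(\<Sum>i\<in>R. A i * (f i - c)\<^sup>2)
      = (\<Sum>i\<in>R. A i * (f i - m)\<^sup>2 + 2 * (m - c) * (A i * (f i - m)) + A i * (m - c)\<^sup>2)"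
    by (intro sum.cong refl) (simp add: power2_eq_square algebra_simps)
  also have "\<dots> = weighted_var A R f + 2 * (m - c) * (\<Sum>i\<in>R. A i * (f i - m)) + sum A R * (m - c)\<^sup>2"
    by (simp add: sum.distrib weighted_var_def m_def sum_distrib_left sum_distrib_right)
  finally show ?thesis by (simp only: centred) (simp add: m_def)
qed

lemma weighted_var_le:
  assumes "sum A R > 0"
  shows "weighted_var A R f \<le> (\<Sum>i\<in>R. A i * (f i - c)\<^sup>2)"
  using assms by (subst sum_weighted_sq_dist) auto

lemma weighted_mean_dist_le:
  assumes A: "\<And>i. i \<in> R \<Longrightarrow> 0 \<le> A i" "sum A R > 0" and f: "\<And>i. i \<in> R \<Longrightarrow> \<bar>f i - x\<bar> \<le> w"
  shows "\<bar>weighted_mean A R f - x\<bar> \<le> w"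
proof -
  have "weighted_mean A R f * sum A R = (\<Sum>i\<in>R. A i * f i)"
    using A(2) by (simp add: weighted_mean_def)
  then have "(weighted_mean A R f - x) * sum A R = (\<Sum>i\<in>R. A i * (f i - x))"
    by (simp add: left_diff_distrib right_diff_distrib sum_subtractf sum_distrib_left mult.commute)
  then have "\<bar>weighted_mean A R f - x\<bar> * sum A R = \<bar>\<Sum>i\<in>R. A i * (f i - x)\<bar>"
    using A(2) by (metis abs_mult abs_of_pos)
  also have "\<dots> \<le> (\<Sum>i\<in>R. A i * w)"
    using A(1) f by (intro order_trans[OF sum_abs] sum_mono) (auto simp: abs_mult intro: mult_left_mono)
  also have "\<dots> = w * sum A R" by (simp add: sum_distrib_left mult.commute)
  finally show ?thesis using A(2) by simp
qed

lemma weighted_mean_osc: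
  assumes "\<And>i. i \<in> R \<Longrightarrow> 0 \<le> A i" "sum A R > 0" "osc_le R f w" "j \<in> R"
  shows "\<bar>f j - weighted_mean A R f\<bar> \<le> w"
  using weighted_mean_dist_le[of R A f "f j" w] assms by (simp add: osc_le_def abs_minus_commute)

lemma weighted_var_le_osc:
  assumes "\<And>i. i \<in> R \<Longrightarrow> 0 \<le> A i" "sum A R > 0" "osc_le R f w"
  shows "weighted_var A R f \<le> sum A R * w\<^sup>2"
  unfolding weighted_var_def sum_distrib_right
proof (intro sum_mono mult_left_mono)
  fix i assume "i \<in> R"
  then show "(f i - weighted_mean A R f)\<^sup>2 \<le> w\<^sup>2"
    using weighted_mean_osc[OF assms] by (intro power2_mono order_trans[OF _ abs_ge_self]) auto
qed (use assms in auto)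

lemma weighted_var_perturb_le:
  assumes A: "\<And>i. i \<in> R \<Longrightarrow> 0 \<le> A i" "sum A R > 0"
    and osc: "osc_le R f w" and fg: "\<And>i. i \<in> R \<Longrightarrow> \<bar>g i - f i - c\<bar> \<le> d"
  shows "weighted_var A R g \<le> weighted_var A R f + sum A R * (2 * w * d + d\<^sup>2)"
proof -
  let ?m = "weighted_mean A R f"
  have "weighted_var A R g \<le> (\<Sum>i\<in>R. A i * (g i - (?m + c))\<^sup>2)"
    by (rule weighted_var_le[OF A(2)])
  also have "\<dots> \<le> (\<Sum>i\<in>R. A i * ((f i - ?m)\<^sup>2 + (2 * w * d + d\<^sup>2)))"
  proof (intro sum_mono mult_left_mono A(1))
    fix i assume i: "i \<in> R"
    define \<eta> where "\<eta> = g i - f i - c"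
    have "\<bar>f i - ?m\<bar> * \<bar>\<eta>\<bar> \<le> w * d"
      using weighted_mean_osc[OF A osc i] fg[OF i] by (intro mult_mono) (auto simp: \<eta>_def)
    then have "(f i - ?m) * \<eta> \<le> w * d" by (simp add: abs_mult[symmetric])
    moreover have "\<eta>\<^sup>2 \<le> d\<^sup>2"
      using fg[OF i] by (intro power2_mono order_trans[OF _ abs_ge_self]) (simp add: \<eta>_def)
    moreover have "(g i - (?m + c))\<^sup>2 = (f i - ?m)\<^sup>2 + 2 * ((f i - ?m) * \<eta>) + \<eta>\<^sup>2"
      by (simp add: \<eta>_def power2_eq_square algebra_simps)
    ultimately show "(g i - (?m + c))\<^sup>2 \<le> (f i - ?m)\<^sup>2 + (2 * w * d + d\<^sup>2)" by linarith
  qed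
  also have "\<dots> = weighted_var A R f + sum A R * (2 * w * d + d\<^sup>2)"
    unfolding weighted_var_def by (simp only: distrib_left[of "A _"] sum.distrib sum_distrib_right)
  finally show ?thesis .
qed

lemma weighted_var_insert:
  assumes "finite R" "i \<notin> R" "A i > 0" "sum A R > 0"
  shows "weighted_var A (insert i R) f
    = weighted_var A R f + A i * sum A R / (A i + sum A R) * (f i - weighted_mean A R f)\<^sup>2"
proof -
  define m where "m = weighted_mean A R f"
  define a where "a = A i"
  define S where "S = sum A R"
  have pos: "a > 0" "S > 0" "a + S > 0" using assms by (simp_all add: a_def S_def)
  have mean: "weighted_mean A (insert i R) f - m = a * (f i - m) / (a + S)"
  proof -
    have "weighted_mean A (insert i R) f = (a * f i + S * m) / (a + S)"
      using assms pos by (simp add: weighted_mean_def m_def a_def S_def)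
    then show ?thesis using pos by (simp add: field_simps)
  qed
  have "a * (f i - m)\<^sup>2 + weighted_var A R f = (\<Sum>j\<in>insert i R. A j * (f j - m)\<^sup>2)"
    using assms by (simp add: weighted_var_def m_def a_def)
  also have "\<dots> = weighted_var A (insert i R) f + (a + S) * (weighted_mean A (insert i R) f - m)\<^sup>2"
    using assms pos by (subst sum_weighted_sq_dist) (simp_all add: a_def S_def)
  also have "(a + S) * (weighted_mean A (insert i R) f - m)\<^sup>2 = a\<^sup>2 / (a + S) * (f i - m)\<^sup>2"
    using pos unfolding mean by (simp add: power_divide power_mult_distrib power2_eq_square)
  finally have "weighted_var A (insert i R) f
      = weighted_var A R f + (a - a\<^sup>2 / (a + S)) * (f i - m)\<^sup>2"
    by (simp add: left_diff_distrib)
  also have "a - a\<^sup>2 / (a + S) = a * S / (a + S)"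
    using pos by (simp add: field_simps power2_eq_square)
  finally show ?thesis by (simp add: m_def a_def S_def)
qed

section \<open>Weighted graphs\<close>

definition laplacian :: "('a \<Rightarrow> 'a \<Rightarrow> real) \<Rightarrow> 'a set \<Rightarrow> ('a \<Rightarrow> real) \<Rightarrow> 'a \<Rightarrow> real" where
  "laplacian v I f i = (\<Sum>j\<in>I. v i j * (f i - f j))"

definition dirichlet_form :: "('a \<Rightarrow> 'a \<Rightarrow> real) \<Rightarrow> 'a set \<Rightarrow> ('a \<Rightarrow> real) \<Rightarrow> real" where
  "dirichlet_form v I f = (\<Sum>i\<in>I. \<Sum>j\<in>I. v i j * (f i - f j)\<^sup>2) / 2"

lemma sum_antisymmetric_by_parts:
  fixes h :: "'a \<Rightarrow> 'a \<Rightarrow> real"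
  assumes "\<And>i j. i \<in> I \<Longrightarrow> j \<in> I \<Longrightarrow> h j i = - h i j"
  shows "(\<Sum>i\<in>I. \<Sum>j\<in>I. h i j * (f i - f j)) / 2 = (\<Sum>i\<in>I. f i * (\<Sum>j\<in>I. h i j))"
proof -
  have "(\<Sum>i\<in>I. \<Sum>j\<in>I. h i j * f j) = (\<Sum>j\<in>I. \<Sum>i\<in>I. h i j * f j)"
    by (rule sum.swap)
  also have "\<dots> = (\<Sum>j\<in>I. \<Sum>i\<in>I. - (f j * h j i))"
  proof (intro sum.cong refl)
    fix j i assume "j \<in> I" "i \<in> I"
    from assms[OF this] show "h i j * f j = - (f j * h j i)" by simp
  qed
  also have "\<dots> = - (\<Sum>i\<in>I. f i * (\<Sum>j\<in>I. h i j))"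
    by (simp add: sum_negf sum_distrib_left)
  finally have "(\<Sum>i\<in>I. \<Sum>j\<in>I. h i j * (f i - f j)) = 2 * (\<Sum>i\<in>I. f i * (\<Sum>j\<in>I. h i j))"
    by (simp add: right_diff_distrib sum_subtractf sum_distrib_left mult.commute)
  then show ?thesis by simp
qed

lemma sum_antisymmetric:
  fixes h :: "'a \<Rightarrow> 'a \<Rightarrow> real"
  assumes "\<And>i j. i \<in> I \<Longrightarrow> j \<in> I \<Longrightarrow> h j i = - h i j"
  shows "(\<Sum>i\<in>I. \<Sum>j\<in>I. h i j) = 0"
  using sum_antisymmetric_by_parts[of I h "\<lambda>_. 1", OF assms] by simp

lemma laplacian_flow_antisym:
  fixes f :: "'a \<Rightarrow> real"
  assumes "\<And>i j. v i j = v j i"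
  shows "v j i * (f j - f i) = - (v i j * (f i - f j))"
  using assms[of i j] by (simp add: algebra_simps)

lemma sum_laplacian:
  assumes "\<And>i j. v i j = v j i"
  shows "(\<Sum>i\<in>I. laplacian v I f i) = 0"
  unfolding laplacian_def by (rule sum_antisymmetric) (rule laplacian_flow_antisym[OF assms])

lemma laplacian_self_adjoint:
  assumes "\<And>i j. v i j = v j i"
  shows "(\<Sum>i\<in>I. f i * laplacian v I g i) = (\<Sum>i\<in>I. g i * laplacian v I f i)"
proof -
  have by_parts: "(\<Sum>i\<in>I. f i * laplacian v I g i) = (\<Sum>i\<in>I. \<Sum>j\<in>I. v i j * (g i - g j) * (f i - f j)) / 2"
    for f g
    unfolding laplacian_def
    by (rule sum_antisymmetric_by_parts[symmetric]) (rule laplacian_flow_antisym[OF assms])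
  show ?thesis by (simp add: by_parts mult_ac)
qed

lemma laplacian_add: "laplacian v I (\<lambda>i. f i + g i) i = laplacian v I f i + laplacian v I g i"
  by (simp add: laplacian_def algebra_simps flip: sum.distrib)

lemma dirichlet_form_nonneg:
  assumes "\<And>i j. i \<in> I \<Longrightarrow> j \<in> I \<Longrightarrow> i \<noteq> j \<Longrightarrow> 0 \<le> v i j"
  shows "0 \<le> dirichlet_form v I f"
proof -
  have "0 \<le> v i j * (f i - f j)\<^sup>2" if "i \<in> I" "j \<in> I" for i j
    using assms[OF that] by (cases "i = j") auto
  then show ?thesis by (simp add: dirichlet_form_def sum_nonneg)
qed

lemma dirichlet_form_mono:
  assumes "\<And>i j. i \<in> I \<Longrightarrow> j \<in> I \<Longrightarrow> i \<noteq> j \<Longrightarrow> u i j \<le> v i j"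
  shows "dirichlet_form u I f \<le> dirichlet_form v I f"
proof -
  have "u i j * (f i - f j)\<^sup>2 \<le> v i j * (f i - f j)\<^sup>2" if "i \<in> I" "j \<in> I" for i j
    using assms[OF that] by (cases "i = j") (auto intro: mult_right_mono)
  then show ?thesis by (simp add: dirichlet_form_def sum_mono)
qed

lemma dirichlet_form_union:
  assumes "finite R" "finite S" "R \<inter> S = {}" and sym: "\<And>i j. v i j = v j i"
  shows "dirichlet_form v (R \<union> S) f
    = dirichlet_form v R f + (\<Sum>i\<in>R. \<Sum>j\<in>S. v i j * (f i - f j)\<^sup>2) + dirichlet_form v S f"
proof -
  have "(\<Sum>i\<in>S. \<Sum>j\<in>R. v i j * (f i - f j)\<^sup>2) = (\<Sum>i\<in>R. \<Sum>j\<in>S. v j i * (f j - f i)\<^sup>2)"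
    by (rule sum.swap)
  also have "\<dots> = (\<Sum>i\<in>R. \<Sum>j\<in>S. v i j * (f i - f j)\<^sup>2)"
    by (intro sum.cong refl) (simp add: sym[of _ "_ :: 'a"] power2_commute)
  finally show ?thesis
    using assms(1-3) by (simp add: dirichlet_form_def sum.union_disjoint sum.distrib add_divide_distrib)
qed

lemma dirichlet_form_ge_poincare:
  fixes \<kappa> :: real
  assumes "finite S" and v: "\<And>i j. i \<in> S \<Longrightarrow> j \<in> S \<Longrightarrow> i \<noteq> j \<Longrightarrow> \<kappa> \<le> v i j"
  shows "\<kappa> * card S * weighted_var (\<lambda>_. 1) S f \<le> dirichlet_form v S f"
proof (cases "S = {}")
  case False
  let ?N = "real (card S)" and ?V = "weighted_var (\<lambda>_. 1) S f" and ?m = "weighted_mean (\<lambda>_. 1) S f"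
  have "(\<Sum>j\<in>S. (f j - f i)\<^sup>2) = ?V + ?N * (f i - ?m)\<^sup>2" for i
    using sum_weighted_sq_dist[of "\<lambda>_. 1" S f "f i"] assms(1) False by (simp add: power2_commute)
  then have "(\<Sum>i\<in>S. \<Sum>j\<in>S. (f i - f j)\<^sup>2) = (\<Sum>i\<in>S. ?V + ?N * (f i - ?m)\<^sup>2)"
    by (simp add: power2_commute[of "f _" "f _"])
  also have "\<dots> = 2 * ?N * ?V"
    by (simp add: sum.distrib weighted_var_def flip: sum_distrib_left)
  finally have "\<kappa> * ?N * ?V = dirichlet_form (\<lambda>_ _. \<kappa>) S f"
    by (simp add: dirichlet_form_def flip: sum_distrib_left)
  also have "\<dots> \<le> dirichlet_form v S f"
    by (rule dirichlet_form_mono) (rule v)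
  finally show ?thesis .
qed (simp add: dirichlet_form_def)

lemma dirichlet_form_ge_sq_diff:
  fixes f :: "'a \<Rightarrow> real" and \<kappa> :: real
  assumes "finite I" and v: "\<And>i j. i \<in> I \<Longrightarrow> j \<in> I \<Longrightarrow> i \<noteq> j \<Longrightarrow> \<kappa> \<le> v i j" and "0 \<le> \<kappa>"
    and pq: "p \<in> I" "q \<in> I"
  shows "\<kappa> * card I * (f p - f q)\<^sup>2 / 4 \<le> dirichlet_form v I f"
proof (cases "p = q")
  case False
  have "real (card I) * ((f p - f q)\<^sup>2 / 2) = (\<Sum>j\<in>I. (f p - f q)\<^sup>2 / 2)" by simp
  also have "\<dots> \<le> (\<Sum>j\<in>I. (f p - f j)\<^sup>2 + (f q - f j)\<^sup>2)"
  proof (intro sum_mono)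
    fix j
    have "0 \<le> ((f p - f j) + (f q - f j))\<^sup>2" by simp
    then have "(f p - f q)\<^sup>2 \<le> 2 * ((f p - f j)\<^sup>2 + (f q - f j)\<^sup>2)"
      by (simp add: power2_eq_square algebra_simps)
    then show "(f p - f q)\<^sup>2 / 2 \<le> (f p - f j)\<^sup>2 + (f q - f j)\<^sup>2" by simp
  qed
  also have "\<dots> = (\<Sum>i\<in>{p, q}. \<Sum>j\<in>I. (f i - f j)\<^sup>2)" using False by (simp add: sum.distrib)
  also have "\<dots> \<le> (\<Sum>i\<in>I. \<Sum>j\<in>I. (f i - f j)\<^sup>2)"
    using assms(1) pq by (intro sum_mono2) (auto intro: sum_nonneg)
  finally have "\<kappa> * (real (card I) * ((f p - f q)\<^sup>2 / 2)) \<le> \<kappa> * (\<Sum>i\<in>I. \<Sum>j\<in>I. (f i - f j)\<^sup>2)"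
    using \<open>0 \<le> \<kappa>\<close> by (rule mult_left_mono)
  then have "\<kappa> * card I * (f p - f q)\<^sup>2 / 4 \<le> dirichlet_form (\<lambda>_ _. \<kappa>) I f"
    by (simp add: dirichlet_form_def flip: sum_distrib_left)
  also have "\<dots> \<le> dirichlet_form v I f"
    by (rule dirichlet_form_mono) (rule v)
  finally show ?thesis .
next
  case True
  have "0 \<le> dirichlet_form v I f"
    using v \<open>0 \<le> \<kappa>\<close> by (intro dirichlet_form_nonneg) (meson order_trans)
  with True show ?thesis by simp
qed

lemma sum_cross_edges_ge:
  fixes a :: "'a \<Rightarrow> real"
  assumes "t > 0" and a: "\<And>j. j \<in> S \<Longrightarrow> 0 \<le> a j" "\<And>j. j \<in> S \<Longrightarrow> a j \<le> M"
  shows "sum a S * x\<^sup>2 * (1 - t * M) - (\<Sum>j\<in>S. (u j)\<^sup>2) / t \<le> (\<Sum>j\<in>S. a j * (x - u j)\<^sup>2)"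
proof -
  have "sum a S * x\<^sup>2 * (1 - t * M) - (\<Sum>j\<in>S. (u j)\<^sup>2) / t
      = (\<Sum>j\<in>S. a j * x\<^sup>2 * (1 - t * M) - (u j)\<^sup>2 / t)"
    by (simp add: sum_subtractf sum_distrib_right sum_divide_distrib)
  also have "\<dots> \<le> (\<Sum>j\<in>S. a j * (x - u j)\<^sup>2)"
  proof (rule sum_mono)
    fix j assume j: "j \<in> S"
    have "0 \<le> (a j * x * t - u j)\<^sup>2 / t" using \<open>t > 0\<close> by simp
    also have "\<dots> = (a j)\<^sup>2 * (x\<^sup>2 * t) - 2 * a j * x * u j + (u j)\<^sup>2 / t"
      using \<open>t > 0\<close> by (simp add: field_simps power2_eq_square)
    finally have am_gm: "2 * a j * x * u j \<le> (a j)\<^sup>2 * (x\<^sup>2 * t) + (u j)\<^sup>2 / t" by simp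
    have "a j * a j \<le> a j * M" using a[OF j] by (intro mult_left_mono)
    then have "(a j)\<^sup>2 * (x\<^sup>2 * t) \<le> a j * M * (x\<^sup>2 * t)"
      unfolding power2_eq_square[of "a j"] using \<open>t > 0\<close> by (intro mult_right_mono) auto
    moreover have "0 \<le> a j * (u j)\<^sup>2" using a(1)[OF j] by simp
    ultimately show "a j * x\<^sup>2 * (1 - t * M) - (u j)\<^sup>2 / t \<le> a j * (x - u j)\<^sup>2"
      using am_gm by (simp add: power2_diff algebra_simps)
  qed
  finally show ?thesis .
qed

text \<open>Minimising the form over the values on \<open>S\<close> (a Schur complement) only costs a factor close to one, since the
  edges inside \<open>S\<close> force these values to be nearly constant.\<close>

lemma weighted_var_le_dirichlet_form:
  fixes v :: "'a \<Rightarrow> 'a \<Rightarrow> real" and \<kappa> M :: real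
  assumes fin: "finite R" "finite S" and disj: "R \<inter> S = {}" and ne: "R \<noteq> {}" "S \<noteq> {}"
    and sym: "\<And>i j. v i j = v j i" and nonneg: "\<And>i j. 0 \<le> v i j"
    and \<kappa>: "0 < \<kappa>" "\<And>i j. i \<in> S \<Longrightarrow> j \<in> S \<Longrightarrow> i \<noteq> j \<Longrightarrow> \<kappa> \<le> v i j"
    and M: "\<And>i j. i \<in> R \<Longrightarrow> j \<in> S \<Longrightarrow> v i j \<le> M"
  defines "A \<equiv> \<lambda>i. sum (v i) S"
  assumes A: "sum A R > 0"
  shows "(1 - card R * M / (\<kappa> * card S)) * weighted_var A R f \<le> dirichlet_form v (R \<union> S) f"
proof (cases "0 \<le> 1 - card R * M / (\<kappa> * card S)")
  case True
  define t where "t = card R / (\<kappa> * card S)"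
  define \<mu> where "\<mu> = weighted_mean (\<lambda>_. 1) S f"
  define W where "W = weighted_var (\<lambda>_. 1) S f"
  have W: "W = (\<Sum>j\<in>S. (f j - \<mu>)\<^sup>2)" by (simp add: W_def weighted_var_def \<mu>_def)
  have pos: "card R > 0" "card S > 0" using fin ne by (auto simp: card_gt_0_iff)
  have t: "t > 0" using pos \<kappa>(1) by (simp add: t_def)
  have cross: "A i * (f i - \<mu>)\<^sup>2 * (1 - t * M) - W / t \<le> (\<Sum>j\<in>S. v i j * (f i - f j)\<^sup>2)" if "i \<in> R" for i
    using sum_cross_edges_ge[OF t nonneg M[OF that], where x = "f i - \<mu>" and u = "\<lambda>j. f j - \<mu>"]
    by (simp add: A_def W)
  have "(1 - t * M) * weighted_var A R f \<le> (1 - t * M) * (\<Sum>i\<in>R. A i * (f i - \<mu>)\<^sup>2)"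
    using True by (intro mult_left_mono weighted_var_le[OF A]) (simp add: t_def)
  also have "\<dots> = (\<Sum>i\<in>R. A i * (f i - \<mu>)\<^sup>2 * (1 - t * M) - W / t) + \<kappa> * card S * W"
    using pos \<kappa>(1) by (simp add: sum_subtractf sum_distrib_right[symmetric] mult.commute t_def)
  also have "\<dots> \<le> (\<Sum>i\<in>R. \<Sum>j\<in>S. v i j * (f i - f j)\<^sup>2) + dirichlet_form v S f"
    unfolding W_def by (intro add_mono sum_mono cross[unfolded W_def] dirichlet_form_ge_poincare fin \<kappa>(2))
  also have "\<dots> \<le> dirichlet_form v (R \<union> S) f"
    using dirichlet_form_nonneg[of R v f] nonneg by (simp add: dirichlet_form_union[OF fin disj sym])
  finally show ?thesis by (simp add: t_def)
next
  case False
  have "(1 - card R * M / (\<kappa> * card S)) * weighted_var A R f \<le> 0"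
    using False nonneg by (intro mult_nonpos_nonneg weighted_var_nonneg) (auto simp: A_def intro: sum_nonneg)
  also have "\<dots> \<le> dirichlet_form v (R \<union> S) f"
    using nonneg by (intro dirichlet_form_nonneg)
  finally show ?thesis .
qed

section \<open>Critical points of convex edge potentials\<close>

lemma compact_box: "compact {f :: 'a \<Rightarrow> real. \<forall>i. \<bar>f i\<bar> \<le> c}"
proof -
  have "compactin (product_topology (\<lambda>i. euclidean) (UNIV :: 'a set)) (PiE UNIV (\<lambda>i. {- c..c}))"
    by (subst compactin_PiE) auto
  moreover have "PiE UNIV (\<lambda>i. {- c..c}) = {f. \<forall>i::'a. \<bar>f i\<bar> \<le> c}"
    by (auto simp: PiE_def Pi_def abs_le_iff minus_le_iff)
  ultimately show ?thesis by (simp add: euclidean_product_topology)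
qed

lemma one_minus_exp_minus_le_imp_le:
  fixes w c :: real
  assumes "1 - exp (- w) \<le> c" "0 \<le> c" "c \<le> 1 / 2"
  shows "w \<le> 2 * c"
proof -
  have "- c - 2 * c\<^sup>2 \<le> ln (1 - c)"
    using assms by (intro ln_one_minus_pos_lower_bound)
  also have "\<dots> \<le> ln (exp (- w))"
    using assms by (subst ln_le_cancel_iff) auto
  finally have "w \<le> c + 2 * c\<^sup>2" by simp
  moreover have "2 * c\<^sup>2 \<le> c" using assms mult_left_mono[of "2 * c" 1 c] by (simp add: power2_eq_square)
  ultimately show ?thesis by simp
qed

locale edge_potential =
  fixes I :: "'a set" and H G :: "'a \<Rightarrow> 'a \<Rightarrow> real \<Rightarrow> real" and b :: real
  assumes finite_I: "finite I" and b_pos: "b > 0"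
    and potential_deriv: "\<And>i j t. (H i j has_real_derivative G i j t) (at t)"
    and flow_antisym: "\<And>i j t. G j i (- t) = - G i j t"
    and flow_ge: "\<And>i j t. i \<in> I \<Longrightarrow> j \<in> I \<Longrightarrow> i \<noteq> j \<Longrightarrow> 0 \<le> t \<Longrightarrow> (1 - exp (- t)) / b \<le> G i j t"
begin

definition net_flow :: "('a \<Rightarrow> real) \<Rightarrow> 'a \<Rightarrow> real" where
  "net_flow f i = (\<Sum>j\<in>I. G i j (f i - f j))"

definition objective :: "('a \<Rightarrow> real) \<Rightarrow> ('a \<Rightarrow> real) \<Rightarrow> real" where
  "objective x f = (\<Sum>i\<in>I. x i * f i) - (\<Sum>i\<in>I. \<Sum>j\<in>I. H i j (f i - f j)) / 2"

lemma flow_antisym_diff: "G j i (f j - f i) = - G i j (f i - f j)"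
  using flow_antisym[of j i "f i - f j"] by simp

lemma flow_diagonal: "G i i 0 = 0"
  using flow_antisym[of i i 0] by simp

lemma objective_shift:
  assumes "(\<Sum>i\<in>I. x i) = 0" "\<And>i. i \<in> I \<Longrightarrow> g i = f i - c"
  shows "objective x g = objective x f"
proof -
  have "(\<Sum>i\<in>I. x i * g i) = (\<Sum>i\<in>I. x i * f i) - c * (\<Sum>i\<in>I. x i)"
    using assms(2) by (simp add: right_diff_distrib sum_subtractf sum_distrib_left mult.commute)
  then show ?thesis using assms by (simp add: objective_def)
qed

lemma continuous_on_objective: "continuous_on B (objective x)"
proof -
  have potential: "continuous_on UNIV (H i j)" for i j
    by (rule DERIV_continuous_on) (rule potential_deriv)
  have coordinate: "continuous_on B (\<lambda>f. f i)" for i :: 'a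
    by (rule continuous_on_subset[OF continuous_on_product_coordinates]) auto
  show ?thesis
    unfolding objective_def[abs_def]
    by (intro continuous_intros coordinate continuous_on_compose2[OF potential]) auto
qed

lemma objective_directional_deriv:
  "((\<lambda>s. objective x (\<lambda>i. f i + s * \<delta> i)) has_real_derivative (\<Sum>i\<in>I. \<delta> i * (x i - net_flow f i))) (at 0)"
proof -
  have edge: "((\<lambda>s. H i j (f i + s * \<delta> i - (f j + s * \<delta> j))) has_real_derivative
      G i j (f i - f j) * (\<delta> i - \<delta> j)) (at 0)" for i j
  proof -
    have "((\<lambda>s. f i + s * \<delta> i - (f j + s * \<delta> j)) has_real_derivative \<delta> i - \<delta> j) (at 0)"
      by (auto intro!: derivative_eq_intros)
    from DERIV_chain2[OF _ this, of "H i j" "G i j (f i - f j)"] potential_deriv show ?thesis by simp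
  qed
  have "((\<lambda>s. objective x (\<lambda>i. f i + s * \<delta> i)) has_real_derivative
      (\<Sum>i\<in>I. x i * \<delta> i) - (\<Sum>i\<in>I. \<Sum>j\<in>I. G i j (f i - f j) * (\<delta> i - \<delta> j)) / 2) (at 0)"
    unfolding objective_def
    by (intro DERIV_diff DERIV_sum DERIV_cdivide edge) (auto intro!: derivative_eq_intros)
  also have "(\<Sum>i\<in>I. \<Sum>j\<in>I. G i j (f i - f j) * (\<delta> i - \<delta> j)) / 2 = (\<Sum>i\<in>I. \<delta> i * net_flow f i)"
    unfolding net_flow_def by (rule sum_antisymmetric_by_parts) (rule flow_antisym_diff)
  also have "(\<Sum>i\<in>I. x i * \<delta> i) - (\<Sum>i\<in>I. \<delta> i * net_flow f i) = (\<Sum>i\<in>I. \<delta> i * (x i - net_flow f i))"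
    by (simp add: right_diff_distrib sum_subtractf mult.commute)
  finally show ?thesis .
qed

lemma directional_deriv_nonpos_of_maximizer:
  assumes max: "\<And>g. g \<in> B \<Longrightarrow> objective x g \<le> objective x f"
    and "0 < \<epsilon>" and feasible: "\<And>s. 0 < s \<Longrightarrow> s < \<epsilon> \<Longrightarrow> (\<lambda>i. f i + s * \<delta> i) \<in> B"
  shows "(\<Sum>i\<in>I. \<delta> i * (x i - net_flow f i)) \<le> 0"
proof (rule ccontr)
  assume "\<not> ?thesis"
  then obtain d where "d > 0"
      and inc: "\<And>s. 0 < s \<Longrightarrow> s < d \<Longrightarrow> objective x f < objective x (\<lambda>i. f i + s * \<delta> i)"
    using DERIV_pos_inc_right[OF objective_directional_deriv[of x f \<delta>]] by auto
  define s where "s = min d \<epsilon> / 2"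
  have "0 < s" "s < d" "s < \<epsilon>" using \<open>d > 0\<close> \<open>0 < \<epsilon>\<close> by (auto simp: s_def)
  then show False using inc[of s] max[OF feasible[of s]] by simp
qed

lemma net_flow_bounds_of_maximizer:
  fixes f :: "'a \<Rightarrow> real"
  assumes max: "\<And>g. (\<forall>i. \<bar>g i\<bar> \<le> c) \<Longrightarrow> objective x g \<le> objective x f"
    and f: "\<forall>i. \<bar>f i\<bar> \<le> c" and p: "p \<in> I"
  shows "- c < f p \<Longrightarrow> net_flow f p \<le> x p" and "f p < c \<Longrightarrow> x p \<le> net_flow f p"
proof -
  have single: "(\<Sum>i\<in>I. (if i = p then e else 0) * (x i - net_flow f i)) = e * (x p - net_flow f p)" for e
    using finite_I p by (simp add: if_distrib[of "\<lambda>z. z * _"] cong: if_cong)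
  have nonpos: "e * (x p - net_flow f p) \<le> 0"
    if "0 < \<epsilon>" "\<And>s. 0 < s \<Longrightarrow> s < \<epsilon> \<Longrightarrow> \<bar>f p + s * e\<bar> \<le> c" for e \<epsilon>
    unfolding single[symmetric]
  proof (rule directional_deriv_nonpos_of_maximizer[where B = "{g. \<forall>i. \<bar>g i\<bar> \<le> c}"])
    show "(\<lambda>i. f i + s * (if i = p then e else 0)) \<in> {g. \<forall>i. \<bar>g i\<bar> \<le> c}" if "0 < s" "s < \<epsilon>" for s
      using f \<open>\<And>s. 0 < s \<Longrightarrow> s < \<epsilon> \<Longrightarrow> \<bar>f p + s * e\<bar> \<le> c\<close>[OF that] by simp
  qed (use max \<open>0 < \<epsilon>\<close> in auto)
  have "\<bar>f p\<bar> \<le> c" using f by blast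
  then show "net_flow f p \<le> x p" if "- c < f p"
    using nonpos[of "f p + c" "- 1"] that by auto
  show "x p \<le> net_flow f p" if "f p < c"
    using nonpos[of "c - f p" 1] that \<open>\<bar>f p\<bar> \<le> c\<close> by auto
qed

lemma net_flow_diff_ge:
  assumes pq: "p \<in> I" "q \<in> I" and range: "\<And>j. j \<in> I \<Longrightarrow> f q \<le> f j \<and> f j \<le> f p"
  shows "card I * (1 - exp (- (f p - f q))) / b \<le> net_flow f p - net_flow f q"
proof -
  have flow_ge_loop: "(1 - exp (- t)) / b \<le> G i j t" if "i \<in> I" "j \<in> I" "0 \<le> t" "i = j \<Longrightarrow> t = 0" for i j t
  proof (cases "i = j")
    case True
    then show ?thesis using that(4) flow_diagonal[of i] by simp
  next
    case False
    then show ?thesis using that(1-3) by (intro flow_ge)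
  qed
  have "card I * (1 - exp (- (f p - f q))) / b = (\<Sum>j\<in>I. (1 - exp (- (f p - f q))) / b)" by simp
  also have "\<dots> \<le> (\<Sum>j\<in>I. G p j (f p - f j) - G q j (f q - f j))"
  proof (rule sum_mono)
    fix j assume j: "j \<in> I"
    define s t where "s = f p - f j" and "t = f j - f q"
    have st: "0 \<le> s" "0 \<le> t" using range[OF j] by (auto simp: s_def t_def)
    then have "0 \<le> (1 - exp (- s)) * (1 - exp (- t))" by (intro mult_nonneg_nonneg) auto
    then have "1 - exp (- (s + t)) \<le> (1 - exp (- s)) + (1 - exp (- t))"
      by (simp only: minus_add_distrib exp_add) (simp add: algebra_simps)
    then have "(1 - exp (- (s + t))) / b \<le> (1 - exp (- s)) / b + (1 - exp (- t)) / b"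
      using b_pos by (simp add: divide_right_mono flip: add_divide_distrib)
    also have "\<dots> \<le> G p j s + G j q t"
      using pq j st by (intro add_mono flow_ge_loop) (auto simp: s_def t_def)
    finally show "(1 - exp (- (f p - f q))) / b \<le> G p j (f p - f j) - G q j (f q - f j)"
      using flow_antisym_diff[of q j f] by (simp add: s_def t_def)
  qed
  also have "\<dots> = net_flow f p - net_flow f q" by (simp add: net_flow_def sum_subtractf)
  finally show ?thesis .
qed

text \<open>The terms of \<open>net_flow\<close> at the largest and at the smallest value of \<open>f\<close> all have the same sign, so
  the equations at these two vertices alone bound the oscillation. The bound is below the diameter of
  the box over which the objective is maximised, so that no constraint is active after a shift.\<close>

lemma maximizer_osc_le:
  assumes max: "\<And>g. (\<forall>i. \<bar>g i\<bar> \<le> 2) \<Longrightarrow> objective x g \<le> objective x f" and f: "\<forall>i. \<bar>f i\<bar> \<le> 2"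
    and X: "\<And>i. i \<in> I \<Longrightarrow> \<bar>x i\<bar> \<le> X" and small: "4 * b * X \<le> card I" and ne: "I \<noteq> {}"
  shows "osc_le I f (4 * b * X / card I)"
proof -
  have N: "real (card I) > 0" using finite_I ne by (simp add: card_gt_0_iff)
  have image: "finite (f ` I)" "f ` I \<noteq> {}" using finite_I ne by auto
  obtain p where p: "p \<in> I" "f p = Max (f ` I)" using Max_in[OF image] by auto
  obtain q where q: "q \<in> I" "f q = Min (f ` I)" using Min_in[OF image] by auto
  have range: "f q \<le> f j \<and> f j \<le> f p" if "j \<in> I" for j
    using that image p(2) q(2) by auto
  have X0: "0 \<le> X" using X[OF p(1)] by linarith
  have "f p - f q \<le> 4 * b * X / card I"
  proof (cases "f p = f q")
    case False
    then have "f q < f p" using range[OF p(1)] by simp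
    moreover have "\<bar>f p\<bar> \<le> 2" "\<bar>f q\<bar> \<le> 2" using f by auto
    ultimately have "net_flow f p \<le> x p" "x q \<le> net_flow f q"
      using net_flow_bounds_of_maximizer[OF max f] p(1) q(1) by simp_all
    then have "card I * (1 - exp (- (f p - f q))) / b \<le> 2 * X"
      using net_flow_diff_ge[OF p(1) q(1) range] X[OF p(1)] X[OF q(1)] by linarith
    then have "1 - exp (- (f p - f q)) \<le> 2 * b * X / card I"
      using b_pos N by (simp add: field_simps)
    then have "f p - f q \<le> 2 * (2 * b * X / card I)"
      using small N b_pos X0 by (intro one_minus_exp_minus_le_imp_le) (auto simp: field_simps)
    then show ?thesis by simp
  qed (use X0 b_pos in simp)
  then have "\<bar>f i - f j\<bar> \<le> 4 * b * X / card I" if "i \<in> I" "j \<in> I" for i j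
    using range[OF that(1)] range[OF that(2)] by linarith
  then show ?thesis by (simp add: osc_le_def)
qed

lemma critical_point_exists:
  assumes i0: "i0 \<in> I" and x0: "(\<Sum>i\<in>I. x i) = 0" and X: "\<And>i. i \<in> I \<Longrightarrow> \<bar>x i\<bar> \<le> X"
    and small: "4 * b * X \<le> card I"
  obtains f where "f i0 = 0" "osc_le I f (4 * b * X / card I)" "\<And>i. i \<in> I \<Longrightarrow> net_flow f i = x i"
proof -
  define B where "B = {f :: 'a \<Rightarrow> real. \<forall>i. \<bar>f i\<bar> \<le> 2}"
  have "compact B" unfolding B_def by (rule compact_box)
  moreover have "B \<noteq> {}" by (auto simp: B_def intro: exI[of _ "\<lambda>_. 0"])
  ultimately have "\<exists>f\<in>B. \<forall>g\<in>B. objective x g \<le> objective x f"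
    by (rule continuous_attains_sup) (rule continuous_on_objective)
  then obtain f where f: "f \<in> B" and max: "\<And>g. g \<in> B \<Longrightarrow> objective x g \<le> objective x f"
    by blast
  have ne: "I \<noteq> {}" using i0 by auto
  have osc: "osc_le I f (4 * b * X / card I)"
    by (rule maximizer_osc_le[OF _ _ X small ne]) (use f max in \<open>auto simp: B_def\<close>)
  define g where "g i = (if i \<in> I then f i - f i0 else 0)" for i
  have osc_g: "osc_le I g (4 * b * X / card I)" using osc by (simp add: osc_le_def g_def)
  have "4 * b * X / card I \<le> 1" using small finite_I ne by (simp add: card_gt_0_iff)
  then have g1: "\<bar>g i\<bar> \<le> 1" for i
    using osc_leD[OF osc, of i i0] i0 by (auto simp: g_def)
  have "objective x g = objective x f" by (rule objective_shift[OF x0]) (simp add: g_def)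
  then have max_g: "objective x h \<le> objective x g" if "\<forall>i. \<bar>h i\<bar> \<le> 2" for h
    using max[of h] that by (simp add: B_def)
  have "net_flow g i = x i" if "i \<in> I" for i
  proof (rule antisym)
    have box: "\<forall>i. \<bar>g i\<bar> \<le> 2" using g1 by (meson order_trans one_le_numeral)
    have "- 2 < g i" "g i < 2" using g1[of i] by auto
    then show "net_flow g i \<le> x i" "x i \<le> net_flow g i"
      using net_flow_bounds_of_maximizer[OF max_g box that] by auto
  qed
  then show ?thesis using that[of g] osc_g i0 by (simp add: g_def)
qed

end

lemma laplacian_solvable:
  assumes fin: "finite I" and i0: "i0 \<in> I" and b: "b > 0"
    and sym: "\<And>i j. v i j = v j i" and v: "\<And>i j. i \<in> I \<Longrightarrow> j \<in> I \<Longrightarrow> i \<noteq> j \<Longrightarrow> 1 / b \<le> v i j"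
    and x0: "(\<Sum>i\<in>I. x i) = 0" and X: "\<And>i. i \<in> I \<Longrightarrow> \<bar>x i\<bar> \<le> X"
  obtains z where "z i0 = 0" "osc_le I z (4 * b * X / card I)" "\<And>i. i \<in> I \<Longrightarrow> laplacian v I z i = x i"
proof -
  interpret edge_potential I "\<lambda>i j t. v i j * t\<^sup>2 / 2" "\<lambda>i j t. v i j * t" b
  proof
    show "((\<lambda>t. v i j * t\<^sup>2 / 2) has_real_derivative v i j * t) (at t)" for i j t
      by (auto intro!: derivative_eq_intros)
    show "(1 - exp (- t)) / b \<le> v i j * t" if "i \<in> I" "j \<in> I" "i \<noteq> j" "0 \<le> t" for i j t
    proof -
      have "1 - exp (- t) \<le> t" using exp_ge_add_one_self[of "- t"] by linarith
      then have "(1 - exp (- t)) / b \<le> 1 / b * t" using b by (simp add: divide_right_mono)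
      also have "\<dots> \<le> v i j * t" using that by (intro mult_right_mono v)
      finally show ?thesis .
    qed
  qed (use fin b sym in auto)
  define s where "s = card I / (4 * b * X + 1)"
  have "0 \<le> X" using X[OF i0] by linarith
  then have d: "4 * b * X + 1 > 0" using b by (simp add: add_nonneg_pos)
  moreover have "card I > 0" using fin i0 by (auto simp: card_gt_0_iff)
  ultimately have s: "s > 0" "4 * b * (s * X) \<le> card I"
    using b \<open>0 \<le> X\<close> by (simp_all add: s_def field_simps)
  have "(\<Sum>i\<in>I. s * x i) = 0" using x0 by (simp flip: sum_distrib_left)
  moreover have "\<bar>s * x i\<bar> \<le> s * X" if "i \<in> I" for i using X[OF that] s by (simp add: abs_mult)
  ultimately obtain z where z: "z i0 = 0" "osc_le I z (4 * b * (s * X) / card I)"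
      "\<And>i. i \<in> I \<Longrightarrow> net_flow z i = s * x i"
    using critical_point_exists[OF i0 _ _ s(2)] by blast
  show ?thesis
  proof (rule that[of "\<lambda>i. z i / s"])
    show "osc_le I (\<lambda>i. z i / s) (4 * b * X / card I)"
      using z(2) s(1) by (simp add: osc_le_def divide_le_eq mult_ac flip: diff_divide_distrib)
    show "laplacian v I (\<lambda>i. z i / s) i = x i" if "i \<in> I" for i
      using z(3)[OF that, unfolded net_flow_def] s(1)
      by (simp add: laplacian_def mult.commute flip: diff_divide_distrib sum_divide_distrib)
  qed (use z(1) in simp)
qed

section \<open>Expectations under finite product distributions\<close>

lemma integral_abs_diff_le:
  fixes f g h :: "'a \<Rightarrow> real"
  assumes "integrable M f" "integrable M g" "integrable M h"
    and "AE x in M. \<bar>f x - g x\<bar> \<le> h x"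
  shows "\<bar>integral\<^sup>L M f - integral\<^sup>L M g\<bar> \<le> integral\<^sup>L M h"
proof -
  have "\<bar>integral\<^sup>L M f - integral\<^sup>L M g\<bar> = \<bar>integral\<^sup>L M (\<lambda>x. f x - g x)\<bar>"
    using assms by simp
  also have "\<dots> \<le> integral\<^sup>L M (\<lambda>x. \<bar>f x - g x\<bar>)" by (rule integral_abs_bound)
  also have "\<dots> \<le> integral\<^sup>L M h" using assms by (intro integral_mono_AE) auto
  finally show ?thesis .
qed

lemma expectation_pair_pmf:
  fixes h :: "'a \<times> 'b \<Rightarrow> real"
  assumes "finite (set_pmf p)" "finite (set_pmf q)"
  shows "measure_pmf.expectation (pair_pmf p q) h
    = measure_pmf.expectation p (\<lambda>x. measure_pmf.expectation q (\<lambda>y. h (x, y)))"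
proof -
  have "measure_pmf.expectation (pair_pmf p q) h
      = (\<Sum>x\<in>set_pmf p. pmf p x *\<^sub>R measure_pmf.expectation (q \<bind> (\<lambda>y. return_pmf (x, y))) h)"
    unfolding pair_pmf_def by (rule pmf_expectation_bind) (use assms in auto)
  also have "\<dots> = (\<Sum>x\<in>set_pmf p. pmf p x *\<^sub>R measure_pmf.expectation q (\<lambda>y. h (x, y)))"
    by (simp flip: map_pmf_def)
  also have "\<dots> = measure_pmf.expectation p (\<lambda>x. measure_pmf.expectation q (\<lambda>y. h (x, y)))"
    by (rule integral_measure_pmf[symmetric]) (use assms in auto)
  finally show ?thesis .
qed

lemma finite_set_Pi_pmf:
  assumes "finite P" "\<And>p. p \<in> P \<Longrightarrow> finite (set_pmf (q p))"
  shows "finite (set_pmf (Pi_pmf P d q))"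
  by (rule finite_subset[OF set_Pi_pmf_subset'[OF assms(1)]]) (use assms in auto)

lemma expectation_Pi_pmf_insert:
  fixes h :: "('a \<Rightarrow> 'b) \<Rightarrow> real"
  assumes "finite P" "p \<notin> P" "\<And>p'. p' \<in> insert p P \<Longrightarrow> finite (set_pmf (q p'))"
  shows "measure_pmf.expectation (Pi_pmf (insert p P) d q) h
    = measure_pmf.expectation (q p) (\<lambda>y. measure_pmf.expectation (Pi_pmf P d q) (\<lambda>a. h (a(p := y))))"
  using assms by (simp add: Pi_pmf_insert expectation_pair_pmf finite_set_Pi_pmf)

lemma expectation_Pi_pmf_component:
  fixes f :: "'b \<Rightarrow> real"
  assumes "finite P" "p \<in> P"
  shows "measure_pmf.expectation (Pi_pmf P d q) (\<lambda>a. f (a p)) = measure_pmf.expectation (q p) f"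
proof -
  have "measure_pmf.expectation (Pi_pmf P d q) (\<lambda>a. f (a p))
      = measure_pmf.expectation (map_pmf (\<lambda>a. a p) (Pi_pmf P d q)) f" by simp
  then show ?thesis using assms by (simp add: Pi_pmf_component)
qed

section \<open>One-dimensional Gaussian smoothing\<close>

lemma gaussian_third_derivative_bound: "\<bar>(12 * z - 8 * z ^ 3) * exp (- z\<^sup>2)\<bar> \<le> (20::real)"
proof -
  define t where "t = \<bar>z\<bar>"
  have t: "0 \<le> t" "z\<^sup>2 = t\<^sup>2" by (simp_all add: t_def)
  have exp_ge: "1 + t\<^sup>2 + (t\<^sup>2)\<^sup>2 / 2 \<le> exp (t\<^sup>2)" by (rule exp_lower_Taylor_quadratic) simp
  have "0 \<le> (t - 1)\<^sup>2" "0 \<le> (t\<^sup>2 - t)\<^sup>2" by simp_all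
  then have powers: "2 * t \<le> t\<^sup>2 + 1" "2 * t ^ 3 \<le> (t\<^sup>2)\<^sup>2 + t\<^sup>2"
    by (simp_all add: algebra_simps power2_eq_square power3_eq_cube)
  have "\<bar>12 * z - 8 * z ^ 3\<bar> \<le> 12 * t + 8 * t ^ 3"
    unfolding t_def power_abs[symmetric] by (simp add: abs_mult)
  also have "\<dots> \<le> 20 * exp (t\<^sup>2)"
    using exp_ge powers t(1) zero_le_power2[of "t\<^sup>2"] zero_le_power2[of t] by linarith
  finally show ?thesis by (simp add: abs_mult t(2) exp_minus field_simps)
qed

lemma gaussian_taylor_space:
  fixes z h :: real
  shows "\<bar>exp (- (z + h)\<^sup>2) - exp (- z\<^sup>2) * (1 - 2 * z * h + (2 * z\<^sup>2 - 1) * h\<^sup>2)\<bar> \<le> 4 * \<bar>h\<bar> ^ 3"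
proof -
  define u where "u s = exp (- (z + s)\<^sup>2)" for s
  define D where "D m s = (if m = 0 then u s else if m = 1 then - 2 * (z + s) * u s
       else if m = 2 then (4 * (z + s)\<^sup>2 - 2) * u s else (12 * (z + s) - 8 * (z + s) ^ 3) * u s)"
    for m :: nat and s
  have u: "(u has_real_derivative - 2 * (z + s) * u s) (at s)" for s
    unfolding u_def[abs_def] by (auto intro!: derivative_eq_intros simp: algebra_simps)
  have "(D m has_real_derivative D (Suc m) s) (at s)" if "m < 3" for m s
  proof -
    consider "m = 0" | "m = 1" | "m = 2" using \<open>m < 3\<close> by linarith
    then show ?thesis
    proof cases
      case 1
      then show ?thesis using u by (simp add: D_def[abs_def])
    qed (simp add: D_def[abs_def], auto intro!: derivative_eq_intros u
          simp: algebra_simps power2_eq_square power3_eq_cube)+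
  qed
  moreover have "D 0 = u" by (simp add: D_def fun_eq_iff)
  ultimately obtain s where s: "u h = (\<Sum>m<3. D m 0 / fact m * h ^ m) + D 3 s / fact 3 * h ^ 3"
    using Maclaurin_bi_le[of D u 3 h] by blast
  have "(\<Sum>m<3. D m 0 / fact m * h ^ m) = exp (- z\<^sup>2) * (1 - 2 * z * h + (2 * z\<^sup>2 - 1) * h\<^sup>2)"
    by (simp add: D_def u_def eval_nat_numeral field_simps)
  then have "\<bar>u h - exp (- z\<^sup>2) * (1 - 2 * z * h + (2 * z\<^sup>2 - 1) * h\<^sup>2)\<bar> = \<bar>D 3 s\<bar> * (\<bar>h\<bar> ^ 3 / fact 3)"
    by (simp add: s abs_mult power_abs)
  also have "\<dots> \<le> 24 * (\<bar>h\<bar> ^ 3 / fact 3)"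
    using gaussian_third_derivative_bound[of "z + s"] by (intro mult_right_mono) (auto simp: D_def u_def)
  also have "\<dots> = 4 * \<bar>h\<bar> ^ 3" by (simp add: eval_nat_numeral)
  finally show ?thesis by (simp add: u_def)
qed

text \<open>The expectation of \<open>exp (- (z + G)\<^sup>2)\<close> for a centred Gaussian \<open>G\<close> of variance \<open>s\<close>.\<close>

definition smoothed_bump :: "real \<Rightarrow> real \<Rightarrow> real" where
  "smoothed_bump z s = exp (- z\<^sup>2 / (1 + 2 * s)) / sqrt (1 + 2 * s)"

lemma smoothed_bump_0 [simp]: "smoothed_bump z 0 = exp (- z\<^sup>2)"
  by (simp add: smoothed_bump_def)

lemma gaussian_second_time_derivative_bound:
  fixes x :: real
  assumes "0 \<le> x"
  shows "\<bar>exp (- x) * (x\<^sup>2 - 3 * x + 3 / 4)\<bar> \<le> 6"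
proof -
  have "1 + x + x\<^sup>2 / 2 \<le> exp x" by (rule exp_lower_Taylor_quadratic[OF assms])
  moreover have "\<bar>x\<^sup>2 - 3 * x + 3 / 4\<bar> \<le> x\<^sup>2 + 3 * x + 3 / 4"
    using assms zero_le_power2[of x] by linarith
  ultimately have "\<bar>x\<^sup>2 - 3 * x + 3 / 4\<bar> \<le> 6 * exp x" using assms zero_le_power2[of x] by linarith
  then show ?thesis by (simp add: abs_mult exp_minus field_simps)
qed

lemma abs_second_time_derivative_le:
  fixes z t :: real
  assumes "1 \<le> t"
  shows "\<bar>exp (- z\<^sup>2 / t) / sqrt t * ((z\<^sup>2 / t\<^sup>2 - 1 / (2 * t))\<^sup>2 - 2 * z\<^sup>2 / t ^ 3 + 1 / (2 * t\<^sup>2))\<bar> \<le> 6"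
proof -
  let ?x = "z\<^sup>2 / t"
  have "(z\<^sup>2 / t\<^sup>2 - 1 / (2 * t))\<^sup>2 - 2 * z\<^sup>2 / t ^ 3 + 1 / (2 * t\<^sup>2) = (?x\<^sup>2 - 3 * ?x + 3 / 4) / t\<^sup>2"
    using assms by (simp add: field_simps power2_eq_square power3_eq_cube)
  then have "exp (- z\<^sup>2 / t) / sqrt t * ((z\<^sup>2 / t\<^sup>2 - 1 / (2 * t))\<^sup>2 - 2 * z\<^sup>2 / t ^ 3 + 1 / (2 * t\<^sup>2))
      = exp (- ?x) * (?x\<^sup>2 - 3 * ?x + 3 / 4) / (sqrt t * t\<^sup>2)"
    by simp
  moreover have "\<bar>exp (- ?x) * (?x\<^sup>2 - 3 * ?x + 3 / 4) / (sqrt t * t\<^sup>2)\<bar> \<le> 6"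
  proof -
    have "1 * 1 \<le> sqrt t * t\<^sup>2" using assms by (intro mult_mono) auto
    then have "\<bar>exp (- ?x) * (?x\<^sup>2 - 3 * ?x + 3 / 4)\<bar> \<le> 6 * \<bar>sqrt t * t\<^sup>2\<bar>"
      using gaussian_second_time_derivative_bound[of ?x] assms by simp
    then show ?thesis
      unfolding abs_divide using assms by (intro mult_imp_div_pos_le) auto
  qed
  ultimately show ?thesis by (simp only:)
qed

lemma gaussian_taylor_time:
  fixes z s :: real
  assumes "0 \<le> s"
  shows "\<bar>smoothed_bump z s - exp (- z\<^sup>2) * (1 + (2 * z\<^sup>2 - 1) * s)\<bar> \<le> 12 * s\<^sup>2"
proof (cases "s = 0")
  case False
  define f where "f N = exp (- z\<^sup>2 / N) / sqrt N" for N
  define D where "D m N = (if m = 0 then f N else if m = 1 then f N * (z\<^sup>2 / N\<^sup>2 - 1 / (2 * N))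
        else f N * ((z\<^sup>2 / N\<^sup>2 - 1 / (2 * N))\<^sup>2 - 2 * z\<^sup>2 / N ^ 3 + 1 / (2 * N\<^sup>2)))"
    for m :: nat and N
  have f: "(f has_real_derivative f N * (z\<^sup>2 / N\<^sup>2 - 1 / (2 * N))) (at N)" if "1 \<le> N" for N
    unfolding f_def[abs_def] using that
    by (auto intro!: derivative_eq_intros simp: field_simps power2_eq_square)
  have "((\<lambda>N. f N * (z\<^sup>2 / N\<^sup>2 - 1 / (2 * N))) has_real_derivative D 2 N) (at N)" if "1 \<le> N" for N
  proof -
    have "((\<lambda>N. z\<^sup>2 / N\<^sup>2 - 1 / (2 * N)) has_real_derivative - 2 * z\<^sup>2 / N ^ 3 + 1 / (2 * N\<^sup>2)) (at N)"
      using that by (auto intro!: derivative_eq_intros simp: field_simps power2_eq_square power3_eq_cube)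
    from DERIV_mult[OF f[OF that] this] show ?thesis
      by (simp add: D_def power2_eq_square algebra_simps)
  qed
  with f have "\<forall>m t. m < 2 \<and> 1 \<le> t \<and> t \<le> 1 + 2 * s \<longrightarrow> (D m has_real_derivative D (Suc m) t) (at t)"
    by (auto simp: D_def[abs_def] less_2_cases_iff numeral_2_eq_2)
  moreover have "D 0 = f" by (simp add: D_def fun_eq_iff)
  ultimately have "\<exists>t>1. t < 1 + 2 * s \<and>
      f (1 + 2 * s) = (\<Sum>m<2. D m 1 / fact m * (1 + 2 * s - 1) ^ m) + D 2 t / fact 2 * (1 + 2 * s - 1) ^ 2"
    using False assms by (intro Taylor_up[of 2 D f 1]) simp_all
  then obtain t where t: "1 < t"
      "f (1 + 2 * s) = (\<Sum>m<2. D m 1 / fact m * (1 + 2 * s - 1) ^ m) + D 2 t / fact 2 * (1 + 2 * s - 1) ^ 2"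
    by blast
  have "(\<Sum>m<2. D m 1 / fact m * (1 + 2 * s - 1) ^ m) = exp (- z\<^sup>2) * (1 + (2 * z\<^sup>2 - 1) * s)"
    by (simp add: D_def f_def numeral_2_eq_2 algebra_simps)
  then have "smoothed_bump z s - exp (- z\<^sup>2) * (1 + (2 * z\<^sup>2 - 1) * s) = D 2 t * (2 * s\<^sup>2)"
    using t(2) by (simp add: smoothed_bump_def f_def power2_eq_square)
  moreover have "\<bar>D 2 t\<bar> \<le> 6"
    using abs_second_time_derivative_le[of t z] t(1) by (simp add: D_def f_def)
  ultimately show ?thesis
    using mult_right_mono[of "\<bar>D 2 t\<bar>" 6 "2 * s\<^sup>2"] by (simp add: abs_mult mult.commute)
qed simp

lemma gaussian_replacement_step:
  fixes p :: "'a pmf" and \<xi> :: "'a \<Rightarrow> real"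
  assumes fin: "finite (set_pmf p)" and mean: "measure_pmf.expectation p \<xi> = 0"
    and bound: "\<And>a. a \<in> set_pmf p \<Longrightarrow> \<bar>\<xi> a\<bar> \<le> B"
    and var: "measure_pmf.expectation p (\<lambda>a. (\<xi> a)\<^sup>2) = v"
  shows "\<bar>measure_pmf.expectation p (\<lambda>a. exp (- (z + \<xi> a)\<^sup>2)) - smoothed_bump z v\<bar> \<le> (4 * B + 12 * B\<^sup>2) * v"
proof -
  have int: "integrable p f" for f :: "'a \<Rightarrow> real" by (rule integrable_measure_pmf_finite[OF fin])
  obtain a0 where "a0 \<in> set_pmf p" using set_pmf_not_empty by fast
  then have B: "0 \<le> B" using bound[of a0] by linarith
  have v0: "0 \<le> v" unfolding var[symmetric] by (rule integral_nonneg_AE) simp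
  have "measure_pmf.expectation p (\<lambda>a. (\<xi> a)\<^sup>2) \<le> measure_pmf.expectation p (\<lambda>a. B\<^sup>2)"
    using bound B by (intro integral_mono_AE int) (auto simp: AE_measure_pmf_iff abs_le_square_iff[symmetric])
  then have vB: "v \<le> B\<^sup>2" by (simp add: var)
  define g where "g h = exp (- z\<^sup>2) * (1 - 2 * z * h + (2 * z\<^sup>2 - 1) * h\<^sup>2)" for h
  have "\<bar>measure_pmf.expectation p (\<lambda>a. exp (- (z + \<xi> a)\<^sup>2)) - measure_pmf.expectation p (\<lambda>a. g (\<xi> a))\<bar>
      \<le> measure_pmf.expectation p (\<lambda>a. 4 * B * (\<xi> a)\<^sup>2)"
  proof (intro integral_abs_diff_le int, unfold AE_measure_pmf_iff, intro ballI)
    fix a assume a: "a \<in> set_pmf p"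
    have "\<bar>exp (- (z + \<xi> a)\<^sup>2) - g (\<xi> a)\<bar> \<le> 4 * \<bar>\<xi> a\<bar> ^ 3"
      unfolding g_def by (rule gaussian_taylor_space)
    also have "\<dots> = 4 * (\<bar>\<xi> a\<bar> * (\<xi> a)\<^sup>2)" by (simp add: power3_eq_cube power2_eq_square)
    also have "\<dots> \<le> 4 * (B * (\<xi> a)\<^sup>2)" using bound[OF a] by (intro mult_left_mono mult_right_mono) auto
    finally show "\<bar>exp (- (z + \<xi> a)\<^sup>2) - g (\<xi> a)\<bar> \<le> 4 * B * (\<xi> a)\<^sup>2" by simp
  qed
  also have "\<dots> = 4 * B * v" by (simp add: var)
  finally have space: "\<bar>measure_pmf.expectation p (\<lambda>a. exp (- (z + \<xi> a)\<^sup>2))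
      - measure_pmf.expectation p (\<lambda>a. g (\<xi> a))\<bar> \<le> 4 * B * v" .
  have "measure_pmf.expectation p (\<lambda>a. g (\<xi> a)) = exp (- z\<^sup>2) * (1 + (2 * z\<^sup>2 - 1) * v)"
    unfolding g_def by (simp add: int mean var)
  moreover have "12 * v\<^sup>2 \<le> 12 * B\<^sup>2 * v"
    unfolding power2_eq_square[of v] using vB v0 by (simp add: mult_right_mono)
  ultimately show ?thesis
    using space gaussian_taylor_time[OF v0, of z] by (simp add: distrib_right)
qed

section \<open>Laplace transform of a weighted variance\<close>

definition smoothed_weight :: "real \<Rightarrow> ('a \<Rightarrow> real) \<Rightarrow> ('a \<Rightarrow> real) \<Rightarrow> 'a \<Rightarrow> real" where
  "smoothed_weight l A T i = A i / (1 + 2 * l * A i * T i)"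

text \<open>The expectation of \<open>exp (- l * weighted_var A R (f + G))\<close> for a centred Gaussian vector \<open>G\<close> with
  independent coordinates of variances \<open>T i\<close>. Working with this formula avoids Gaussian vectors.\<close>

definition smoothed_laplace ::
  "real \<Rightarrow> ('a \<Rightarrow> real) \<Rightarrow> 'a set \<Rightarrow> ('a \<Rightarrow> real) \<Rightarrow> ('a \<Rightarrow> real) \<Rightarrow> real" where
  "smoothed_laplace l A R T f = (let w = smoothed_weight l A T in
     sqrt ((\<Prod>i\<in>R. w i / A i) * sum A R / sum w R) * exp (- l * weighted_var w R f))"

lemma smoothed_weight_bounds:
  assumes "0 \<le> l" "0 < A i" "0 \<le> T i"
  shows "0 < smoothed_weight l A T i" "smoothed_weight l A T i \<le> A i"
proof -
  have "1 \<le> 1 + 2 * l * A i * T i" using assms by simp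
  moreover from this have "0 < 1 + 2 * l * A i * T i" by linarith
  ultimately show "0 < smoothed_weight l A T i" "smoothed_weight l A T i \<le> A i"
    using assms by (simp_all add: smoothed_weight_def divide_le_eq mult_le_cancel_left1)
qed

lemma smoothed_weight_add:
  assumes "0 \<le> l" "0 < A i" "0 \<le> T i"
  shows "smoothed_weight l A (T(i := T i + s)) i
    = smoothed_weight l A T i / (1 + 2 * l * smoothed_weight l A T i * s)"
proof -
  define d where "d = 1 + 2 * l * A i * T i"
  have "d > 0" using assms by (simp add: d_def add_pos_nonneg)
  then have "1 + 2 * l * (A i / d) * s = (d + 2 * l * A i * s) / d" by (simp add: field_simps)
  moreover have "1 + 2 * l * A i * (T i + s) = d + 2 * l * A i * s" by (simp add: d_def algebra_simps)
  ultimately show ?thesis using \<open>d > 0\<close> by (simp add: smoothed_weight_def flip: d_def)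
qed

lemma prod_ratio_mult_sum_le:
  fixes A w :: "'a \<Rightarrow> real"
  assumes "finite R" and w: "\<And>i. i \<in> R \<Longrightarrow> 0 < w i" "\<And>i. i \<in> R \<Longrightarrow> w i \<le> A i"
  shows "(\<Prod>i\<in>R. w i / A i) * sum A R \<le> sum w R"
proof -
  have A: "0 < A i" if "i \<in> R" for i using w[OF that] by linarith
  have prod_le: "(\<Prod>j\<in>R. w j / A j) \<le> w i / A i" if i: "i \<in> R" for i
  proof -
    have "(\<Prod>j\<in>R. w j / A j) = w i / A i * (\<Prod>j\<in>R - {i}. w j / A j)"
      using assms(1) i by (simp add: prod.remove)
    also have "\<dots> \<le> w i / A i * 1"
      using w A i by (intro mult_left_mono prod_le_1) (auto simp: divide_le_eq intro!: divide_nonneg_pos less_imp_le)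
    finally show ?thesis by simp
  qed
  have "(\<Prod>j\<in>R. w j / A j) * sum A R = (\<Sum>i\<in>R. A i * (\<Prod>j\<in>R. w j / A j))"
    by (subst mult.commute) (rule sum_distrib_right)
  also have "\<dots> \<le> (\<Sum>i\<in>R. A i * (w i / A i))"
    using A prod_le by (intro sum_mono mult_left_mono) (auto intro: less_imp_le)
  also have "\<dots> = sum w R" using A by (intro sum.cong refl) force
  finally show ?thesis .
qed

lemma smoothed_laplace_insert:
  fixes A T f :: "'a \<Rightarrow> real"
  assumes fin: "finite R" "i \<notin> R" and ne: "R \<noteq> {}" and l: "0 < l"
    and A: "\<And>j. j \<in> insert i R \<Longrightarrow> 0 < A j" and T: "\<And>j. j \<in> insert i R \<Longrightarrow> 0 \<le> T j"
  defines "w \<equiv> smoothed_weight l A T"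
  defines "h \<equiv> w i * sum w R / (w i + sum w R)"
  shows "smoothed_laplace l A (insert i R) T f
    = sqrt (h * ((\<Prod>j\<in>R. w j / A j) * sum A (insert i R) / (A i * sum w R)))
      * exp (- l * weighted_var w R f) * exp (- l * h * (f i - weighted_mean w R f)\<^sup>2)"
proof -
  have w: "0 < w j" if "j \<in> insert i R" for j
    unfolding w_def using that l A T by (intro smoothed_weight_bounds) auto
  then have W: "0 < sum w R" using fin ne by (intro sum_pos) auto
  have "(\<Prod>j\<in>insert i R. w j / A j) * sum A (insert i R) / sum w (insert i R)
      = h * ((\<Prod>j\<in>R. w j / A j) * sum A (insert i R) / (A i * sum w R))"
    using fin W w[of i] A[of i] by (simp add: h_def mult_ac)
  moreover have "- l * weighted_var w (insert i R) f
      = - l * weighted_var w R f + - l * h * (f i - weighted_mean w R f)\<^sup>2"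
    using weighted_var_insert[of R i w f] fin W w[of i] by (simp add: h_def algebra_simps)
  ultimately show ?thesis
    unfolding smoothed_laplace_def Let_def w_def[symmetric] by (simp flip: exp_add)
qed

lemma harmonic_weight_flow:
  fixes w W l s :: real
  assumes "0 < w" "0 < W" "0 \<le> l" "0 \<le> s"
  defines "h \<equiv> w * W / (w + W)"
  shows "w / (1 + 2 * l * w * s) * W / (w / (1 + 2 * l * w * s) + W) = h / (1 + 2 * l * h * s)"
proof -
  define e where "e = 1 + 2 * l * w * s"
  have "0 < e" using assms by (simp add: e_def add_pos_nonneg)
  then have "w / e + W = (w + W * e) / e" by (simp add: field_simps)
  then have "w / e * W / (w / e + W) = w * W / (w + W * e)" using \<open>0 < e\<close> by simp
  also have "w + W * e = (w + W) * (1 + 2 * l * h * s)"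
    using assms by (simp add: e_def field_simps)
  finally show ?thesis by (simp only: e_def h_def divide_divide_eq_left)
qed

text \<open>As a function of one coordinate and of its variance, \<open>smoothed_laplace\<close> is a multiple of the
  one-dimensional heat flow \<open>smoothed_bump\<close>.\<close>

lemma smoothed_laplace_insert_flow:
  fixes A T f :: "'a \<Rightarrow> real"
  assumes fin: "finite R" "i \<notin> R" and ne: "R \<noteq> {}" and l: "0 < l" and s: "0 \<le> s"
    and A: "\<And>j. j \<in> insert i R \<Longrightarrow> 0 < A j" and T: "\<And>j. j \<in> insert i R \<Longrightarrow> 0 \<le> T j"
  defines "w \<equiv> smoothed_weight l A T"
  defines "h \<equiv> w i * sum w R / (w i + sum w R)"
  shows "smoothed_laplace l A (insert i R) (T(i := T i + s)) (f(i := y))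
    = sqrt (h * ((\<Prod>j\<in>R. w j / A j) * sum A (insert i R) / (A i * sum w R)))
      * exp (- l * weighted_var w R f) * smoothed_bump (sqrt (l * h) * (y - weighted_mean w R f)) (l * h * s)"
proof -
  let ?w = "smoothed_weight l A (T(i := T i + s))"
  define Q where "Q = (\<Prod>j\<in>R. w j / A j) * sum A (insert i R) / (A i * sum w R)"
  have w: "0 < w j" if "j \<in> insert i R" for j
    unfolding w_def using that l A T by (intro smoothed_weight_bounds) auto
  then have W: "0 < sum w R" using fin ne by (intro sum_pos) auto
  then have h: "0 < h" using w[of i] by (simp add: h_def)
  have wR: "?w j = w j" if "j \<in> R" for j using that fin by (auto simp: smoothed_weight_def w_def)
  have wi: "?w i = w i / (1 + 2 * l * w i * s)"
    unfolding w_def using l A[of i] T[of i] by (intro smoothed_weight_add) auto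
  have sums: "sum ?w R = sum w R" "(\<Prod>j\<in>R. ?w j / A j) = (\<Prod>j\<in>R. w j / A j)"
    using wR by (simp_all cong: sum.cong prod.cong)
  have fR: "(f(i := y)) j = f j" if "j \<in> R" for j using that fin by auto
  then have mean: "weighted_mean ?w R (f(i := y)) = weighted_mean w R f"
    using wR by (simp add: weighted_mean_def cong: sum.cong)
  have var: "weighted_var ?w R (f(i := y)) = weighted_var w R f"
    unfolding weighted_var_def mean using wR fR by (intro sum.cong) simp_all
  have harmonic: "?w i * sum w R / (?w i + sum w R) = h / (1 + 2 * l * h * s)"
    unfolding wi h_def using w W l s by (intro harmonic_weight_flow) auto
  have T': "0 \<le> (T(i := T i + s)) j" if "j \<in> insert i R" for j
    using T[OF that] T[of i] s by simp
  have "smoothed_laplace l A (insert i R) (T(i := T i + s)) (f(i := y))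
      = sqrt (h / (1 + 2 * l * h * s) * Q) * exp (- l * weighted_var w R f)
        * exp (- l * (h / (1 + 2 * l * h * s)) * (y - weighted_mean w R f)\<^sup>2)"
    using smoothed_laplace_insert[of R i l A "T(i := T i + s)" "f(i := y)", OF fin ne l A T']
    by (simp only: sums mean var harmonic Q_def fun_upd_same)
  also have "sqrt (h / (1 + 2 * l * h * s) * Q) = sqrt (h * Q) / sqrt (1 + 2 * l * h * s)"
    by (simp flip: real_sqrt_divide)
  also have "- l * (h / (1 + 2 * l * h * s)) * (y - weighted_mean w R f)\<^sup>2
      = - (sqrt (l * h) * (y - weighted_mean w R f))\<^sup>2 / (1 + 2 * (l * h * s))"
    using l h by (simp add: power_mult_distrib mult.assoc)
  finally show ?thesis by (simp add: smoothed_bump_def Q_def mult_ac fun_upd_def)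
qed

lemma smoothed_laplace_bounds:
  assumes R: "finite R" "R \<noteq> {}" and l: "0 < l"
    and A: "\<And>i. i \<in> R \<Longrightarrow> 0 < A i" and T: "\<And>i. i \<in> R \<Longrightarrow> 0 \<le> T i"
  shows "0 \<le> smoothed_laplace l A R T f" "smoothed_laplace l A R T f \<le> 1"
proof -
  define w where "w = smoothed_weight l A T"
  have w: "0 < w i" "w i \<le> A i" if "i \<in> R" for i
    unfolding w_def using that l A T by (auto intro: smoothed_weight_bounds)
  have pos: "0 < sum w R" "0 < sum A R" using R w A by (auto intro!: sum_pos)
  have K: "smoothed_laplace l A R T f
      = sqrt ((\<Prod>i\<in>R. w i / A i) * sum A R / sum w R) * exp (- l * weighted_var w R f)"
    by (simp add: smoothed_laplace_def w_def Let_def)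
  show "0 \<le> smoothed_laplace l A R T f"
    unfolding K using w A pos
    by (intro mult_nonneg_nonneg real_sqrt_ge_zero divide_nonneg_nonneg prod_nonneg) (auto simp: less_imp_le)
  have "(\<Prod>i\<in>R. w i / A i) * sum A R / sum w R \<le> 1"
    using prod_ratio_mult_sum_le[OF R(1) w] pos by (simp add: divide_le_eq)
  moreover have "0 \<le> weighted_var w R f" using w by (intro weighted_var_nonneg) (auto intro: less_imp_le)
  ultimately show "smoothed_laplace l A R T f \<le> 1"
    unfolding K using l by (intro mult_le_one) auto
qed

lemma smoothed_laplace_coordinate:
  fixes A T f :: "'a \<Rightarrow> real"
  assumes R: "finite R" "i \<in> R" "2 \<le> card R" and l: "0 < l"
    and A: "\<And>j. j \<in> R \<Longrightarrow> 0 < A j" and T: "\<And>j. j \<in> R \<Longrightarrow> 0 \<le> T j"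
  obtains M c y0 where "0 \<le> M" "M \<le> 1" "0 \<le> c" "c\<^sup>2 \<le> l * A i"
    "\<And>y s. 0 \<le> s \<Longrightarrow> smoothed_laplace l A R (T(i := T i + s)) (f(i := y)) = M * smoothed_bump (c * (y - y0)) (c\<^sup>2 * s)"
proof -
  define S where "S = R - {i}"
  have "R \<noteq> {i}" using R(3) by auto
  then have S: "R = insert i S" "finite S" "i \<notin> S" "S \<noteq> {}" using R by (auto simp: S_def)
  define w where "w = smoothed_weight l A T"
  define h where "h = w i * sum w S / (w i + sum w S)"
  define c y0 where "c = sqrt (l * h)" and "y0 = weighted_mean w S f"
  define M where "M = sqrt (h * ((\<Prod>j\<in>S. w j / A j) * sum A R / (A i * sum w S))) * exp (- l * weighted_var w S f)"
  have w: "0 < w j" "w j \<le> A j" if "j \<in> R" for j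
    unfolding w_def using that l A T by (auto intro: smoothed_weight_bounds)
  have pos: "0 < sum w S" "0 < w i" using S w R(2) by (auto intro!: sum_pos)
  then have h: "0 < h" "h \<le> w i" by (simp_all add: h_def divide_le_eq)
  then have "l * h \<le> l * A i" using w(2)[OF R(2)] l by (intro mult_left_mono) auto
  moreover have c: "0 \<le> c" "c\<^sup>2 = l * h" using l h by (simp_all add: c_def)
  ultimately have "c\<^sup>2 \<le> l * A i" by simp
  moreover have flow: "smoothed_laplace l A R (T(i := T i + s)) (f(i := y)) = M * smoothed_bump (c * (y - y0)) (c\<^sup>2 * s)"
    if "0 \<le> s" for y s
    using smoothed_laplace_insert_flow[OF S(2,3,4) l that, of A T f y, folded S(1) w_def, folded h_def, OF A T]
    unfolding c(2) unfolding M_def c_def y0_def by simp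
  moreover have "M = smoothed_laplace l A R T (f(i := y0))" using flow[of 0 y0] by simp
  then have "0 \<le> M" "M \<le> 1" using smoothed_laplace_bounds[of R l A T] R l A T by auto
  ultimately show ?thesis using c(1) by (intro that)
qed

lemma smoothed_laplace_step:
  fixes A T f :: "'a \<Rightarrow> real" and q :: "'b pmf" and \<xi> :: "'b \<Rightarrow> real"
  assumes R: "finite R" "i \<in> R" "2 \<le> card R" and l: "0 < l"
    and A: "\<And>j. j \<in> R \<Longrightarrow> 0 < A j" and T: "\<And>j. j \<in> R \<Longrightarrow> 0 \<le> T j"
    and q: "finite (set_pmf q)" "measure_pmf.expectation q \<xi> = 0"
      "\<And>a. a \<in> set_pmf q \<Longrightarrow> sqrt (l * A i) * \<bar>\<xi> a\<bar> \<le> B" "measure_pmf.expectation q (\<lambda>a. (\<xi> a)\<^sup>2) = v"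
  shows "\<bar>measure_pmf.expectation q (\<lambda>a. smoothed_laplace l A R T (f(i := f i + \<xi> a)))
     - smoothed_laplace l A R (T(i := T i + v)) f\<bar> \<le> (4 * B + 12 * B\<^sup>2) * (l * A i * v)"
proof (rule smoothed_laplace_coordinate[of R i l A T f])
  fix M c y0
  assume M: "0 \<le> M" "M \<le> 1" and c: "0 \<le> c" "c\<^sup>2 \<le> l * A i"
    and flow: "\<And>y s. 0 \<le> s \<Longrightarrow>
       smoothed_laplace l A R (T(i := T i + s)) (f(i := y)) = M * smoothed_bump (c * (y - y0)) (c\<^sup>2 * s)"
  have v: "0 \<le> v" unfolding q(4)[symmetric] by (rule integral_nonneg_AE) simp
  define z where "z = c * (f i - y0)"
  have before: "smoothed_laplace l A R T (f(i := f i + \<xi> a)) = M * exp (- (z + c * \<xi> a)\<^sup>2)" for a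
    using flow[of 0 "f i + \<xi> a"] by (simp add: z_def algebra_simps)
  have after: "smoothed_laplace l A R (T(i := T i + v)) f = M * smoothed_bump z (c\<^sup>2 * v)"
    using flow[OF v, of "f i"] by (simp add: z_def)
  have bound: "\<bar>c * \<xi> a\<bar> \<le> B" if "a \<in> set_pmf q" for a
  proof -
    have "c \<le> sqrt (l * A i)" using c by (simp add: real_le_rsqrt)
    then have "c * \<bar>\<xi> a\<bar> \<le> sqrt (l * A i) * \<bar>\<xi> a\<bar>" by (rule mult_right_mono) simp
    then show ?thesis using q(3)[OF that] c(1) by (simp add: abs_mult)
  qed
  obtain a0 where "a0 \<in> set_pmf q" using set_pmf_not_empty by fast
  then have B: "0 \<le> B" using bound[of a0] by linarith
  have "\<bar>measure_pmf.expectation q (\<lambda>a. smoothed_laplace l A R T (f(i := f i + \<xi> a)))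
      - smoothed_laplace l A R (T(i := T i + v)) f\<bar>
      = M * \<bar>measure_pmf.expectation q (\<lambda>a. exp (- (z + c * \<xi> a)\<^sup>2)) - smoothed_bump z (c\<^sup>2 * v)\<bar>"
    unfolding before after integral_mult_right_zero right_diff_distrib[symmetric]
    using M(1) by (simp only: abs_mult abs_of_nonneg)
  also have "\<dots> \<le> 1 * ((4 * B + 12 * B\<^sup>2) * (c\<^sup>2 * v))"
    using M q bound by (intro mult_mono gaussian_replacement_step) (auto simp: power_mult_distrib)
  also have "\<dots> \<le> (4 * B + 12 * B\<^sup>2) * (l * A i * v)"
    using c B v by (simp add: mult_left_mono mult_right_mono)
  finally show ?thesis .
qed (use R l A T in auto)

definition fibre_sum :: "('p \<Rightarrow> 'a) \<Rightarrow> 'p set \<Rightarrow> ('p \<Rightarrow> real) \<Rightarrow> 'a \<Rightarrow> real" where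
  "fibre_sum \<iota> P x i = (\<Sum>p\<in>{p \<in> P. \<iota> p = i}. x p)"

lemma fibre_sum_empty [simp]: "fibre_sum \<iota> {} x i = 0"
  by (simp add: fibre_sum_def)

lemma fibre_sum_insert:
  assumes "finite P" "p \<notin> P"
  shows "fibre_sum \<iota> (insert p P) x i = fibre_sum \<iota> P x i + (if \<iota> p = i then x p else 0)"
proof -
  have "{p' \<in> insert p P. \<iota> p' = i} = (if \<iota> p = i then insert p {p' \<in> P. \<iota> p' = i} else {p' \<in> P. \<iota> p' = i})"
    by auto
  then show ?thesis using assms by (simp add: fibre_sum_def)
qed

lemma fibre_sum_cong:
  assumes "\<And>p. p \<in> P \<Longrightarrow> \<iota> p = i \<Longrightarrow> x p = y p"
  shows "fibre_sum \<iota> P x i = fibre_sum \<iota> P y i"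
  using assms by (simp add: fibre_sum_def)

lemma sum_mult_fibre_sum:
  assumes "finite R" "finite P" "\<And>p. p \<in> P \<Longrightarrow> \<iota> p \<in> R"
  shows "(\<Sum>i\<in>R. A i * fibre_sum \<iota> P x i) = (\<Sum>p\<in>P. A (\<iota> p) * x p)"
proof -
  have "(\<Sum>i\<in>R. A i * fibre_sum \<iota> P x i) = (\<Sum>i\<in>R. \<Sum>p\<in>{p \<in> P. \<iota> p = i}. A (\<iota> p) * x p)"
    by (simp add: fibre_sum_def sum_distrib_left)
  also have "\<dots> = (\<Sum>p\<in>P. A (\<iota> p) * x p)" using assms by (intro sum.group) auto
  finally show ?thesis .
qed

lemma expectation_fibre_sum_insert:
  fixes F :: "('a \<Rightarrow> real) \<Rightarrow> real" and q :: "'p \<Rightarrow> 'b pmf"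
  assumes P: "finite P" "p \<notin> P" and q: "\<And>p'. p' \<in> insert p P \<Longrightarrow> finite (set_pmf (q p'))"
  shows "measure_pmf.expectation (Pi_pmf (insert p P) d q) (\<lambda>a. F (\<lambda>i. f i + fibre_sum \<iota> (insert p P) (\<lambda>p. \<xi> p (a p)) i))
    = measure_pmf.expectation (q p) (\<lambda>y. measure_pmf.expectation (Pi_pmf P d q)
        (\<lambda>a. F (\<lambda>i. (f(\<iota> p := f (\<iota> p) + \<xi> p y)) i + fibre_sum \<iota> P (\<lambda>p. \<xi> p (a p)) i)))"
proof -
  have "f i + fibre_sum \<iota> (insert p P) (\<lambda>p'. \<xi> p' ((a(p := y)) p')) i
      = (f(\<iota> p := f (\<iota> p) + \<xi> p y)) i + fibre_sum \<iota> P (\<lambda>p. \<xi> p (a p)) i" for a y i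
  proof -
    have "fibre_sum \<iota> P (\<lambda>p'. \<xi> p' ((a(p := y)) p')) i = fibre_sum \<iota> P (\<lambda>p. \<xi> p (a p)) i"
      using P(2) by (intro fibre_sum_cong) auto
    then show ?thesis by (simp add: fibre_sum_insert[OF P])
  qed
  then show ?thesis by (simp only: expectation_Pi_pmf_insert[OF P q])
qed

lemma smoothed_laplace_lindeberg:
  fixes A :: "'a \<Rightarrow> real" and q :: "'p \<Rightarrow> 'b pmf" and \<xi> :: "'p \<Rightarrow> 'b \<Rightarrow> real" and \<iota> :: "'p \<Rightarrow> 'a"
  assumes R: "finite R" "2 \<le> card R" and l: "0 < l" and A: "\<And>i. i \<in> R \<Longrightarrow> 0 < A i"
    and T: "\<And>i. i \<in> R \<Longrightarrow> 0 \<le> T i"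
    and P: "finite P" "\<And>p. p \<in> P \<Longrightarrow> \<iota> p \<in> R" "\<And>p. p \<in> P \<Longrightarrow> finite (set_pmf (q p))"
    and mean: "\<And>p. p \<in> P \<Longrightarrow> measure_pmf.expectation (q p) (\<xi> p) = 0"
    and bound: "\<And>p a. p \<in> P \<Longrightarrow> a \<in> set_pmf (q p) \<Longrightarrow> sqrt (l * A (\<iota> p)) * \<bar>\<xi> p a\<bar> \<le> B"
    and var: "\<And>p. p \<in> P \<Longrightarrow> measure_pmf.expectation (q p) (\<lambda>a. (\<xi> p a)\<^sup>2) = v p"
  shows "\<bar>measure_pmf.expectation (Pi_pmf P d q)
        (\<lambda>a. smoothed_laplace l A R T (\<lambda>i. f i + fibre_sum \<iota> P (\<lambda>p. \<xi> p (a p)) i))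
      - smoothed_laplace l A R (\<lambda>i. T i + fibre_sum \<iota> P v i) f\<bar>
    \<le> (4 * B + 12 * B\<^sup>2) * (l * (\<Sum>p\<in>P. A (\<iota> p) * v p))"
  using P mean bound var
proof (induction P arbitrary: f rule: finite_induct)
  case empty
  then show ?case by simp
next
  case (insert p P)
  let ?K = "smoothed_laplace l A R" and ?\<epsilon> = "(4 * B + 12 * B\<^sup>2) * (l * (\<Sum>p\<in>P. A (\<iota> p) * v p))"
  define g where "g y = f(\<iota> p := f (\<iota> p) + \<xi> p y)" for y
  define S where "S a = fibre_sum \<iota> P (\<lambda>p. \<xi> p (a p))" for a
  define V where "V i = T i + fibre_sum \<iota> P v i" for i
  have v: "0 \<le> v p'" if "p' \<in> insert p P" for p'
    unfolding insert.prems(5)[OF that, symmetric] by (rule integral_nonneg_AE) simp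
  have V: "0 \<le> V j" if "j \<in> R" for j
    unfolding V_def fibre_sum_def using T[OF that] v by (intro add_nonneg_nonneg sum_nonneg) auto
  have condition: "measure_pmf.expectation (Pi_pmf (insert p P) d q)
        (\<lambda>a. ?K T (\<lambda>i. f i + fibre_sum \<iota> (insert p P) (\<lambda>p. \<xi> p (a p)) i))
      = measure_pmf.expectation (q p) (\<lambda>y. measure_pmf.expectation (Pi_pmf P d q) (\<lambda>a. ?K T (\<lambda>i. g y i + S a i)))"
    unfolding g_def S_def using insert.hyps insert.prems(2) by (intro expectation_fibre_sum_insert) auto
  have "\<bar>measure_pmf.expectation (q p) (\<lambda>y. measure_pmf.expectation (Pi_pmf P d q) (\<lambda>a. ?K T (\<lambda>i. g y i + S a i)))
      - measure_pmf.expectation (q p) (\<lambda>y. ?K V (g y))\<bar> \<le> measure_pmf.expectation (q p) (\<lambda>y. ?\<epsilon>)"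
  proof (intro integral_abs_diff_le integrable_measure_pmf_finite AE_I2)
    show "\<bar>measure_pmf.expectation (Pi_pmf P d q) (\<lambda>a. ?K T (\<lambda>i. g y i + S a i)) - ?K V (g y)\<bar> \<le> ?\<epsilon>" for y
      unfolding S_def V_def using insert.prems by (intro insert.IH) auto
  qed (use insert.prems in auto)
  then have others: "\<bar>measure_pmf.expectation (q p) (\<lambda>y. measure_pmf.expectation (Pi_pmf P d q) (\<lambda>a. ?K T (\<lambda>i. g y i + S a i)))
      - measure_pmf.expectation (q p) (\<lambda>y. ?K V (g y))\<bar> \<le> ?\<epsilon>" by simp
  have this_one: "\<bar>measure_pmf.expectation (q p) (\<lambda>y. ?K V (g y)) - ?K (V(\<iota> p := V (\<iota> p) + v p)) f\<bar>
      \<le> (4 * B + 12 * B\<^sup>2) * (l * A (\<iota> p) * v p)"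
    unfolding g_def using insert.prems by (intro smoothed_laplace_step R l A V) auto
  have V_insert: "(\<lambda>i. T i + fibre_sum \<iota> (insert p P) v i) = V(\<iota> p := V (\<iota> p) + v p)"
    using insert.hyps by (auto simp: V_def fibre_sum_insert)
  have budget: "(4 * B + 12 * B\<^sup>2) * (l * (\<Sum>p\<in>insert p P. A (\<iota> p) * v p))
      = (4 * B + 12 * B\<^sup>2) * (l * A (\<iota> p) * v p) + ?\<epsilon>"
    unfolding sum.insert[OF insert.hyps] by (simp only: distrib_left mult.assoc)
  show ?case
    unfolding condition V_insert budget using others this_one by linarith
qed

lemma smoothed_laplace_zero_variance:
  assumes "\<And>i. i \<in> R \<Longrightarrow> 0 < A i" "0 < sum A R"
  shows "smoothed_laplace l A R (\<lambda>_. 0) f = exp (- l * weighted_var A R f)"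
proof -
  have "(\<Prod>i\<in>R. A i / A i) = 1" using assms(1) by (intro prod.neutral) force
  moreover have "smoothed_weight l A (\<lambda>_. 0) = A" by (simp add: fun_eq_iff smoothed_weight_def)
  ultimately show ?thesis using assms(2) by (simp add: smoothed_laplace_def)
qed

lemma smoothed_laplace_standard:
  assumes R: "finite R" "R \<noteq> {}" and A: "\<And>i. i \<in> R \<Longrightarrow> 0 < A i" and l: "0 < l"
    and T: "\<And>i. i \<in> R \<Longrightarrow> T i = 1 / A i"
  shows "smoothed_laplace l A R T (\<lambda>_. 0) = (1 + 2 * l) powr (- real (card R - 1) / 2)"
proof -
  define g where "g = 1 + 2 * l"
  have g: "0 < g" using l by (simp add: g_def)
  have w: "smoothed_weight l A T i = A i / g" if "i \<in> R" for i
    using A[OF that] T[OF that] by (simp add: smoothed_weight_def g_def)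
  have S: "0 < sum A R" using R A by (intro sum_pos)
  have "(\<Prod>i\<in>R. smoothed_weight l A T i / A i) = (\<Prod>i\<in>R. 1 / g)"
    using w A by (intro prod.cong refl) force
  moreover have "sum (smoothed_weight l A T) R = sum A R / g"
    unfolding sum_divide_distrib using w by (intro sum.cong) auto
  moreover have "weighted_var w R (\<lambda>_. 0) = 0" for w :: "'a \<Rightarrow> real"
    by (simp add: weighted_var_def weighted_mean_def)
  ultimately have "smoothed_laplace l A R T (\<lambda>_. 0) = sqrt ((1 / g) ^ card R * g)"
    using S by (simp add: smoothed_laplace_def)
  also have "(1 / g) ^ card R * g = g powr (- real (card R - 1))"
  proof -
    obtain m where "card R = Suc m" using R by (cases "card R") auto
    then show ?thesis using g by (simp add: power_one_over powr_minus powr_realpow inverse_eq_divide)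
  qed
  also have "sqrt \<dots> = (g powr (- real (card R - 1))) powr (1 / 2)" by (simp add: powr_half_sqrt)
  also have "\<dots> = g powr (- real (card R - 1) / 2)" by (simp add: powr_powr)
  finally show ?thesis by (simp add: g_def)
qed

theorem weighted_var_laplace_approx:
  fixes A :: "'a \<Rightarrow> real" and q :: "'p \<Rightarrow> 'b pmf" and \<xi> :: "'p \<Rightarrow> 'b \<Rightarrow> real" and \<iota> :: "'p \<Rightarrow> 'a"
  assumes R: "finite R" "2 \<le> card R" and l: "0 < l" and A: "\<And>i. i \<in> R \<Longrightarrow> 0 < A i"
    and P: "finite P" "\<And>p. p \<in> P \<Longrightarrow> \<iota> p \<in> R" "\<And>p. p \<in> P \<Longrightarrow> finite (set_pmf (q p))"
    and mean: "\<And>p. p \<in> P \<Longrightarrow> measure_pmf.expectation (q p) (\<xi> p) = 0"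
    and bound: "\<And>p a. p \<in> P \<Longrightarrow> a \<in> set_pmf (q p) \<Longrightarrow> sqrt (l * A (\<iota> p)) * \<bar>\<xi> p a\<bar> \<le> B"
    and var: "\<And>p. p \<in> P \<Longrightarrow> measure_pmf.expectation (q p) (\<lambda>a. (\<xi> p a)\<^sup>2) = v p"
    and total: "\<And>i. i \<in> R \<Longrightarrow> fibre_sum \<iota> P v i = 1 / A i"
  shows "\<bar>measure_pmf.expectation (Pi_pmf P d q) (\<lambda>a. exp (- l * weighted_var A R (fibre_sum \<iota> P (\<lambda>p. \<xi> p (a p)))))
      - (1 + 2 * l) powr (- real (card R - 1) / 2)\<bar> \<le> (4 * B + 12 * B\<^sup>2) * (l * card R)"
proof -
  have ne: "R \<noteq> {}" using R(2) by auto
  then have S: "0 < sum A R" using R A by (intro sum_pos)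
  have "(\<Sum>p\<in>P. A (\<iota> p) * v p) = (\<Sum>i\<in>R. A i * fibre_sum \<iota> P v i)"
    by (rule sum_mult_fibre_sum[OF R(1) P(1,2), symmetric])
  also have "\<dots> = (\<Sum>i\<in>R. 1)" using A total by (intro sum.cong refl) force
  finally have budget: "(\<Sum>p\<in>P. A (\<iota> p) * v p) = card R" by simp
  have start: "smoothed_laplace l A R (\<lambda>_. 0) f = exp (- l * weighted_var A R f)" for f
    by (rule smoothed_laplace_zero_variance[OF A S])
  have final: "smoothed_laplace l A R (fibre_sum \<iota> P v) (\<lambda>_. 0) = (1 + 2 * l) powr (- real (card R - 1) / 2)"
    by (rule smoothed_laplace_standard[OF R(1) ne A l total])
  show ?thesis
    using smoothed_laplace_lindeberg[where T = "\<lambda>_. 0" and f = "\<lambda>_. 0" and A = A and \<iota> = \<iota> and q = q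
        and \<xi> = \<xi> and v = v and d = d, OF R l A order_refl P mean bound var]
    by (simp only: add_0 start final budget)
qed

section \<open>Laplace transforms and weak convergence\<close>

lemma continuous_on_minus_ln_compactified:
  fixes f :: "real \<Rightarrow> real"
  assumes cont: "continuous_on {0..} f" and lim: "(f \<longlongrightarrow> L) at_top"
  shows "continuous_on {0..1} (\<lambda>s. if s = 0 then L else f (- ln s))" (is "continuous_on _ ?F")
  unfolding continuous_on_eq_continuous_within
proof
  fix s :: real assume s: "s \<in> {0..1}"
  show "continuous (at s within {0..1}) ?F"
  proof (cases "s = 0")
    case True
    have "filterlim (\<lambda>s. - ln s) at_top (at_right (0::real))"
      using ln_at_0 by (simp add: filterlim_uminus_at_bot)
    then have "((\<lambda>s. f (- ln s)) \<longlongrightarrow> L) (at_right 0)"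
      by (rule filterlim_compose[OF lim])
    then have "(?F \<longlongrightarrow> L) (at_right 0)"
      by (rule Lim_transform_eventually) (auto simp: eventually_at_right_less eventually_at_filter)
    then show ?thesis using True by (simp add: continuous_within at_within_Icc_at_right)
  next
    case False
    then have "s > 0" using s by simp
    have "continuous_on {0<..1} (\<lambda>s. f (- ln s))"
      by (intro continuous_on_compose2[OF cont] continuous_intros) auto
    then have "continuous_on {0<..1} ?F" by (rule continuous_on_eq) auto
    then have "continuous (at s within {0<..1}) ?F"
      using s \<open>s > 0\<close> by (auto simp: continuous_on_eq_continuous_within)
    moreover have "at s within {0<..1} = at s within {0..1}"
      using \<open>s > 0\<close> by (intro at_within_nhd[of s "{0<..}"]) auto
    ultimately show ?thesis by simp
  qed
qed

lemma exp_polynomial_approximation: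
  fixes f :: "real \<Rightarrow> real"
  assumes cont: "continuous_on {0..} f" and lim: "(f \<longlongrightarrow> L) at_top" and e: "e > 0"
  obtains c :: "nat \<Rightarrow> real" and m :: nat
    where "\<And>u. 0 \<le> u \<Longrightarrow> \<bar>f u - (\<Sum>i\<le>m. c i * exp (- u) ^ i)\<bar> < e"
proof -
  define F where "F s = (if s = 0 then L else f (- ln s))" for s
  have "continuous_on {0..1} F"
    unfolding F_def[abs_def] by (rule continuous_on_minus_ln_compactified[OF cont lim])
  then obtain g where g: "real_polynomial_function g" "\<And>s. s \<in> {0..1} \<Longrightarrow> \<bar>F s - g s\<bar> < e"
    using Stone_Weierstrass_real_polynomial_function[of "{0..1::real}" F e] e by auto
  obtain c m where "g = (\<lambda>s. \<Sum>i\<le>m. c i * s ^ i)"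
    using g(1) by (auto simp: real_polynomial_function_iff_sum)
  then show ?thesis using that[of c m] g(2)[of "exp (- _)"] by (simp add: F_def)
qed

lemma cts_step_continuous_vanishing:
  assumes "x < y"
  shows "continuous_on {0..} (cts_step x y)" "(cts_step x y \<longlongrightarrow> 0) at_top"
proof -
  show "continuous_on {0..} (cts_step x y)"
    using uniformly_continuous_imp_continuous[OF cts_step_uniformly_continuous[OF assms]]
    by (rule continuous_on_subset) simp
  show "(cts_step x y \<longlongrightarrow> 0) at_top"
    using assms by (intro tendsto_eventually eventually_at_top_linorderI[of y]) (simp add: cts_step_def)
qed

lemma tendsto_integral_of_uniform_approximation:
  fixes f :: "real \<Rightarrow> real"
  assumes N: "\<And>n. prob_space (N n)" and M: "prob_space M"
    and f: "\<And>n. integrable (N n) f" "integrable M f"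
    and approx: "\<And>e. 0 < e \<Longrightarrow> \<exists>g. (\<forall>n. integrable (N n) g \<and> (AE x in N n. \<bar>f x - g x\<bar> \<le> e)) \<and>
      integrable M g \<and> (AE x in M. \<bar>f x - g x\<bar> \<le> e) \<and> (\<lambda>n. integral\<^sup>L (N n) g) \<longlonglongrightarrow> integral\<^sup>L M g"
  shows "(\<lambda>n. integral\<^sup>L (N n) f) \<longlonglongrightarrow> integral\<^sup>L M f"
proof (rule LIMSEQ_I)
  fix e :: real assume "e > 0"
  then obtain g where g: "\<And>n. integrable (N n) g" "\<And>n. AE x in N n. \<bar>f x - g x\<bar> \<le> e / 4"
      "integrable M g" "AE x in M. \<bar>f x - g x\<bar> \<le> e / 4" "(\<lambda>n. integral\<^sup>L (N n) g) \<longlonglongrightarrow> integral\<^sup>L M g"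
    using approx[of "e / 4"] by auto
  have near: "\<bar>integral\<^sup>L P f - integral\<^sup>L P g\<bar> \<le> e / 4"
    if "prob_space P" "integrable P f" "integrable P g" "AE x in P. \<bar>f x - g x\<bar> \<le> e / 4" for P
  proof -
    interpret P: prob_space P by fact
    have "\<bar>integral\<^sup>L P f - integral\<^sup>L P g\<bar> \<le> integral\<^sup>L P (\<lambda>x. e / 4)"
      using that by (intro integral_abs_diff_le) auto
    then show ?thesis by (simp add: P.prob_space)
  qed
  obtain n0 where n0: "\<And>n. n \<ge> n0 \<Longrightarrow> norm (integral\<^sup>L (N n) g - integral\<^sup>L M g) < e / 4"
    using LIMSEQ_D[OF g(5), of "e / 4"] \<open>e > 0\<close> by auto
  have "norm (integral\<^sup>L (N n) f - integral\<^sup>L M f) < e" if "n \<ge> n0" for n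
    using n0[OF that] near[OF N[of n] f(1) g(1) g(2)] near[OF M f(2) g(3,4)] \<open>e > 0\<close>
    unfolding real_norm_def by linarith
  then show "\<exists>n0. \<forall>n\<ge>n0. norm (integral\<^sup>L (N n) f - integral\<^sup>L M f) < e" by blast
qed

lemma (in real_distribution) integrable_exp_minus_power:
  fixes i :: nat
  assumes "AE u in M. 0 \<le> u"
  shows "integrable M (\<lambda>u. exp (- u) ^ i)"
  using assms by (intro integrable_const_bound[of _ 1]) (auto elim!: eventually_mono intro: power_le_one)

theorem weak_conv_m_of_laplace:
  assumes N: "\<And>n. real_distribution (N n)" and M: "real_distribution M"
    and nonneg: "\<And>n. AE x in N n. 0 \<le> x" "AE x in M. 0 \<le> x"
    and laplace: "\<And>l::nat. l > 0 \<Longrightarrow>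
      (\<lambda>n. integral\<^sup>L (N n) (\<lambda>x. exp (- real l * x))) \<longlonglongrightarrow> integral\<^sup>L M (\<lambda>x. exp (- real l * x))"
  shows "weak_conv_m N M"
proof (rule integral_cts_step_conv_imp_weak_conv[OF N M])
  fix x y :: real assume "x < y"
  note powers = real_distribution.integrable_exp_minus_power[OF N nonneg(1)]
    real_distribution.integrable_exp_minus_power[OF M nonneg(2)]
  have moments: "(\<lambda>n. integral\<^sup>L (N n) (\<lambda>u. exp (- u) ^ i)) \<longlonglongrightarrow> integral\<^sup>L M (\<lambda>u. exp (- u) ^ i)" for i :: nat
  proof (cases "i = 0")
    case True
    then show ?thesis
      using real_distribution.axioms(1)[OF N] real_distribution.axioms(1)[OF M] by (simp add: prob_space.prob_space)
  next
    case False
    then show ?thesis using laplace[of i] by (simp add: mult.commute flip: exp_of_nat_mult)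
  qed
  show "(\<lambda>n. integral\<^sup>L (N n) (cts_step x y)) \<longlonglongrightarrow> integral\<^sup>L M (cts_step x y)"
  proof (rule tendsto_integral_of_uniform_approximation)
    fix e :: real assume "e > 0"
    obtain c m where approx: "\<And>u. 0 \<le> u \<Longrightarrow> \<bar>cts_step x y u - (\<Sum>i\<le>m. c i * exp (- u) ^ i)\<bar> < e"
      using exp_polynomial_approximation[OF cts_step_continuous_vanishing[OF \<open>x < y\<close>] \<open>e > 0\<close>] by metis
    have limit: "(\<lambda>n. \<Sum>i\<le>m. c i * integral\<^sup>L (N n) (\<lambda>u. exp (- u) ^ i))
        \<longlonglongrightarrow> (\<Sum>i\<le>m. c i * integral\<^sup>L M (\<lambda>u. exp (- u) ^ i))"
      by (intro tendsto_intros moments)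
    let ?g = "\<lambda>u. \<Sum>i\<le>m. c i * exp (- u) ^ i"
    have "(\<lambda>n. integral\<^sup>L (N n) ?g) \<longlonglongrightarrow> integral\<^sup>L M ?g"
      using limit powers by (simp add: Bochner_Integration.integral_sum)
    moreover have "AE u in P. \<bar>cts_step x y u - ?g u\<bar> \<le> e" if "AE u in P. 0 \<le> u" for P
      using that by eventually_elim (simp add: approx less_imp_le)
    moreover have "integrable (N n) ?g" "integrable M ?g" for n
      by (intro Bochner_Integration.integrable_sum integrable_mult_right powers)+
    ultimately show "\<exists>g. (\<forall>n. integrable (N n) g \<and> (AE u in N n. \<bar>cts_step x y u - g u\<bar> \<le> e)) \<and>
        integrable M g \<and> (AE u in M. \<bar>cts_step x y u - g u\<bar> \<le> e) \<and> (\<lambda>n. integral\<^sup>L (N n) g) \<longlonglongrightarrow> integral\<^sup>L M g"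
      using nonneg by (intro exI[of _ ?g]) auto
  qed (use N M \<open>x < y\<close> in \<open>auto intro: real_distribution.integrable_cts_step real_distribution.axioms(1)\<close>)
qed

corollary weak_conv_m_pmf_of_laplace:
  fixes \<mu> :: "nat \<Rightarrow> real pmf"
  assumes M: "real_distribution M" "AE x in M. 0 \<le> x"
    and nonneg: "\<And>n x. x \<in> set_pmf (\<mu> n) \<Longrightarrow> 0 \<le> x"
    and laplace: "\<And>l::nat. l > 0 \<Longrightarrow> (\<lambda>n. measure_pmf.expectation (\<mu> n) (\<lambda>x. exp (- real l * x)))
      \<longlonglongrightarrow> integral\<^sup>L M (\<lambda>x. exp (- real l * x))"
  shows "weak_conv_m (\<lambda>n. measure_pmf (\<mu> n)) M"
proof -
  define N where "N n = distr (measure_pmf (\<mu> n)) borel (\<lambda>x. x)" for n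
  have "weak_conv_m N M"
  proof (rule weak_conv_m_of_laplace[OF _ M(1) _ M(2)])
    show "real_distribution (N n)" for n
      unfolding N_def by (intro prob_space.real_distribution_distr prob_space_measure_pmf) simp
    show "AE x in N n. 0 \<le> x" for n
      unfolding N_def using nonneg by (subst AE_distr_iff) (auto simp: AE_measure_pmf_iff)
    show "(\<lambda>n. integral\<^sup>L (N n) (\<lambda>x. exp (- real l * x))) \<longlonglongrightarrow> integral\<^sup>L M (\<lambda>x. exp (- real l * x))"
      if "l > 0" for l :: nat
      using laplace[OF that] by (simp add: N_def integral_distr)
  qed
  moreover have "cdf (N n) = cdf (measure_pmf (\<mu> n))" for n
    by (simp add: cdf_def N_def measure_distr fun_eq_iff)
  ultimately show ?thesis by (simp add: weak_conv_m_def)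
qed

lemma abs_exp_minus_diff_le:
  fixes l x y :: real
  assumes "0 \<le> l" "0 \<le> x" "0 \<le> y"
  shows "\<bar>exp (- l * x) - exp (- l * y)\<bar> \<le> min 1 (l * \<bar>x - y\<bar>)"
proof -
  have ordered: "\<bar>exp (- l * s) - exp (- l * t)\<bar> \<le> min 1 (l * \<bar>s - t\<bar>)" if "0 \<le> s" "s \<le> t" for s t
  proof -
    have "exp (- l * s) - exp (- l * t) = exp (- l * s) * (1 - exp (- (l * (t - s))))"
      by (simp add: right_diff_distrib flip: exp_add)
    also have "\<dots> \<le> 1 * min 1 (l * (t - s))"
      using assms(1) that exp_ge_add_one_self[of "- (l * (t - s))"] by (intro mult_mono) auto
    finally have "exp (- l * s) - exp (- l * t) \<le> min 1 (l * (t - s))" by simp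
    moreover have "exp (- l * t) \<le> exp (- l * s)" using assms(1) that by (simp add: mult_left_mono)
    ultimately show ?thesis using that by simp
  qed
  show ?thesis
    using ordered[of x y] ordered[of y x] assms by (cases "x \<le> y") (simp_all add: abs_minus_commute)
qed

lemma expectation_exp_diff_le:
  fixes X Y :: "'a \<Rightarrow> real"
  assumes fin: "finite (set_pmf p)" and l: "0 \<le> l" and C: "0 \<le> C"
    and nonneg: "\<And>a. a \<in> set_pmf p \<Longrightarrow> 0 \<le> X a" "\<And>a. a \<in> set_pmf p \<Longrightarrow> 0 \<le> Y a"
    and close: "\<And>a. a \<in> set_pmf p \<Longrightarrow> a \<notin> E \<Longrightarrow> \<bar>X a - Y a\<bar> \<le> C"
  shows "\<bar>measure_pmf.expectation p (\<lambda>a. exp (- l * X a)) - measure_pmf.expectation p (\<lambda>a. exp (- l * Y a))\<bar>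
    \<le> l * C + measure_pmf.prob p E"
proof -
  have int: "integrable p f" for f :: "'a \<Rightarrow> real" by (rule integrable_measure_pmf_finite[OF fin])
  have "\<bar>measure_pmf.expectation p (\<lambda>a. exp (- l * X a)) - measure_pmf.expectation p (\<lambda>a. exp (- l * Y a))\<bar>
      \<le> measure_pmf.expectation p (\<lambda>a. l * C + indicator E a)"
  proof (intro integral_abs_diff_le int, unfold AE_measure_pmf_iff, intro ballI)
    fix a assume a: "a \<in> set_pmf p"
    note min = abs_exp_minus_diff_le[OF l nonneg[OF a]]
    show "\<bar>exp (- l * X a) - exp (- l * Y a)\<bar> \<le> l * C + indicator E a"
    proof (cases "a \<in> E")
      case True
      moreover have "0 \<le> l * C" using l C by simp
      ultimately show ?thesis using min by simp
    next
      case False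
      then have "l * \<bar>X a - Y a\<bar> \<le> l * C" using close[OF a] l by (intro mult_left_mono)
      then show ?thesis using min False by simp
    qed
  qed
  also have "\<dots> = l * C + measure_pmf.prob p E" by (simp add: int)
  finally show ?thesis .
qed

section \<open>The chi-square distribution\<close>

lemma nn_integral_powr_mult_exp:
  assumes s: "0 < s" and c: "0 < c"
  shows "(\<integral>\<^sup>+x. ennreal (indicator {0..} x * x powr (s - 1) * exp (- c * x)) \<partial>lborel) = ennreal (Gamma s / c powr s)"
    (is "?I = _")
proof -
  let ?f = "\<lambda>t::real. indicator {0..} t * t powr (s - 1) / exp t"
  have scale: "c * ?f (c * x) = c powr s * (indicator {0..} x * x powr (s - 1) * exp (- c * x))" for x
  proof (cases "0 < x")
    case True
    have "c * (c * x) powr (s - 1) = c powr s * x powr (s - 1)" using c True by (simp add: powr_mult powr_diff)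
    then show ?thesis using c True by (simp add: exp_minus field_simps)
  next
    case False
    then show ?thesis using c by (cases "x = 0") (auto simp: indicator_def zero_le_mult_iff)
  qed
  have "ennreal (Gamma s) = (\<integral>\<^sup>+t. ennreal (?f t) \<partial>lborel)"
    by (rule Gamma_conv_nn_integral_real[OF s])
  also have "\<dots> = ennreal c * (\<integral>\<^sup>+x. ennreal (?f (c * x)) \<partial>lborel)"
    using nn_integral_real_affine[of "\<lambda>t. ennreal (?f t)" c 0] c by simp
  also have "\<dots> = (\<integral>\<^sup>+x. ennreal (c * ?f (c * x)) \<partial>lborel)"
    using c by (subst nn_integral_cmult[symmetric]) (simp_all flip: ennreal_mult')
  also have "\<dots> = (\<integral>\<^sup>+x. ennreal (c powr s) * ennreal (indicator {0..} x * x powr (s - 1) * exp (- c * x)) \<partial>lborel)"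
    unfolding scale by (simp add: ennreal_mult')
  also have "\<dots> = ennreal (c powr s) * ?I" by (rule nn_integral_cmult) simp
  finally have Gamma_eq: "ennreal (Gamma s) = ennreal (c powr s) * ?I" .
  have "ennreal (Gamma s / c powr s) = ennreal (1 / c powr s) * ennreal (Gamma s)"
    by (simp flip: ennreal_mult')
  also have "\<dots> = ennreal (1 / c powr s) * (ennreal (c powr s) * ?I)" by (simp only: Gamma_eq)
  also have "\<dots> = ennreal (1 / c powr s * c powr s) * ?I"
    by (simp only: mult.assoc[symmetric] ennreal_mult'[symmetric] divide_nonneg_nonneg zero_le_one powr_ge_zero)
  finally show ?thesis using c by simp
qed

lemma chi_square_density_nonneg: "m > 0 \<Longrightarrow> chi_square_density m x \<ge> 0"
  using Gamma_real_pos[of "real m / 2"] by (simp add: chi_square_density_def)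

lemma chi_square_density_measurable [measurable]: "chi_square_density m \<in> borel_measurable borel"
  by (simp add: chi_square_density_def[abs_def])

lemma nn_integral_chi_square_laplace:
  assumes m: "m > 0" and l: "l \<ge> 0"
  shows "(\<integral>\<^sup>+x. ennreal (chi_square_density m x * exp (- l * x)) \<partial>lborel) = ennreal ((1 + 2 * l) powr (- real m / 2))"
proof -
  define s where "s = real m / 2"
  define C where "C = 2 powr s * Gamma s"
  have s: "s > 0" using m by (simp add: s_def)
  then have G: "Gamma s > 0" by (rule Gamma_real_pos)
  then have C: "C > 0" by (simp add: C_def)
  have "chi_square_density m x * exp (- l * x) = 1 / C * (indicator {0..} x * x powr (s - 1) * exp (- (1 / 2 + l) * x))" for x
  proof (cases "x > 0")
    case True
    have "- x / 2 + - l * x = - (1 / 2 + l) * x" by (simp add: algebra_simps)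
    then have "exp (- x / 2) * exp (- l * x) = exp (- (1 / 2 + l) * x)" by (simp only: exp_add[symmetric])
    then show ?thesis
      using True by (simp add: chi_square_density_def C_def s_def[symmetric] mult.assoc)
  qed (auto simp: chi_square_density_def indicator_def)
  then have "(\<integral>\<^sup>+x. ennreal (chi_square_density m x * exp (- l * x)) \<partial>lborel)
      = (\<integral>\<^sup>+x. ennreal (1 / C) * ennreal (indicator {0..} x * x powr (s - 1) * exp (- (1 / 2 + l) * x)) \<partial>lborel)"
    using C by (simp add: ennreal_mult'[symmetric])
  also have "\<dots> = ennreal (1 / C) * (\<integral>\<^sup>+x. ennreal (indicator {0..} x * x powr (s - 1) * exp (- (1 / 2 + l) * x)) \<partial>lborel)"
    by (rule nn_integral_cmult) simp
  also have "\<dots> = ennreal (1 / C * (Gamma s / (1 / 2 + l) powr s))"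
    using C G s l by (subst nn_integral_powr_mult_exp) (simp_all flip: ennreal_mult')
  also have "1 / C * (Gamma s / (1 / 2 + l) powr s) = 1 / (2 powr s * (1 / 2 + l) powr s)"
    using G by (simp add: C_def)
  also have "2 powr s * (1 / 2 + l) powr s = (1 + 2 * l) powr s"
    using l by (simp add: distrib_left flip: powr_mult)
  also have "1 / (1 + 2 * l) powr s = (1 + 2 * l) powr (- s)" by (simp add: powr_minus_divide)
  finally show ?thesis by (simp add: s_def)
qed

lemma real_distribution_chi_square:
  assumes "m > 0"
  shows "real_distribution (chi_square m)"
proof -
  have "emeasure (chi_square m) UNIV = 1"
    using nn_integral_chi_square_laplace[OF assms, of 0] by (simp add: chi_square_def emeasure_density)
  then have "prob_space (chi_square m)" by (intro prob_spaceI) (simp add: chi_square_def)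
  then show ?thesis
    by (simp add: real_distribution_def real_distribution_axioms_def chi_square_def)
qed

lemma AE_chi_square_nonneg: "AE x in chi_square m. 0 \<le> x"
  unfolding chi_square_def by (subst AE_density) (auto simp: chi_square_density_def)

lemma chi_square_laplace:
  assumes m: "m > 0" and l: "l \<ge> 0"
  shows "integral\<^sup>L (chi_square m) (\<lambda>x. exp (- l * x)) = (1 + 2 * l) powr (- real m / 2)"
proof -
  have "integral\<^sup>L (chi_square m) (\<lambda>x. exp (- l * x)) = (\<integral>x. chi_square_density m x * exp (- l * x) \<partial>lborel)"
    unfolding chi_square_def using chi_square_density_nonneg[OF m] by (subst integral_density) auto
  also have "\<dots> = (1 + 2 * l) powr (- real m / 2)"
    using nn_integral_chi_square_laplace[OF m l] chi_square_density_nonneg[OF m]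
    by (intro integral_eq_nn_integral[THEN trans]) auto
  finally show ?thesis .
qed

section \<open>Binomial moments and Hoeffding's inequality for product distributions\<close>

lemma expectation_binomial_pmf_Suc:
  fixes f :: "nat \<Rightarrow> real"
  assumes p: "p \<in> {0..1}"
  shows "measure_pmf.expectation (binomial_pmf (Suc m) p) f
    = p * measure_pmf.expectation (binomial_pmf m p) (\<lambda>x. f (x + 1)) + (1 - p) * measure_pmf.expectation (binomial_pmf m p) f"
proof -
  have "binomial_pmf (Suc m) p = bernoulli_pmf p \<bind> (\<lambda>b. map_pmf (\<lambda>x. (if b then 1 else 0) + x) (binomial_pmf m p))"
    unfolding binomial_pmf_Suc[OF p] map_pmf_def by simp
  then have "measure_pmf.expectation (binomial_pmf (Suc m) p) f
     = (\<Sum>b\<in>UNIV. pmf (bernoulli_pmf p) b *\<^sub>R measure_pmf.expectation (map_pmf (\<lambda>x. (if b then 1 else 0) + x) (binomial_pmf m p)) f)"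
    by (simp only:) (rule pmf_expectation_bind, use p in \<open>auto intro!: finite_imageI\<close>)
  then show ?thesis using p by (simp add: UNIV_bool add.commute)
qed

lemma expectation_binomial_pmf:
  assumes p: "p \<in> {0..1}"
  shows "measure_pmf.expectation (binomial_pmf m p) real = m * p"
proof (induction m)
  case 0
  show ?case using p by (simp add: binomial_pmf_0)
next
  case (Suc m)
  then show ?case
    using p by (simp add: expectation_binomial_pmf_Suc[OF p] algebra_simps)
qed

lemma second_moment_binomial_pmf:
  assumes p: "p \<in> {0..1}"
  shows "measure_pmf.expectation (binomial_pmf m p) (\<lambda>x. (real x)\<^sup>2) = m * p * (1 - p) + (m * p)\<^sup>2"
proof (induction m)
  case 0
  show ?case using p by (simp add: binomial_pmf_0)
next
  case (Suc m)
  have int: "integrable (binomial_pmf m p) f" for f :: "nat \<Rightarrow> real" using p by simp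
  have "(real (x + 1))\<^sup>2 = (real x)\<^sup>2 + 2 * real x + 1" for x
    by (simp add: power2_eq_square algebra_simps)
  then have shifted: "measure_pmf.expectation (binomial_pmf m p) (\<lambda>x. (real (x + 1))\<^sup>2)
      = m * p * (1 - p) + (m * p)\<^sup>2 + 2 * (m * p) + 1"
    by (simp only:) (simp add: int Suc expectation_binomial_pmf[OF p])
  show ?case
    unfolding expectation_binomial_pmf_Suc[OF p] Suc shifted by (simp add: algebra_simps power2_eq_square)
qed

lemma variance_binomial_pmf:
  assumes p: "p \<in> {0..1}"
  shows "measure_pmf.expectation (binomial_pmf m p) (\<lambda>x. (real x - m * p)\<^sup>2) = m * (p * (1 - p))"
proof -
  have int: "integrable (binomial_pmf m p) f" for f :: "nat \<Rightarrow> real" using p by simp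
  have "(real x - m * p)\<^sup>2 = (real x)\<^sup>2 - 2 * (m * p) * real x + (m * p)\<^sup>2" for x
    by (simp add: power2_diff algebra_simps)
  then show ?thesis
    by (simp add: int expectation_binomial_pmf[OF p] second_moment_binomial_pmf[OF p])
       (simp add: algebra_simps power2_eq_square)
qed

lemma component_in_set_Pi_pmf:
  assumes "finite P" "a \<in> set_pmf (Pi_pmf P d q)" "p \<in> P"
  shows "a p \<in> set_pmf (q p)"
  using set_Pi_pmf_subset'[OF assms(1), of d q] assms(2,3) by (auto simp: PiE_dflt_def)

lemma hoeffding_Pi_pmf:
  fixes \<xi> :: "'a \<Rightarrow> 'b \<Rightarrow> real"
  assumes fin: "finite P" and mean: "\<And>p. p \<in> P \<Longrightarrow> measure_pmf.expectation (q p) (\<xi> p) = 0"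
    and range: "\<And>p x. p \<in> P \<Longrightarrow> x \<in> set_pmf (q p) \<Longrightarrow> \<xi> p x \<in> {lo p..hi p}"
    and pos: "0 < (\<Sum>p\<in>P. (hi p - lo p)\<^sup>2)" and \<epsilon>: "0 \<le> \<epsilon>"
  shows "measure_pmf.prob (Pi_pmf P d q) {a. \<epsilon> \<le> \<bar>\<Sum>p\<in>P. \<xi> p (a p)\<bar>} \<le> 2 * exp (- 2 * \<epsilon>\<^sup>2 / (\<Sum>p\<in>P. (hi p - lo p)\<^sup>2))"
proof -
  define \<mu> where "\<mu> = (\<Sum>p\<in>P. measure_pmf.expectation (Pi_pmf P d q) (\<lambda>a. \<xi> p (a p)))"
  interpret Hoeffding_ineq "measure_pmf (Pi_pmf P d q)" P "\<lambda>p a. \<xi> p (a p)" lo hi \<mu>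
  proof unfold_locales
    show "prob_space.indep_vars (measure_pmf (Pi_pmf P d q)) (\<lambda>_. borel) (\<lambda>p a. \<xi> p (a p)) P"
      by (rule prob_space.indep_vars_compose2[OF _ indep_vars_Pi_pmf[OF fin], where Y = \<xi>])
         (auto simp: measure_pmf.prob_space_axioms)
    show "AE a in Pi_pmf P d q. \<xi> p (a p) \<in> {lo p..hi p}" if "p \<in> P" for p
      unfolding AE_measure_pmf_iff
      by (intro ballI range that component_in_set_Pi_pmf[OF fin])
  qed (use fin in \<open>simp_all add: \<mu>_def\<close>)
  have "\<mu> = 0" unfolding \<mu>_def using fin mean by (intro sum.neutral ballI) (simp add: expectation_Pi_pmf_component)
  then show ?thesis using Hoeffding_ineq_abs_ge[OF \<epsilon> pos] by simp
qed

lemma mult_mem_interval: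
  fixes c x y :: real
  assumes "0 \<le> x" "x \<le> y"
  shows "c * x \<in> {min 0 c * y..min 0 c * y + \<bar>c\<bar> * y}"
proof (cases "0 \<le> c")
  case True
  then show ?thesis using assms by (simp add: min_def mult_left_mono)
next
  case False
  then show ?thesis using assms by (simp add: min_def mult_left_mono_neg mult_nonpos_nonneg)
qed

section \<open>Likelihood and score of paired comparisons\<close>

lemma finite_bt_pairs [simp]: "finite (bt_pairs n)"
  by (rule finite_subset[of _ "{1..n} \<times> {1..n}"]) (auto simp: bt_pairs_def)

lemma sum_bt_pairs_symmetrized:
  fixes F :: "nat \<Rightarrow> nat \<Rightarrow> real"
  shows "(\<Sum>(i, j)\<in>bt_pairs n. F i j + F j i) = (\<Sum>i=1..n. \<Sum>j\<in>{1..n} - {i}. F i j)"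
proof -
  let ?P = "bt_pairs n" and ?Q = "{(i, j). 1 \<le> j \<and> j < i \<and> i \<le> n}"
  have "finite ?Q" by (rule finite_subset[of _ "{1..n} \<times> {1..n}"]) auto
  have "(\<Sum>i=1..n. \<Sum>j\<in>{1..n} - {i}. F i j) = (\<Sum>(i, j)\<in>(SIGMA i:{1..n}. {1..n} - {i}). F i j)"
    by (rule sum.Sigma) auto
  also have "(SIGMA i:{1..n}. {1..n} - {i}) = ?P \<union> ?Q" by (auto simp: bt_pairs_def)
  also have "(\<Sum>(i, j)\<in>?P \<union> ?Q. F i j) = (\<Sum>(i, j)\<in>?P. F i j) + (\<Sum>(i, j)\<in>?Q. F i j)"
    by (rule sum.union_disjoint[OF finite_bt_pairs \<open>finite ?Q\<close>]) (auto simp: bt_pairs_def)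
  also have "(\<Sum>(i, j)\<in>?Q. F i j) = (\<Sum>(i, j)\<in>?P. F j i)"
    by (rule sum.reindex_bij_witness[where i = prod.swap and j = prod.swap]) (auto simp: bt_pairs_def)
  finally show ?thesis by (simp add: sum.distrib case_prod_unfold)
qed

lemma sum_bt_pairs_symmetric:
  fixes F :: "nat \<Rightarrow> nat \<Rightarrow> real"
  assumes sym: "\<And>i j. i \<in> {1..n} \<Longrightarrow> j \<in> {1..n} \<Longrightarrow> F i j = F j i"
    and diag: "\<And>i. i \<in> {1..n} \<Longrightarrow> F i i = 0"
  shows "(\<Sum>(i, j)\<in>bt_pairs n. F i j) = (\<Sum>i=1..n. \<Sum>j=1..n. F i j) / 2"
proof -
  have "2 * (\<Sum>(i, j)\<in>bt_pairs n. F i j) = (\<Sum>(i, j)\<in>bt_pairs n. F i j + F j i)"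
    unfolding sum_distrib_left
  proof (intro sum.cong refl, clarify)
    fix i j assume "(i, j) \<in> bt_pairs n"
    then have "F i j = F j i" by (intro sym) (auto simp: bt_pairs_def)
    then show "2 * F i j = F i j + F j i" by simp
  qed
  also have "\<dots> = (\<Sum>i=1..n. \<Sum>j=1..n. F i j)"
    unfolding sum_bt_pairs_symmetrized
    by (intro sum.cong refl sum.mono_neutral_left) (auto simp: diag)
  finally show ?thesis by simp
qed

locale bt_design =
  fixes n K :: nat and k :: "nat \<Rightarrow> nat \<Rightarrow> nat"
  assumes k_sym: "\<And>i j. k i j = k j i"
    and k_range: "\<And>i j. 1 \<le> i \<Longrightarrow> i < j \<Longrightarrow> j \<le> n \<Longrightarrow> k i j \<in> {1..K}"
begin

abbreviation I where "I \<equiv> {1..n}"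

definition outcome :: "(nat \<times> nat \<Rightarrow> nat) \<Rightarrow> bool" where
  "outcome a \<longleftrightarrow> (\<forall>(i, j)\<in>bt_pairs n. a (i, j) \<le> k i j)"

definition residual :: "(nat \<Rightarrow> real) \<Rightarrow> (nat \<times> nat \<Rightarrow> nat) \<Rightarrow> nat \<Rightarrow> nat \<Rightarrow> real" where
  "residual \<theta> a i j = (if i = j then 0 else real (bt_win k a i j) - real (k i j) * logistic (\<theta> i - \<theta> j))"

definition score :: "(nat \<Rightarrow> real) \<Rightarrow> (nat \<times> nat \<Rightarrow> nat) \<Rightarrow> nat \<Rightarrow> real" where
  "score \<theta> a i = (\<Sum>j\<in>I. residual \<theta> a i j)"

definition bregman_loss :: "(nat \<Rightarrow> real) \<Rightarrow> (nat \<Rightarrow> real) \<Rightarrow> real" where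
  "bregman_loss \<theta> \<delta> = (\<Sum>i\<in>I. \<Sum>j\<in>I. real (k i j) * bregman (\<theta> i - \<theta> j) (\<delta> i - \<delta> j)) / 2"

lemma k_bounds: "i \<in> I \<Longrightarrow> j \<in> I \<Longrightarrow> i \<noteq> j \<Longrightarrow> 1 \<le> real (k i j) \<and> real (k i j) \<le> real K"
  using k_range[of i j] k_range[of j i] k_sym[of i j] by (cases "i < j") auto

lemma win_complement:
  assumes "outcome a" "i \<in> I" "j \<in> I" "i \<noteq> j"
  shows "real (bt_win k a i j) + real (bt_win k a j i) = real (k i j)"
proof -
  have "a (i, j) \<le> k i j" if "i < j" using assms that by (auto simp: outcome_def bt_pairs_def)
  moreover have "a (j, i) \<le> k j i" if "j < i" using assms that by (auto simp: outcome_def bt_pairs_def)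
  ultimately show ?thesis using assms(4) k_sym[of i j] by (auto simp: bt_win_def)
qed

lemma residual_antisym:
  assumes "outcome a" "i \<in> I" "j \<in> I"
  shows "residual \<theta> a j i = - residual \<theta> a i j"
proof (cases "i = j")
  case False
  have swap: "logistic (\<theta> j - \<theta> i) = 1 - logistic (\<theta> i - \<theta> j)"
    using logistic_minus[of "\<theta> i - \<theta> j"] by simp
  show ?thesis
    using win_complement[OF assms False] False
    unfolding residual_def swap k_sym[of j i] by (simp add: algebra_simps)
qed (simp add: residual_def)

lemma sum_score: "outcome a \<Longrightarrow> (\<Sum>i\<in>I. score \<theta> a i) = 0"
  unfolding score_def by (rule sum_antisymmetric) (rule residual_antisym)

lemma sum_pairs_residual:
  assumes "outcome a"
  shows "(\<Sum>(i, j)\<in>bt_pairs n. residual \<theta> a i j * (\<delta> i - \<delta> j)) = (\<Sum>i\<in>I. \<delta> i * score \<theta> a i)"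
proof -
  have anti: "residual \<theta> a j i = - residual \<theta> a i j" if "i \<in> I" "j \<in> I" for i j
    using residual_antisym[OF assms that] .
  have "(\<Sum>(i, j)\<in>bt_pairs n. residual \<theta> a i j * (\<delta> i - \<delta> j)) = (\<Sum>i\<in>I. \<Sum>j\<in>I. residual \<theta> a i j * (\<delta> i - \<delta> j)) / 2"
  proof (rule sum_bt_pairs_symmetric)
    fix i j assume "i \<in> I" "j \<in> I"
    from anti[OF this] show "residual \<theta> a i j * (\<delta> i - \<delta> j) = residual \<theta> a j i * (\<delta> j - \<delta> i)"
      by (simp add: algebra_simps)
  qed simp
  also have "\<dots> = (\<Sum>i\<in>I. \<delta> i * score \<theta> a i)"
    unfolding score_def by (rule sum_antisymmetric_by_parts) (rule anti)
  finally show ?thesis .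
qed

lemma bregman_loss_eq_sum_pairs:
  "bregman_loss \<theta> \<delta> = (\<Sum>(i, j)\<in>bt_pairs n. real (k i j) * bregman (\<theta> i - \<theta> j) (\<delta> i - \<delta> j))"
proof -
  have "real (k i j) * bregman (\<theta> i - \<theta> j) (\<delta> i - \<delta> j) = real (k j i) * bregman (\<theta> j - \<theta> i) (\<delta> j - \<delta> i)" for i j
    using bregman_minus[of "\<theta> i - \<theta> j" "\<delta> i - \<delta> j"] by (simp add: k_sym[of i j])
  then show ?thesis
    unfolding bregman_loss_def by (intro sum_bt_pairs_symmetric[symmetric]) auto
qed

lemma loglik_eq_sum_pairs:
  assumes "outcome a"
  shows "bt_loglik n k a \<gamma>
    = (\<Sum>(i, j)\<in>bt_pairs n. real (bt_win k a i j) * (\<gamma> i - \<gamma> j) - real (k i j) * softplus (\<gamma> i - \<gamma> j))"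
proof -
  have "(\<Sum>i=1..n. \<gamma> i * real (bt_degree n k a i)) = (\<Sum>i\<in>I. \<Sum>j\<in>I - {i}. \<gamma> i * real (bt_win k a i j))"
    by (simp add: bt_degree_def sum_distrib_left)
  also have "\<dots> = (\<Sum>(i, j)\<in>bt_pairs n. \<gamma> i * real (bt_win k a i j) + \<gamma> j * real (bt_win k a j i))"
    by (rule sum_bt_pairs_symmetrized[symmetric])
  finally have "bt_loglik n k a \<gamma>
      = (\<Sum>(i, j)\<in>bt_pairs n. \<gamma> i * real (bt_win k a i j) + \<gamma> j * real (bt_win k a j i)
          - real (k i j) * ln (exp (\<gamma> i) + exp (\<gamma> j)))"
    by (simp add: bt_loglik_def case_prod_unfold sum_subtractf)
  also have "\<dots> = (\<Sum>(i, j)\<in>bt_pairs n. real (bt_win k a i j) * (\<gamma> i - \<gamma> j) - real (k i j) * softplus (\<gamma> i - \<gamma> j))"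
  proof (intro sum.cong refl, clarify)
    fix i j assume "(i, j) \<in> bt_pairs n"
    then have ij: "i \<in> I" "j \<in> I" "i \<noteq> j" by (auto simp: bt_pairs_def)
    have "exp (\<gamma> i) + exp (\<gamma> j) = exp (\<gamma> j) * (1 + exp (\<gamma> i - \<gamma> j))" by (simp add: distrib_left flip: exp_add)
    then have "ln (exp (\<gamma> i) + exp (\<gamma> j)) = \<gamma> j + softplus (\<gamma> i - \<gamma> j)"
      by (simp add: ln_mult softplus_def)
    then show "\<gamma> i * real (bt_win k a i j) + \<gamma> j * real (bt_win k a j i) - real (k i j) * ln (exp (\<gamma> i) + exp (\<gamma> j))
        = real (bt_win k a i j) * (\<gamma> i - \<gamma> j) - real (k i j) * softplus (\<gamma> i - \<gamma> j)"
      using win_complement[OF assms ij] by (simp add: algebra_simps flip: distrib_left)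
  qed
  finally show ?thesis .
qed

lemma loglik_add:
  assumes a: "outcome a"
  shows "bt_loglik n k a (\<lambda>i. \<theta> i + \<delta> i) = bt_loglik n k a \<theta> + (\<Sum>i\<in>I. \<delta> i * score \<theta> a i) - bregman_loss \<theta> \<delta>"
proof -
  have "bt_loglik n k a (\<lambda>i. \<theta> i + \<delta> i) = (\<Sum>p\<in>bt_pairs n.
      (case p of (i, j) \<Rightarrow> real (bt_win k a i j) * (\<theta> i - \<theta> j) - real (k i j) * softplus (\<theta> i - \<theta> j))
      + (case p of (i, j) \<Rightarrow> residual \<theta> a i j * (\<delta> i - \<delta> j))
      - (case p of (i, j) \<Rightarrow> real (k i j) * bregman (\<theta> i - \<theta> j) (\<delta> i - \<delta> j)))"
    unfolding loglik_eq_sum_pairs[OF a]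
  proof (intro sum.cong refl, clarify)
    fix i j assume "(i, j) \<in> bt_pairs n"
    then have "i \<noteq> j" by (auto simp: bt_pairs_def)
    moreover have "\<theta> i + \<delta> i - (\<theta> j + \<delta> j) = \<theta> i - \<theta> j + (\<delta> i - \<delta> j)" by simp
    ultimately show "real (bt_win k a i j) * (\<theta> i + \<delta> i - (\<theta> j + \<delta> j)) - real (k i j) * softplus (\<theta> i + \<delta> i - (\<theta> j + \<delta> j))
      = real (bt_win k a i j) * (\<theta> i - \<theta> j) - real (k i j) * softplus (\<theta> i - \<theta> j)
        + residual \<theta> a i j * (\<delta> i - \<delta> j) - real (k i j) * bregman (\<theta> i - \<theta> j) (\<delta> i - \<delta> j)"
      by (simp only: residual_def bregman_def if_False) (simp add: algebra_simps)
  qed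
  then show ?thesis
    unfolding sum.distrib sum_subtractf sum_pairs_residual[OF a]
    by (simp only: loglik_eq_sum_pairs[OF a] bregman_loss_eq_sum_pairs)
qed

lemma bregman_loss_nonneg: "0 \<le> bregman_loss \<theta> \<delta>"
  unfolding bregman_loss_def by (intro divide_nonneg_nonneg sum_nonneg mult_nonneg_nonneg bregman_nonneg) auto

lemma bregman_loss_scale_le:
  assumes "0 \<le> s" "s \<le> 1"
  shows "bregman_loss \<theta> (\<lambda>i. s * \<delta> i) \<le> bregman_loss \<theta> \<delta>"
  unfolding bregman_loss_def right_diff_distrib[symmetric]
  by (intro divide_right_mono sum_mono mult_left_mono bregman_scale_le assms) auto

section \<open>The likelihood ratio statistic\<close>

definition stationary :: "(nat \<times> nat \<Rightarrow> nat) \<Rightarrow> (nat \<Rightarrow> real) \<Rightarrow> bool" where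
  "stationary a \<theta> \<longleftrightarrow> (\<forall>i\<in>I. score \<theta> a i = 0)"

lemma loglik_diff_stationary:
  assumes "outcome a" "stationary a \<theta>"
  shows "bt_loglik n k a \<gamma> = bt_loglik n k a \<theta> - bregman_loss \<theta> (\<lambda>i. \<gamma> i - \<theta> i)"
  using loglik_add[OF assms(1), of \<theta> "\<lambda>i. \<gamma> i - \<theta> i"] assms(2) by (simp add: stationary_def)

lemma loglik_nonpos:
  assumes a: "outcome a"
  shows "bt_loglik n k a \<gamma> \<le> 0"
  unfolding loglik_eq_sum_pairs[OF a]
proof (intro sum_nonpos, clarify)
  fix i j assume "(i, j) \<in> bt_pairs n"
  then have ij: "i \<in> I" "j \<in> I" "i \<noteq> j" by (auto simp: bt_pairs_def)
  define t where "t = \<gamma> i - \<gamma> j"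
  define x where "x = real (bt_win k a i j)"
  have x: "0 \<le> x" "x \<le> k i j" using win_complement[OF a ij] by (auto simp: x_def)
  have "x * t \<le> x * softplus t" using x softplus_ge by (intro mult_left_mono)
  also have "\<dots> \<le> k i j * softplus t" using x softplus_ge by (intro mult_right_mono)
  finally show "real (bt_win k a i j) * (\<gamma> i - \<gamma> j) - real (k i j) * softplus (\<gamma> i - \<gamma> j) \<le> 0"
    by (simp add: x_def t_def)
qed

lemma bdd_above_loglik: "outcome a \<Longrightarrow> bdd_above (bt_loglik n k a ` \<Gamma>)"
  using loglik_nonpos by (intro bdd_aboveI2)

lemma bt_null_space_nonempty: "bt_null_space r \<noteq> {}"
  unfolding bt_null_space_def by (auto intro: exI[of _ "\<lambda>_. 0"])

lemma lr_stat_nonneg: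
  assumes "outcome a"
  shows "0 \<le> bt_lr_stat n r k a"
proof -
  have "(SUP \<gamma>\<in>bt_null_space r. bt_loglik n k a \<gamma>) \<le> (SUP \<gamma>\<in>bt_param_space. bt_loglik n k a \<gamma>)"
    by (rule cSUP_subset_mono[OF bt_null_space_nonempty bdd_above_loglik[OF assms]])
       (auto simp: bt_null_space_def bt_param_space_def)
  then show ?thesis by (simp add: bt_lr_stat_def)
qed

lemma lr_stat_eq_stationary:
  assumes a: "outcome a" and \<theta>: "stationary a \<theta>" "\<theta> 1 = 0"
  shows "bt_lr_stat n r k a = 2 * (bt_loglik n k a \<theta> - (SUP \<gamma>\<in>bt_null_space r. bt_loglik n k a \<gamma>))"
proof -
  have "bt_loglik n k a \<gamma> \<le> bt_loglik n k a \<theta>" for \<gamma>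
    using loglik_diff_stationary[OF a \<theta>(1), of \<gamma>] bregman_loss_nonneg[of \<theta> "\<lambda>i. \<gamma> i - \<theta> i"] by simp
  then have "(SUP \<gamma>\<in>bt_param_space. bt_loglik n k a \<gamma>) = bt_loglik n k a \<theta>"
    using \<theta>(2) by (intro cSup_eq_maximum) (auto simp: bt_param_space_def)
  then show ?thesis by (simp add: bt_lr_stat_def)
qed

lemma lr_stat_le:
  assumes "outcome a" "stationary a \<theta>" "\<theta> 1 = 0" and \<gamma>: "\<gamma> \<in> bt_null_space r"
  shows "bt_lr_stat n r k a \<le> 2 * bregman_loss \<theta> (\<lambda>i. \<gamma> i - \<theta> i)"
  using cSUP_upper[OF \<gamma> bdd_above_loglik[OF assms(1)]] loglik_diff_stationary[OF assms(1,2), of \<gamma>]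
  by (simp add: lr_stat_eq_stationary[OF assms(1-3)])

lemma lr_stat_ge:
  assumes "outcome a" "stationary a \<theta>" "\<theta> 1 = 0"
    and lo: "\<And>\<gamma>. \<gamma> \<in> bt_null_space r \<Longrightarrow> lo \<le> 2 * bregman_loss \<theta> (\<lambda>i. \<gamma> i - \<theta> i)"
  shows "lo \<le> bt_lr_stat n r k a"
proof -
  have "(SUP \<gamma>\<in>bt_null_space r. bt_loglik n k a \<gamma>) \<le> bt_loglik n k a \<theta> - lo / 2"
  proof (rule cSUP_least[OF bt_null_space_nonempty])
    fix \<gamma> assume "\<gamma> \<in> bt_null_space r"
    from lo[OF this] show "bt_loglik n k a \<gamma> \<le> bt_loglik n k a \<theta> - lo / 2"
      unfolding loglik_diff_stationary[OF assms(1,2), of \<gamma>] by linarith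
  qed
  then show ?thesis by (simp add: lr_stat_eq_stationary[OF assms(1-3)])
qed

section \<open>The random design\<close>

definition comparison_pmf :: "(nat \<Rightarrow> real) \<Rightarrow> nat \<times> nat \<Rightarrow> nat pmf" where
  "comparison_pmf \<beta> = (\<lambda>(i, j). binomial_pmf (k i j) (logistic (\<beta> i - \<beta> j)))"

definition noise :: "(nat \<Rightarrow> real) \<Rightarrow> nat \<times> nat \<Rightarrow> nat \<Rightarrow> real" where
  "noise \<beta> = (\<lambda>(i, j) x. real x - real (k i j) * logistic (\<beta> i - \<beta> j))"

lemma logistic_in_unit_interval: "logistic t \<in> {0..1}"
  using logistic_bounds[of t] by simp

lemma bt_data_eq: "bt_data n k \<beta> = Pi_pmf (bt_pairs n) 0 (comparison_pmf \<beta>)"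
  unfolding bt_data_def comparison_pmf_def bt_prob_def logistic_def ..

lemma set_comparison_pmf: "set_pmf (comparison_pmf \<beta> (i, j)) = {..k i j}"
  using logistic_bounds[of "\<beta> i - \<beta> j"] by (simp add: comparison_pmf_def)

lemma finite_set_comparison_pmf: "finite (set_pmf (comparison_pmf \<beta> p))"
  by (cases p) (simp add: set_comparison_pmf)

lemma finite_set_bt_data: "finite (set_pmf (bt_data n k \<beta>))"
  unfolding bt_data_eq by (intro finite_set_Pi_pmf finite_bt_pairs finite_set_comparison_pmf)

lemma outcome_bt_data: "a \<in> set_pmf (bt_data n k \<beta>) \<Longrightarrow> outcome a"
  unfolding outcome_def bt_data_eq
  using component_in_set_Pi_pmf[OF finite_bt_pairs, of a n 0 "comparison_pmf \<beta>"] set_comparison_pmf by fastforce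

lemma residual_eq_noise: "(i, j) \<in> bt_pairs n \<Longrightarrow> residual \<beta> a i j = noise \<beta> (i, j) (a (i, j))"
  by (auto simp: residual_def noise_def bt_win_def bt_pairs_def)

lemma expectation_noise: "measure_pmf.expectation (comparison_pmf \<beta> p) (noise \<beta> p) = 0"
  using logistic_in_unit_interval
  by (cases p) (simp add: comparison_pmf_def noise_def expectation_binomial_pmf)

lemma variance_noise:
  "measure_pmf.expectation (comparison_pmf \<beta> (i, j)) (\<lambda>x. (noise \<beta> (i, j) x)\<^sup>2) = real (k i j) * dlogistic (\<beta> i - \<beta> j)"
  by (simp add: comparison_pmf_def noise_def variance_binomial_pmf[OF logistic_in_unit_interval] dlogistic_eq)

lemma abs_noise_le:
  assumes p: "p \<in> bt_pairs n" and x: "x \<in> set_pmf (comparison_pmf \<beta> p)"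
  shows "\<bar>noise \<beta> p x\<bar> \<le> K"
proof -
  obtain i j where ij: "p = (i, j)" by (cases p)
  define \<mu> where "\<mu> = real (k i j) * logistic (\<beta> i - \<beta> j)"
  have "0 \<le> \<mu>" "\<mu> \<le> real (k i j) * 1"
    unfolding \<mu>_def using logistic_in_unit_interval[of "\<beta> i - \<beta> j"] by (auto intro!: mult_left_le)
  moreover have "x \<le> k i j" using x by (simp add: ij set_comparison_pmf)
  moreover have "k i j \<le> K" using p k_range[of i j] by (simp add: ij bt_pairs_def)
  ultimately show ?thesis by (simp add: ij noise_def flip: \<mu>_def)
qed

lemma prob_abs_weighted_score_ge:
  fixes z :: "nat \<Rightarrow> real"
  assumes z: "\<And>i j. (i, j) \<in> bt_pairs n \<Longrightarrow> \<bar>z i - z j\<bar> \<le> u (i, j)"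
    and u: "0 < (\<Sum>p\<in>bt_pairs n. (u p)\<^sup>2)" "(\<Sum>p\<in>bt_pairs n. (u p)\<^sup>2) \<le> U" and \<epsilon>: "0 \<le> \<epsilon>"
  shows "measure_pmf.prob (bt_data n k \<beta>) {a. \<epsilon> \<le> \<bar>\<Sum>m\<in>I. z m * score \<beta> a m\<bar>}
    \<le> 2 * exp (- 2 * \<epsilon>\<^sup>2 / ((real K)\<^sup>2 * U))"
proof -
  define c where "c p = z (fst p) - z (snd p)" for p
  define \<kappa> where "\<kappa> p = real (k (fst p) (snd p))" for p
  define lo where "lo p = min 0 (c p) * \<kappa> p - c p * (\<kappa> p * logistic (\<beta> (fst p) - \<beta> (snd p)))" for p
  define hi where "hi p = lo p + K * u p" for p
  have c: "\<bar>c p\<bar> \<le> u p" "0 \<le> \<kappa> p" "\<kappa> p \<le> K" "1 \<le> K" if "p \<in> bt_pairs n" for p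
    using that z[of "fst p" "snd p"] k_range[of "fst p" "snd p"] by (auto simp: c_def \<kappa>_def bt_pairs_def)
  have "bt_pairs n \<noteq> {}" using u(1) by auto
  then have K: "0 < K" using c(4) by fastforce
  have score: "(\<Sum>m\<in>I. z m * score \<beta> a m) = (\<Sum>p\<in>bt_pairs n. c p * noise \<beta> p (a p))" if "outcome a" for a
    unfolding sum_pairs_residual[OF that, symmetric]
    by (intro sum.cong refl) (auto simp: c_def residual_eq_noise)
  have "measure_pmf.prob (bt_data n k \<beta>) {a. \<epsilon> \<le> \<bar>\<Sum>m\<in>I. z m * score \<beta> a m\<bar>}
      = measure_pmf.prob (bt_data n k \<beta>) {a. \<epsilon> \<le> \<bar>\<Sum>p\<in>bt_pairs n. c p * noise \<beta> p (a p)\<bar>}"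
    using outcome_bt_data score by (intro measure_pmf.finite_measure_eq_AE) (auto simp: AE_measure_pmf_iff)
  also have "\<dots> \<le> 2 * exp (- 2 * \<epsilon>\<^sup>2 / (\<Sum>p\<in>bt_pairs n. (hi p - lo p)\<^sup>2))"
    unfolding bt_data_eq
  proof (rule hoeffding_Pi_pmf[OF finite_bt_pairs _ _ _ \<epsilon>])
    show "c p * noise \<beta> p x \<in> {lo p..hi p}" if p: "p \<in> bt_pairs n" and x: "x \<in> set_pmf (comparison_pmf \<beta> p)" for p x
    proof -
      have "real x \<le> \<kappa> p" using x set_comparison_pmf[of \<beta> "fst p" "snd p"] by (simp add: \<kappa>_def)
      then have "c p * x \<in> {min 0 (c p) * \<kappa> p..min 0 (c p) * \<kappa> p + \<bar>c p\<bar> * \<kappa> p}"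
        by (intro mult_mem_interval) auto
      moreover have "\<bar>c p\<bar> * \<kappa> p \<le> u p * K" using c[OF p] by (intro mult_mono) auto
      ultimately show ?thesis
        by (simp add: lo_def hi_def noise_def \<kappa>_def case_prod_unfold right_diff_distrib mult.commute[of "u p"])
    qed
    show "0 < (\<Sum>p\<in>bt_pairs n. (hi p - lo p)\<^sup>2)"
      using K u(1) by (simp add: hi_def power_mult_distrib flip: sum_distrib_left)
  qed (simp add: expectation_noise)
  also have "(\<Sum>p\<in>bt_pairs n. (hi p - lo p)\<^sup>2) = (real K)\<^sup>2 * (\<Sum>p\<in>bt_pairs n. (u p)\<^sup>2)"
    by (simp add: hi_def power_mult_distrib flip: sum_distrib_left)
  also have "2 * exp (- 2 * \<epsilon>\<^sup>2 / ((real K)\<^sup>2 * (\<Sum>p\<in>bt_pairs n. (u p)\<^sup>2))) \<le> 2 * exp (- 2 * \<epsilon>\<^sup>2 / ((real K)\<^sup>2 * U))"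
    using u K by (simp add: frac_le)
  finally show ?thesis .
qed

end

section \<open>Arithmetic of the error terms\<close>

lemma monomial_mono:
  fixes r K b x :: real
  assumes "1 \<le> r" "1 \<le> K" "1 \<le> b" "0 \<le> x" "i \<le> i'" "j \<le> j'" "l \<le> l'"
  shows "r ^ i * K ^ j * b ^ l * x \<le> r ^ i' * K ^ j' * b ^ l' * x"
  using assms by (intro mult_right_mono mult_mono power_increasing) auto

lemma power2_le_mult_power3:
  fixes n w :: real
  assumes "0 < w" "w \<le> 1" "1 \<le> n * w\<^sup>2"
  shows "w\<^sup>2 \<le> n * w ^ 3"
proof -
  have "0 < n * w\<^sup>2" using assms by linarith
  then have "0 \<le> n" by (simp add: zero_less_mult_iff)
  then have "n * w * w \<le> n * w * 1" using assms by (intro mult_left_mono) auto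
  then have "1 \<le> n * w" using assms by (simp add: power2_eq_square mult_ac)
  then have "1 * w\<^sup>2 \<le> n * w * w\<^sup>2" by (intro mult_right_mono) auto
  then show ?thesis by (simp add: power2_eq_square power3_eq_cube mult_ac)
qed

lemma upper_error_le:
  fixes b n r K w W L :: real
  assumes ge1: "1 \<le> r" "1 \<le> K" "1 \<le> b" and w: "0 < w" "w \<le> 1 / 20" "1 \<le> n * w\<^sup>2" and n: "0 < n"
    and W: "0 \<le> W" "W \<le> r * n * K / 4 * w\<^sup>2"
    and upper: "L \<le> exp (2 * w) * (W + r\<^sup>2 * K * w\<^sup>2)"
  shows "L - W \<le> 4 * (r\<^sup>2 * K ^ 3 * b\<^sup>2 * (n * w ^ 3))"
proof -
  define U where "U = r\<^sup>2 * K ^ 3 * b\<^sup>2 * (n * w ^ 3)"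
  have "exp (2 * w) \<le> 1 + 2 * w + (2 * w)\<^sup>2" using w by (intro exp_bound) auto
  also have "(2 * w)\<^sup>2 \<le> 2 * w" using w mult_left_mono[of "2 * w" 1 "2 * w"] by (simp add: power2_eq_square)
  finally have exp: "exp (2 * w) \<le> 1 + 4 * w" "exp (2 * w) \<le> 3" using w by simp_all
  have "exp (2 * w) * W \<le> (1 + 4 * w) * W" using exp W by (intro mult_right_mono)
  moreover have "exp (2 * w) * (r\<^sup>2 * K * w\<^sup>2) \<le> 3 * (r\<^sup>2 * K * w\<^sup>2)" using exp ge1 by (intro mult_right_mono) auto
  moreover have "4 * w * W \<le> U"
  proof -
    have "4 * w * W \<le> 4 * w * (r * n * K / 4 * w\<^sup>2)" using W(2) w by (intro mult_left_mono) auto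
    also have "\<dots> = r ^ 1 * K ^ 1 * b ^ 0 * (n * w ^ 3)" by (simp add: power2_eq_square power3_eq_cube mult_ac)
    also have "\<dots> \<le> U" unfolding U_def using n w by (intro monomial_mono ge1) auto
    finally show ?thesis .
  qed
  moreover have "r\<^sup>2 * K * w\<^sup>2 \<le> U"
  proof -
    have "r ^ 2 * K ^ 1 * b ^ 0 * w\<^sup>2 \<le> r\<^sup>2 * K ^ 3 * b\<^sup>2 * w\<^sup>2" by (intro monomial_mono ge1) auto
    also have "\<dots> \<le> U"
      unfolding U_def using power2_le_mult_power3[of w n] w ge1 by (intro mult_left_mono) auto
    finally show ?thesis by simp
  qed
  ultimately show ?thesis using upper by (simp add: distrib_left distrib_right flip: U_def)
qed

lemma lower_error_le:
  fixes b n r K w W L :: real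
  assumes ge1: "1 \<le> r" "1 \<le> K" "1 \<le> b" and w: "0 < w" "w \<le> 1 / 20" "1 \<le> n * w\<^sup>2" and n: "0 < n"
    and W: "0 \<le> W" "W \<le> r * n * K / 4 * w\<^sup>2"
    and lower: "(1 - w - 2 * r * K * b * w) * ((1 - r * K * b / (2 * n)) * W) \<le> L"
  shows "W - L \<le> 4 * (r\<^sup>2 * K ^ 3 * b\<^sup>2 * (n * w ^ 3))"
proof -
  define U where "U = r\<^sup>2 * K ^ 3 * b\<^sup>2 * (n * w ^ 3)"
  define u \<kappa> where "u = w + 2 * r * K * b * w" and "\<kappa> = r * K * b / (2 * n)"
  have "1 * 1 * 1 \<le> r * K * b" using ge1 by (intro mult_mono) auto
  from mult_right_mono[OF this, of w] have "w \<le> r * K * b * w" using w by simp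
  with w have u: "0 \<le> u" "u \<le> 3 * (r * K * b * w)" unfolding u_def by linarith+
  have \<kappa>: "0 \<le> \<kappa>" using n ge1 by (simp add: \<kappa>_def)
  have "0 \<le> u * \<kappa> * W" using u \<kappa> W by simp
  then have "W - (u * W + \<kappa> * W) \<le> (1 - u) * ((1 - \<kappa>) * W)" by (simp add: algebra_simps)
  also have "\<dots> \<le> L" using lower by (simp add: u_def \<kappa>_def diff_diff_eq)
  finally have "W - L \<le> u * W + \<kappa> * W" by simp
  moreover have "u * W \<le> U"
  proof -
    have "u * W \<le> 3 * (r * K * b * w) * (r * n * K / 4 * w\<^sup>2)" using u W by (intro mult_mono) auto
    also have "\<dots> = 3 / 4 * (r ^ 2 * K ^ 2 * b ^ 1 * (n * w ^ 3))"
      by (simp add: power2_eq_square power3_eq_cube mult_ac)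
    also have "\<dots> \<le> 1 * U"
      unfolding U_def using n w ge1 by (intro mult_mono monomial_mono) auto
    finally show ?thesis by simp
  qed
  moreover have "\<kappa> * W \<le> U"
  proof -
    have "\<kappa> * W \<le> \<kappa> * (r * n * K / 4 * w\<^sup>2)" using \<kappa> W by (intro mult_left_mono)
    also have "\<dots> = 1 / 8 * (r ^ 2 * K ^ 2 * b ^ 1 * w\<^sup>2)"
      using n by (simp add: \<kappa>_def power2_eq_square mult_ac)
    also have "\<dots> \<le> 1 * (r\<^sup>2 * K ^ 3 * b\<^sup>2 * w\<^sup>2)" using ge1 by (intro mult_mono monomial_mono) auto
    also have "\<dots> \<le> 1 * U"
      unfolding U_def using power2_le_mult_power3[of w n] w ge1 by (intro mult_left_mono) auto
    finally show ?thesis by simp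
  qed
  moreover have "0 \<le> U" using n w ge1 by (simp add: U_def)
  ultimately show ?thesis by (simp flip: U_def)
qed

section \<open>The model under the null hypothesis\<close>

locale bradley_terry = bt_design +
  fixes r :: nat and \<beta> :: "nat \<Rightarrow> real" and b :: real
  assumes r3: "3 \<le> r" and n2r: "2 * r \<le> n"
    and beta1: "\<beta> 1 = 0" and H0: "\<And>i. i \<in> {2..r} \<Longrightarrow> \<beta> i = \<beta> 2"
    and b1: "1 \<le> b"
    and b_bound: "\<And>i j. i \<in> {1..n} \<Longrightarrow> j \<in> {1..n} \<Longrightarrow> i \<noteq> j \<Longrightarrow> 1 / b \<le> dlogistic (\<beta> i - \<beta> j)"
begin

abbreviation R where "R \<equiv> {2..r}"
abbreviation S where "S \<equiv> {1..n} - {2..r}"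

definition info :: "nat \<Rightarrow> nat \<Rightarrow> real" where
  "info i j = real (k i j) * dlogistic (\<beta> i - \<beta> j)"

definition cross_info :: "nat \<Rightarrow> real" where
  "cross_info i = sum (info i) S"

definition cross_score :: "(nat \<times> nat \<Rightarrow> nat) \<Rightarrow> nat \<Rightarrow> real" where
  "cross_score a i = (\<Sum>j\<in>S. residual \<beta> a i j)"

lemma R_sub: "R \<subseteq> I" using n2r by auto

lemma RS_partition: "R \<union> S = I" "R \<inter> S = {}" using R_sub by auto

lemma one_in: "1 \<in> I" "1 \<in> S" using n2r r3 by auto

lemma n_pos: "real n > 0" using n2r r3 by simp

lemma b_pos: "b > 0" using b1 by simp

lemma K_ge_1: "1 \<le> real K"
  using k_bounds[of 1 2] n2r r3 by auto

lemma card_S_ge: "real n / 2 \<le> card S"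
  using R_sub n2r r3 by (simp add: card_Diff_subset)

lemma info_sym: "info i j = info j i"
  using dlogistic_minus[of "\<beta> i - \<beta> j"] by (simp add: info_def k_sym)

lemma info_nonneg: "0 \<le> info i j"
  unfolding info_def using less_imp_le[OF dlogistic_pos] by simp

lemma info_bounds:
  assumes "i \<in> I" "j \<in> I" "i \<noteq> j"
  shows "1 / b \<le> info i j" "info i j \<le> K / 4"
proof -
  note k = k_bounds[OF assms]
  have "1 * (1 / b) \<le> info i j" unfolding info_def
    using k b_bound[OF assms] b_pos by (intro mult_mono) auto
  then show "1 / b \<le> info i j" by simp
  have "info i j \<le> K * (1 / 4)" unfolding info_def
    using k dlogistic_le less_imp_le[OF dlogistic_pos] by (intro mult_mono) auto
  then show "info i j \<le> K / 4" by simp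
qed

lemma cross_info_bounds:
  assumes "i \<in> R"
  shows "real n / (2 * b) \<le> cross_info i" "cross_info i \<le> real n * K / 4" "0 < cross_info i"
proof -
  have bounds: "1 / b \<le> info i j" "info i j \<le> K / 4" if "j \<in> S" for j
    using that assms R_sub by (intro info_bounds; auto)+
  have "real n / 2 * (1 / b) \<le> card S * (1 / b)"
    using b_pos by (intro mult_right_mono card_S_ge) auto
  also have "\<dots> = (\<Sum>j\<in>S. 1 / b)" by simp
  also have "\<dots> \<le> cross_info i" unfolding cross_info_def by (intro sum_mono bounds)
  finally show lower: "real n / (2 * b) \<le> cross_info i" by simp
  have "cross_info i \<le> (\<Sum>j\<in>S. real K / 4)" unfolding cross_info_def by (intro sum_mono bounds)
  also have "\<dots> \<le> (\<Sum>j\<in>I. real K / 4)" by (intro sum_mono2) auto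
  finally show "cross_info i \<le> real n * K / 4" by simp
  have "0 < real n / (2 * b)" using n_pos b_pos by simp
  with lower show "0 < cross_info i" by linarith
qed

lemma cross_info_nonneg: "i \<in> R \<Longrightarrow> 0 \<le> cross_info i"
  using cross_info_bounds(3) by (rule less_imp_le)

lemma inverse_cross_info_bounds:
  assumes i: "i \<in> R"
  shows "1 / cross_info i \<le> 2 * b / n" "0 < 1 / cross_info i"
proof -
  have "0 < real n / (2 * b)" using n_pos b_pos by simp
  then have "1 / cross_info i \<le> 1 / (real n / (2 * b))"
    using cross_info_bounds(1)[OF i] by (intro divide_left_mono mult_pos_pos) auto
  then show "1 / cross_info i \<le> 2 * b / n" by simp
  show "0 < 1 / cross_info i" using cross_info_bounds(3)[OF i] by simp
qed

lemma sum_cross_info: "0 < sum cross_info R" "sum cross_info R \<le> real r * real n * K / 4"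
proof -
  show "0 < sum cross_info R" using cross_info_bounds(3) r3 by (intro sum_pos) auto
  have "sum cross_info R \<le> (\<Sum>i\<in>R. real n * K / 4)" using cross_info_bounds(2) by (intro sum_mono)
  also have "\<dots> \<le> real r * (real n * K / 4)" by (auto intro!: mult_right_mono)
  finally show "sum cross_info R \<le> real r * real n * K / 4" by simp
qed

lemma weighted_var_cross_info_affine:
  "weighted_var cross_info R (\<lambda>i. c + s * f i) = s\<^sup>2 * weighted_var cross_info R f"
  using sum_cross_info(1) by (intro weighted_var_affine) simp

lemma weighted_var_cross_info_le:
  fixes w :: real
  assumes "osc_le R f w"
  shows "weighted_var cross_info R f \<le> real r * real n * K / 4 * w\<^sup>2"
proof -
  have "weighted_var cross_info R f \<le> sum cross_info R * w\<^sup>2"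
    by (rule weighted_var_le_osc[OF cross_info_nonneg sum_cross_info(1) assms])
  also have "\<dots> \<le> real r * real n * K / 4 * w\<^sup>2" by (intro mult_right_mono sum_cross_info) simp
  finally show ?thesis .
qed

lemma weighted_var_cross_info_nonneg: "0 \<le> weighted_var cross_info R f"
  by (rule weighted_var_nonneg) (rule cross_info_nonneg)

lemma dirichlet_form_info_split:
  "dirichlet_form info I f
    = dirichlet_form info R f + (\<Sum>i\<in>R. \<Sum>j\<in>S. info i j * (f i - f j)\<^sup>2) + dirichlet_form info S f"
  using dirichlet_form_union[of R S info f, OF _ _ RS_partition(2) info_sym] unfolding RS_partition(1) by simp

section \<open>Existence and consistency of the maximum likelihood estimator\<close>

definition deviation :: "(nat \<Rightarrow> real) \<Rightarrow> nat \<Rightarrow> real" where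
  "deviation \<theta> i = \<theta> i - \<beta> i"

lemma theta_null: "i \<in> R \<Longrightarrow> \<theta> i = \<beta> 2 + deviation \<theta> i"
  using H0[of i] by (simp add: deviation_def)

lemma theta_diff: "\<theta> i - \<theta> j = \<beta> i - \<beta> j + (deviation \<theta> i - deviation \<theta> j)"
  by (simp add: deviation_def)

lemma score_diff:
  "score \<beta> a i - score \<theta> a i = (\<Sum>j\<in>I. real (k i j) * (logistic (\<theta> i - \<theta> j) - logistic (\<beta> i - \<beta> j)))"
  unfolding score_def sum_subtractf[symmetric]
  by (intro sum.cong refl) (simp add: residual_def algebra_simps)

lemma edge_potential_bregman:
  "edge_potential I (\<lambda>i j t. real (k i j) * bregman (\<beta> i - \<beta> j) t)
     (\<lambda>i j t. real (k i j) * (logistic (\<beta> i - \<beta> j + t) - logistic (\<beta> i - \<beta> j))) b"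
proof
  show "((\<lambda>t. real (k i j) * bregman (\<beta> i - \<beta> j) t) has_real_derivative
      real (k i j) * (logistic (\<beta> i - \<beta> j + t) - logistic (\<beta> i - \<beta> j))) (at t)" for i j t
    unfolding bregman_def by (auto intro!: derivative_eq_intros DERIV_chain2[OF DERIV_softplus])
  show "real (k j i) * (logistic (\<beta> j - \<beta> i + - t) - logistic (\<beta> j - \<beta> i))
      = - (real (k i j) * (logistic (\<beta> i - \<beta> j + t) - logistic (\<beta> i - \<beta> j)))" for i j t
  proof -
    have "logistic (\<beta> j - \<beta> i + - t) = 1 - logistic (\<beta> i - \<beta> j + t)"
        "logistic (\<beta> j - \<beta> i) = 1 - logistic (\<beta> i - \<beta> j)"
      using logistic_minus[of "\<beta> i - \<beta> j + t"] logistic_minus[of "\<beta> i - \<beta> j"] by (simp_all add: algebra_simps)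
    then show ?thesis unfolding k_sym[of j i] by (simp only:) (simp add: algebra_simps)
  qed
  show "(1 - exp (- t)) / b \<le> real (k i j) * (logistic (\<beta> i - \<beta> j + t) - logistic (\<beta> i - \<beta> j))"
    if "i \<in> I" "j \<in> I" "i \<noteq> j" "0 \<le> t" for i j t
  proof -
    have "(1 - exp (- t)) / b = 1 * (1 / b * (1 - exp (- t)))" by simp
    also have "\<dots> \<le> real (k i j) * (dlogistic (\<beta> i - \<beta> j) * (1 - exp (- t)))"
      using k_bounds[OF that(1-3)] b_bound[OF that(1-3)] b_pos that(4) by (intro mult_mono mult_right_mono) auto
    also have "\<dots> \<le> real (k i j) * (logistic (\<beta> i - \<beta> j + t) - logistic (\<beta> i - \<beta> j))"
      by (intro mult_left_mono logistic_increment_ge that) simp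
    finally show ?thesis .
  qed
qed (use b_pos in auto)

lemma mle_exists:
  fixes w :: real
  assumes a: "outcome a" and w: "w \<le> 1" and score: "\<And>i. i \<in> I \<Longrightarrow> \<bar>score \<beta> a i\<bar> \<le> n * w / (4 * b)"
  obtains \<theta> where "\<theta> 1 = 0" "osc_le I (deviation \<theta>) w" "stationary a \<theta>"
proof -
  interpret edge_potential I "\<lambda>i j t. real (k i j) * bregman (\<beta> i - \<beta> j) t"
     "\<lambda>i j t. real (k i j) * (logistic (\<beta> i - \<beta> j + t) - logistic (\<beta> i - \<beta> j))" b
    by (rule edge_potential_bregman)
  have X: "4 * b * (n * w / (4 * b)) = n * w" using b_pos by simp
  show ?thesis
  proof (rule critical_point_exists[OF one_in(1) sum_score[OF a] score, unfolded X])
    show "n * w \<le> card I" using w by (simp add: mult_left_le)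
    fix f assume f: "f 1 = 0" "osc_le I f (n * w / card I)" "\<And>i. i \<in> I \<Longrightarrow> net_flow f i = score \<beta> a i"
    define \<theta> where "\<theta> i = \<beta> i + f i" for i
    have dev: "deviation \<theta> = f" by (simp add: deviation_def \<theta>_def fun_eq_iff)
    have "score \<theta> a i = 0" if "i \<in> I" for i
      using f(3)[OF that, unfolded net_flow_def] score_diff[of a i \<theta>] unfolding theta_diff[of \<theta>] dev by simp
    then have "stationary a \<theta>" by (simp add: stationary_def)
    moreover have "\<theta> 1 = 0" by (simp only: \<theta>_def f(1) beta1 add_0)
    moreover have "osc_le I (deviation \<theta>) w" using f(2) n_pos by (simp add: dev)
    ultimately show ?thesis using that by blast
  qed
qed

section \<open>The likelihood ratio as a weighted variance of the estimator\<close>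

lemma weighted_var_deviation:
  "weighted_var cross_info R \<theta> = weighted_var cross_info R (deviation \<theta>)"
proof -
  have "weighted_var cross_info R \<theta> = weighted_var cross_info R (\<lambda>i. \<beta> 2 + 1 * deviation \<theta> i)"
    by (rule weighted_var_cong) (simp only: mult_1, rule theta_null)
  then show ?thesis by (simp only: weighted_var_cross_info_affine) simp
qed

lemma osc_le_R_iff_deviation: "osc_le R \<theta> w \<longleftrightarrow> osc_le R (deviation \<theta>) w"
proof -
  have "\<theta> i - \<theta> j = deviation \<theta> i - deviation \<theta> j" if "i \<in> R" "j \<in> R" for i j
    using theta_null[OF that(1), of \<theta>] theta_null[OF that(2), of \<theta>] by linarith
  then show ?thesis by (simp add: osc_le_def)
qed

lemma bregman_loss_bounds:
  assumes "osc_le I (deviation \<theta>) w" "osc_le I \<delta> h"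
  shows "2 * bregman_loss \<theta> \<delta> \<le> exp (w + h) * dirichlet_form info I \<delta>"
    and "exp (- (w + h)) * dirichlet_form info I \<delta> \<le> 2 * bregman_loss \<theta> \<delta>"
proof -
  have step: "\<bar>(\<theta> i - \<theta> j) - (\<beta> i - \<beta> j)\<bar> + \<bar>\<delta> i - \<delta> j\<bar> \<le> w + h" if "i \<in> I" "j \<in> I" for i j
    unfolding theta_diff[of \<theta>] using assms that by (simp add: osc_le_def add_mono)
  have pairs: "real (k i j) * (2 * bregman (\<theta> i - \<theta> j) (\<delta> i - \<delta> j)) \<le> real (k i j) * (exp (w + h) * (dlogistic (\<beta> i - \<beta> j) * (\<delta> i - \<delta> j)\<^sup>2))"
      "real (k i j) * (exp (- (w + h)) * (dlogistic (\<beta> i - \<beta> j) * (\<delta> i - \<delta> j)\<^sup>2)) \<le> real (k i j) * (2 * bregman (\<theta> i - \<theta> j) (\<delta> i - \<delta> j))"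
    if "i \<in> I" "j \<in> I" for i j
  proof -
    have nonneg: "0 \<le> dlogistic (\<beta> i - \<beta> j) * (\<delta> i - \<delta> j)\<^sup>2" using dlogistic_pos[of "\<beta> i - \<beta> j"] by simp
    note bounds = bregman_quadratic_bounds[where t = "\<theta> i - \<theta> j" and h = "\<delta> i - \<delta> j" and s = "\<beta> i - \<beta> j"]
    have "2 * bregman (\<theta> i - \<theta> j) (\<delta> i - \<delta> j) \<le> exp (w + h) * (dlogistic (\<beta> i - \<beta> j) * (\<delta> i - \<delta> j)\<^sup>2)"
      by (rule order_trans[OF bounds(1) mult_right_mono[OF _ nonneg]]) (use step[OF that] in simp)
    then show "real (k i j) * (2 * bregman (\<theta> i - \<theta> j) (\<delta> i - \<delta> j)) \<le> real (k i j) * (exp (w + h) * (dlogistic (\<beta> i - \<beta> j) * (\<delta> i - \<delta> j)\<^sup>2))"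
      by (rule mult_left_mono) simp
    have "exp (- (w + h)) * (dlogistic (\<beta> i - \<beta> j) * (\<delta> i - \<delta> j)\<^sup>2) \<le> 2 * bregman (\<theta> i - \<theta> j) (\<delta> i - \<delta> j)"
      by (rule order_trans[OF mult_right_mono[OF _ nonneg] bounds(2)]) (use step[OF that] in simp)
    then show "real (k i j) * (exp (- (w + h)) * (dlogistic (\<beta> i - \<beta> j) * (\<delta> i - \<delta> j)\<^sup>2)) \<le> real (k i j) * (2 * bregman (\<theta> i - \<theta> j) (\<delta> i - \<delta> j))"
      by (rule mult_left_mono) simp
  qed
  have loss: "2 * bregman_loss \<theta> \<delta> = (\<Sum>i\<in>I. \<Sum>j\<in>I. real (k i j) * (2 * bregman (\<theta> i - \<theta> j) (\<delta> i - \<delta> j))) / 2"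
    by (simp add: bregman_loss_def sum_distrib_left mult_ac)
  have form: "c * dirichlet_form info I \<delta> = (\<Sum>i\<in>I. \<Sum>j\<in>I. real (k i j) * (c * (dlogistic (\<beta> i - \<beta> j) * (\<delta> i - \<delta> j)\<^sup>2))) / 2" for c
    by (simp add: dirichlet_form_def info_def sum_distrib_left mult_ac)
  show "2 * bregman_loss \<theta> \<delta> \<le> exp (w + h) * dirichlet_form info I \<delta>"
    unfolding loss form by (intro divide_right_mono sum_mono pairs) auto
  show "exp (- (w + h)) * dirichlet_form info I \<delta> \<le> 2 * bregman_loss \<theta> \<delta>"
    unfolding loss form by (intro divide_right_mono sum_mono pairs) auto
qed

lemma dirichlet_form_R_le:
  fixes w :: real
  assumes "osc_le R \<delta> w"
  shows "dirichlet_form info R \<delta> \<le> (real r)\<^sup>2 * K * w\<^sup>2"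
proof -
  have "dirichlet_form info R \<delta> \<le> dirichlet_form (\<lambda>_ _. K) R \<delta>"
  proof (rule dirichlet_form_mono)
    fix i j assume "i \<in> R" "j \<in> R" "i \<noteq> j"
    then have "info i j \<le> K / 4" using R_sub by (intro info_bounds) auto
    then show "info i j \<le> K" using K_ge_1 by simp
  qed
  also have "\<dots> \<le> (\<Sum>i\<in>R. \<Sum>j\<in>R. K * w\<^sup>2)"
  proof -
    have "real K * (\<delta> i - \<delta> j)\<^sup>2 \<le> K * w\<^sup>2" if "i \<in> R" "j \<in> R" for i j
      using osc_leD[OF assms that]
      by (intro mult_left_mono power2_mono order_trans[OF _ abs_ge_self]) auto
    then have "(\<Sum>i\<in>R. \<Sum>j\<in>R. real K * (\<delta> i - \<delta> j)\<^sup>2) \<le> (\<Sum>i\<in>R. \<Sum>j\<in>R. K * w\<^sup>2)" by (intro sum_mono)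
    moreover have "0 \<le> (\<Sum>i\<in>R. \<Sum>j\<in>R. real K * (\<delta> i - \<delta> j)\<^sup>2)" by (intro sum_nonneg) auto
    ultimately show ?thesis by (simp add: dirichlet_form_def)
  qed
  also have "\<dots> = (real (card R))\<^sup>2 * (K * w\<^sup>2)" by (simp only: sum_constant power2_eq_square[of "real (card R)"] mult.assoc)
  also have "\<dots> \<le> (real r)\<^sup>2 * (K * w\<^sup>2)" by (intro mult_right_mono power_mono) auto
  finally show ?thesis by simp
qed

lemma lr_stat_upper:
  fixes w :: real
  assumes a: "outcome a" and \<theta>: "stationary a \<theta>" "\<theta> 1 = 0" and osc: "osc_le I (deviation \<theta>) w"
  shows "bt_lr_stat n r k a \<le> exp (2 * w) * (weighted_var cross_info R \<theta> + (real r)\<^sup>2 * K * w\<^sup>2)"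
proof -
  define m where "m = weighted_mean cross_info R \<theta>"
  define \<delta> where "\<delta> i = (if i \<in> R then m - \<theta> i else 0)" for i
  have osc_R: "osc_le R \<theta> w"
    unfolding osc_le_R_iff_deviation[of \<theta>] by (rule osc_le_subset[OF osc R_sub])
  have m: "\<bar>\<theta> i - m\<bar> \<le> w" if "i \<in> R" for i
    unfolding m_def by (rule weighted_mean_osc[OF cross_info_nonneg sum_cross_info(1) osc_R that])
  have "0 \<le> w" using osc_leD[OF osc one_in(1) one_in(1)] by simp
  then have "\<bar>\<delta> i - \<delta> j\<bar> \<le> w" for i j
    using m[of i] m[of j] osc_leD[OF osc_R, of i j] unfolding \<delta>_def by (simp split: if_splits) linarith+
  then have osc_\<delta>: "osc_le I \<delta> w" by (simp add: osc_le_def)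
  have "dirichlet_form info I \<delta> \<le> weighted_var cross_info R \<theta> + (real r)\<^sup>2 * K * w\<^sup>2"
  proof -
    have "(\<Sum>i\<in>R. \<Sum>j\<in>S. info i j * (\<delta> i - \<delta> j)\<^sup>2) = (\<Sum>i\<in>R. cross_info i * (\<theta> i - m)\<^sup>2)"
      unfolding cross_info_def sum_distrib_right by (intro sum.cong refl) (auto simp: \<delta>_def power2_commute)
    moreover have "(\<Sum>i\<in>S. \<Sum>j\<in>S. info i j * (\<delta> i - \<delta> j)\<^sup>2) = 0"
      by (intro sum.neutral ballI) (auto simp: \<delta>_def)
    then have "dirichlet_form info S \<delta> = 0" by (simp add: dirichlet_form_def)
    ultimately show ?thesis
      using dirichlet_form_R_le[OF osc_le_subset[OF osc_\<delta> R_sub]]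
      unfolding dirichlet_form_info_split weighted_var_def m_def by linarith
  qed
  then have energy: "exp (w + w) * dirichlet_form info I \<delta>
      \<le> exp (w + w) * (weighted_var cross_info R \<theta> + (real r)\<^sup>2 * K * w\<^sup>2)"
    by (rule mult_left_mono) simp
  have "(\<lambda>i. \<theta> i + \<delta> i) \<in> bt_null_space r"
    using \<theta>(2) r3 by (auto simp: bt_null_space_def \<delta>_def)
  from lr_stat_le[OF a \<theta> this] have "bt_lr_stat n r k a \<le> 2 * bregman_loss \<theta> \<delta>"
    by (simp only: add_diff_cancel_left')
  also have "\<dots> \<le> exp (w + w) * dirichlet_form info I \<delta>"
    by (rule bregman_loss_bounds(1)[OF osc osc_\<delta>])
  also note energy
  finally show ?thesis by (simp only: mult_2)
qed

lemma bregman_loss_ge_of_large_step: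
  fixes w h :: real
  assumes osc: "osc_le I (deviation \<theta>) w" and h: "0 < h" and "w + h \<le> 1" and "\<not> osc_le I \<delta> h"
  shows "n * h\<^sup>2 / (12 * b) \<le> 2 * bregman_loss \<theta> \<delta>"
proof -
  have image: "finite (\<delta> ` I)" "\<delta> ` I \<noteq> {}" using one_in(1) by auto
  obtain p where p: "p \<in> I" "\<delta> p = Max (\<delta> ` I)" using Max_in[OF image] by auto
  obtain q where q: "q \<in> I" "\<delta> q = Min (\<delta> ` I)" using Min_in[OF image] by auto
  have range: "\<delta> q \<le> \<delta> i \<and> \<delta> i \<le> \<delta> p" if "i \<in> I" for i using that p(2) q(2) by auto
  define M where "M = \<delta> p - \<delta> q"
  have osc_M: "\<bar>\<delta> i - \<delta> j\<bar> \<le> M" if "i \<in> I" "j \<in> I" for i j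
    using range[OF that(1)] range[OF that(2)] by (auto simp: M_def)
  then have "h < M" using \<open>\<not> osc_le I \<delta> h\<close> by (force simp: osc_le_def)
  define s where "s = h / M"
  have s: "0 \<le> s" "s \<le> 1" "s * M = h" using h \<open>h < M\<close> by (auto simp: s_def)
  have scaled: "osc_le I (\<lambda>i. s * \<delta> i) h"
    unfolding osc_le_def
  proof (intro ballI)
    fix i j assume "i \<in> I" "j \<in> I"
    then have "s * \<bar>\<delta> i - \<delta> j\<bar> \<le> s * M" using s by (intro mult_left_mono osc_M)
    then show "\<bar>s * \<delta> i - s * \<delta> j\<bar> \<le> h" using s by (simp add: abs_mult flip: right_diff_distrib)
  qed
  have "1 / b * card I * (s * \<delta> p - s * \<delta> q)\<^sup>2 / 4 \<le> dirichlet_form info I (\<lambda>i. s * \<delta> i)"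
    using b_pos p(1) q(1) by (intro dirichlet_form_ge_sq_diff info_bounds) auto
  moreover have "s * \<delta> p - s * \<delta> q = h" using s(3) by (simp add: M_def right_diff_distrib)
  ultimately have energy: "n * h\<^sup>2 / (4 * b) \<le> dirichlet_form info I (\<lambda>i. s * \<delta> i)" by simp
  have "exp (w + h) \<le> 3" using \<open>w + h \<le> 1\<close> exp_le by (meson exp_le_cancel_iff order_trans)
  then have "inverse 3 \<le> inverse (exp (w + h))" by (intro le_imp_inverse_le) auto
  then have "1 / 3 \<le> exp (- (w + h))" by (simp only: exp_minus inverse_eq_divide)
  then have "1 / 3 * (n * h\<^sup>2 / (4 * b)) \<le> exp (- (w + h)) * dirichlet_form info I (\<lambda>i. s * \<delta> i)"
    using energy b_pos by (intro mult_mono) auto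
  also have "\<dots> \<le> 2 * bregman_loss \<theta> (\<lambda>i. s * \<delta> i)" by (rule bregman_loss_bounds(2)[OF osc scaled])
  also have "\<dots> \<le> 2 * bregman_loss \<theta> \<delta>" using bregman_loss_scale_le[OF s(1,2)] by simp
  finally show ?thesis by simp
qed

lemma weighted_var_le_dirichlet_form_info:
  "(1 - real r * K * b / (2 * real n)) * weighted_var cross_info R \<delta> \<le> dirichlet_form info I \<delta>"
proof -
  have "(1 - card R * (real K / 4) / (1 / b * card S)) * weighted_var cross_info R \<delta> \<le> dirichlet_form info (R \<union> S) \<delta>"
    unfolding cross_info_def[abs_def]
  proof (rule weighted_var_le_dirichlet_form)
    show "S \<noteq> {}" using one_in(2) by blast
    show "0 < (\<Sum>i\<in>R. sum (info i) S)" using sum_cross_info(1) by (simp add: cross_info_def)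
    show "info i j \<le> real K / 4" if "i \<in> R" "j \<in> S" for i j
      using that R_sub by (intro info_bounds) auto
    show "1 / b \<le> info i j" if "i \<in> S" "j \<in> S" "i \<noteq> j" for i j
      using that by (intro info_bounds) auto
  qed (use r3 b_pos info_sym info_nonneg in auto)
  moreover have "card R * (real K / 4) / (1 / b * card S) \<le> real r * K * b / (2 * real n)"
  proof -
    have "card R * (real K / 4) / (1 / b * card S) \<le> real r * (real K / 4) / (1 / b * (real n / 2))"
      using card_S_ge n_pos b_pos by (intro frac_le mult_mono mult_nonneg_nonneg) auto
    then show ?thesis by (simp add: mult_ac)
  qed
  then have "(1 - real r * K * b / (2 * real n)) * weighted_var cross_info R \<delta>
      \<le> (1 - card R * (real K / 4) / (1 / b * card S)) * weighted_var cross_info R \<delta>"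
    by (intro mult_right_mono weighted_var_cross_info_nonneg) simp
  ultimately show ?thesis unfolding RS_partition(1) by linarith
qed

lemma bregman_loss_ge_weighted_var:
  fixes w :: real
  assumes osc: "osc_le I (deviation \<theta>) w" and "0 < w" and small: "w + 2 * real r * K * b * w \<le> 1"
    and var: "weighted_var cross_info R \<delta> \<le> real r * real n * K / 4 * w\<^sup>2"
  shows "(1 - w - 2 * real r * K * b * w) * ((1 - real r * K * b / (2 * real n)) * weighted_var cross_info R \<delta>)
    \<le> 2 * bregman_loss \<theta> \<delta>"
proof -
  define h where "h = 2 * real r * K * b * w"
  define V where "V = weighted_var cross_info R \<delta>"
  define \<kappa> where "\<kappa> = real r * K * b / (2 * real n)"
  have V: "0 \<le> V" unfolding V_def by (rule weighted_var_cross_info_nonneg)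
  have h: "0 < h" using \<open>0 < w\<close> b_pos K_ge_1 r3 by (simp add: h_def)
  have factor: "0 \<le> 1 - w - h" using small by (simp add: h_def)
  have "(1 - w - h) * ((1 - \<kappa>) * V) \<le> 2 * bregman_loss \<theta> \<delta>"
  proof (cases "osc_le I \<delta> h")
    case True
    have "(1 - w - h) * ((1 - \<kappa>) * V) \<le> (1 - w - h) * dirichlet_form info I \<delta>"
      using factor weighted_var_le_dirichlet_form_info unfolding \<kappa>_def V_def by (rule mult_left_mono[rotated])
    also have "(1 - w - h) * dirichlet_form info I \<delta> \<le> exp (- (w + h)) * dirichlet_form info I \<delta>"
      using exp_ge_add_one_self[of "- (w + h)"] by (intro mult_right_mono dirichlet_form_nonneg info_nonneg) linarith
    also have "\<dots> \<le> 2 * bregman_loss \<theta> \<delta>" by (rule bregman_loss_bounds(2)[OF osc True])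
    finally show ?thesis .
  next
    case False
    have "1 * 3 \<le> b * (real r * K)" using b1 K_ge_1 r3 mult_mono[of 3 "real r" 1 "real K"] by (intro mult_mono) auto
    have "0 \<le> \<kappa> * V" using V b_pos by (simp add: \<kappa>_def)
    then have "(1 - w - h) * ((1 - \<kappa>) * V) \<le> (1 - w - h) * V"
      using factor by (intro mult_left_mono) (auto simp: left_diff_distrib)
    also have "\<dots> \<le> 1 * V" using \<open>0 < w\<close> h V by (intro mult_right_mono) auto
    also have "\<dots> \<le> 1 / 4 * (real r * real n * K * w\<^sup>2)" using var by (simp add: V_def)
    also have "\<dots> \<le> b * (real r * K) / 3 * (real r * real n * K * w\<^sup>2)"
      using \<open>1 * 3 \<le> b * (real r * K)\<close> by (intro mult_right_mono) auto
    also have "\<dots> = n * h\<^sup>2 / (12 * b)"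
      using b_pos by (simp add: h_def power2_eq_square field_simps)
    also have "\<dots> \<le> 2 * bregman_loss \<theta> \<delta>"
      using osc h factor False by (intro bregman_loss_ge_of_large_step) auto
    finally show ?thesis .
  qed
  then show ?thesis by (simp add: h_def V_def \<kappa>_def)
qed

lemma lr_stat_lower:
  fixes w :: real
  assumes a: "outcome a" and \<theta>: "stationary a \<theta>" "\<theta> 1 = 0" and osc: "osc_le I (deviation \<theta>) w"
    and w: "0 < w" "w + 2 * real r * K * b * w \<le> 1"
  shows "(1 - w - 2 * real r * K * b * w) * ((1 - real r * K * b / (2 * real n)) * weighted_var cross_info R \<theta>)
    \<le> bt_lr_stat n r k a"
proof (rule lr_stat_ge[OF a \<theta>])
  fix \<gamma> assume \<gamma>: "\<gamma> \<in> bt_null_space r"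
  have "weighted_var cross_info R (\<lambda>i. \<gamma> i - \<theta> i) = weighted_var cross_info R (\<lambda>i. \<gamma> 2 + - 1 * \<theta> i)"
  proof (rule weighted_var_cong)
    fix i assume "i \<in> R"
    then have "\<gamma> i = \<gamma> 2" using \<gamma> unfolding bt_null_space_def by blast
    then show "\<gamma> i - \<theta> i = \<gamma> 2 + - 1 * \<theta> i" by simp
  qed
  then have var: "weighted_var cross_info R (\<lambda>i. \<gamma> i - \<theta> i) = weighted_var cross_info R \<theta>"
    by (simp only: weighted_var_cross_info_affine) simp
  have "weighted_var cross_info R \<theta> \<le> real r * real n * K / 4 * w\<^sup>2"
    unfolding weighted_var_deviation[of \<theta>]
    by (rule weighted_var_cross_info_le[OF osc_le_subset[OF osc R_sub]])
  from bregman_loss_ge_weighted_var[OF osc w, of "\<lambda>i. \<gamma> i - \<theta> i", unfolded var, OF this]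
  show "(1 - w - 2 * real r * K * b * w) * ((1 - real r * K * b / (2 * real n)) * weighted_var cross_info R \<theta>)
      \<le> 2 * bregman_loss \<theta> (\<lambda>i. \<gamma> i - \<theta> i)" .
qed

section \<open>Expansion of the estimator\<close>

definition bump :: "nat \<Rightarrow> nat \<Rightarrow> real" where
  "bump i m = (if m = i then 1 / cross_info i else 0)"

lemma sum_info_bounds:
  assumes i: "i \<in> R"
  shows "0 \<le> sum (info i) (I - {i}) - cross_info i" "sum (info i) (I - {i}) - cross_info i \<le> real r * K / 4"
proof -
  have "I - {i} = S \<union> (R - {i})" using R_sub i by auto
  moreover have "sum (info i) (S \<union> (R - {i})) = sum (info i) S + sum (info i) (R - {i})"
    by (rule sum.union_disjoint) auto
  ultimately have split: "sum (info i) (I - {i}) - cross_info i = sum (info i) (R - {i})"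
    by (simp add: cross_info_def)
  show "0 \<le> sum (info i) (I - {i}) - cross_info i" unfolding split by (intro sum_nonneg info_nonneg)
  have "sum (info i) (R - {i}) \<le> (\<Sum>j\<in>R - {i}. K / 4)"
    using i R_sub by (intro sum_mono info_bounds) auto
  also have "\<dots> \<le> real r * (K / 4)" using i by (auto intro!: mult_right_mono)
  finally show "sum (info i) (I - {i}) - cross_info i \<le> real r * K / 4" unfolding split by simp
qed

lemma laplacian_bump:
  assumes i: "i \<in> R" and m: "m \<in> I"
  shows "\<bar>laplacian info I (bump i) m - (if m = i then 1 else 0)\<bar> \<le> real r * K / 4 * (1 / cross_info i)"
proof -
  have iI: "i \<in> I" using i R_sub by auto
  note A = inverse_cross_info_bounds(2)[OF i]
  show ?thesis
  proof (cases "m = i")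
    case True
    have "laplacian info I (bump i) i = (\<Sum>j\<in>I - {i}. info i j * (1 / cross_info i))"
      using iI unfolding laplacian_def by (subst sum.remove[of _ i]) (auto simp: bump_def intro!: sum.cong)
    also have "\<dots> = sum (info i) (I - {i}) * (1 / cross_info i)" by (rule sum_distrib_right[symmetric])
    finally have lap: "laplacian info I (bump i) i - 1 = (sum (info i) (I - {i}) - cross_info i) * (1 / cross_info i)"
      using cross_info_bounds(3)[OF i] by (simp add: diff_divide_distrib)
    have "\<bar>laplacian info I (bump i) i - 1\<bar> \<le> real r * K / 4 * (1 / cross_info i)"
      unfolding lap abs_mult using A sum_info_bounds[OF i] by (intro mult_mono) auto
    then show ?thesis using True by simp
  next
    case False
    have "laplacian info I (bump i) m = - info m i * (1 / cross_info i)"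
      using iI False unfolding laplacian_def
      by (subst sum.remove[of _ i]) (auto simp: bump_def intro!: sum.neutral)
    then have lap: "\<bar>laplacian info I (bump i) m - (if m = i then 1 else 0)\<bar> = info m i * (1 / cross_info i)"
      using False A info_nonneg[of m i] by (simp add: abs_mult)
    have "info m i \<le> 1 * (K / 4)" using info_bounds(2)[OF m iI False] by simp
    also have "\<dots> \<le> real r * (K / 4)" using r3 by (intro mult_right_mono) auto
    finally show ?thesis unfolding lap using A by (intro mult_right_mono) auto
  qed
qed

text \<open>A corrector turns the one-point function \<open>bump i\<close> into an exact solution \<open>f\<close> of
  \<open>laplacian info I f = 1\<^sub>i - 1/n\<close>; it is smaller than \<open>bump i\<close> by a factor of order \<open>b / n\<close>.\<close>

definition is_corrector :: "nat \<Rightarrow> (nat \<Rightarrow> real) \<Rightarrow> bool" where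
  "is_corrector i z \<longleftrightarrow> z 1 = 0 \<and> osc_le I z (4 * real r * K * b\<^sup>2 / (real n)\<^sup>2) \<and>
     (\<forall>m\<in>I. laplacian info I (\<lambda>j. z j + bump i j) m = (if m = i then 1 else 0) - 1 / n)"

definition corrector :: "nat \<Rightarrow> nat \<Rightarrow> real" where
  "corrector i = (SOME z. is_corrector i z)"

lemma corrector_exists:
  assumes i: "i \<in> R"
  shows "\<exists>z. is_corrector i z"
proof -
  define x where "x m = (if m = i then 1 else 0) - 1 / n - laplacian info I (bump i) m" for m
  have iI: "i \<in> I" using i R_sub by auto
  have "(\<Sum>m\<in>I. if m = i then 1 else 0 :: real) = 1" "(\<Sum>m\<in>I. 1 / real n) = 1" using iI by auto
  then have x0: "(\<Sum>m\<in>I. x m) = 0"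
    unfolding x_def sum_subtractf by (simp add: sum_laplacian[OF info_sym])
  have x_le: "\<bar>x m\<bar> \<le> real r * K * b / n" if m: "m \<in> I" for m
  proof -
    have "\<bar>x m\<bar> \<le> 1 / n + \<bar>laplacian info I (bump i) m - (if m = i then 1 else 0)\<bar>"
    proof -
      define e where "e = (if m = i then 1 else 0 :: real)"
      have "0 \<le> 1 / real n" by simp
      then show ?thesis unfolding x_def e_def[symmetric] by linarith
    qed
    also have "\<dots> \<le> 1 / n + real r * K / 4 * (2 * b / n)"
      by (intro add_left_mono order_trans[OF laplacian_bump[OF i m] mult_left_mono[OF inverse_cross_info_bounds(1)[OF i]]]) simp
    also have "\<dots> \<le> real r * K * b / n"
    proof -
      have "2 * (1 * 1) \<le> real r * (K * b)" using r3 K_ge_1 b1 by (intro mult_mono) auto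
      then have "(1 + real r * (K * b) / 2) / n \<le> (real r * (K * b)) / n" by (intro divide_right_mono) auto
      then show ?thesis by (simp add: add_divide_distrib mult_ac)
    qed
    finally show ?thesis .
  qed
  show ?thesis
  proof (rule laplacian_solvable[OF finite_atLeastAtMost one_in(1) b_pos info_sym info_bounds(1) x0 x_le])
    fix z
    assume z: "z 1 = 0" "osc_le I z (4 * b * (real r * K * b / n) / card I)" "\<And>m. m \<in> I \<Longrightarrow> laplacian info I z m = x m"
    have "laplacian info I (\<lambda>j. z j + bump i j) m = (if m = i then 1 else 0) - 1 / n" if "m \<in> I" for m
      unfolding laplacian_add z(3)[OF that] x_def by simp
    moreover have "4 * b * (real r * K * b / n) / card I = 4 * real r * K * b\<^sup>2 / (real n)\<^sup>2"
      by (simp add: power2_eq_square)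
    ultimately have "is_corrector i z" unfolding is_corrector_def using z(1,2) by metis
    then show ?thesis by blast
  qed
qed

lemma corrector:
  assumes "i \<in> R"
  shows "corrector i 1 = 0" "osc_le I (corrector i) (4 * real r * K * b\<^sup>2 / (real n)\<^sup>2)"
    and "\<And>m. m \<in> I \<Longrightarrow> laplacian info I (\<lambda>j. corrector i j + bump i j) m = (if m = i then 1 else 0) - 1 / n"
proof -
  have "is_corrector i (corrector i)"
    unfolding corrector_def using corrector_exists[OF assms] by (rule someI_ex)
  then show "corrector i 1 = 0" "osc_le I (corrector i) (4 * real r * K * b\<^sup>2 / (real n)\<^sup>2)"
    "\<And>m. m \<in> I \<Longrightarrow> laplacian info I (\<lambda>j. corrector i j + bump i j) m = (if m = i then 1 else 0) - 1 / n"
    unfolding is_corrector_def by blast+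
qed

definition score_remainder :: "(nat \<Rightarrow> real) \<Rightarrow> nat \<Rightarrow> real" where
  "score_remainder \<theta> i = (\<Sum>j\<in>I. real (k i j) * (logistic (\<theta> i - \<theta> j) - logistic (\<beta> i - \<beta> j)
     - dlogistic (\<beta> i - \<beta> j) * (deviation \<theta> i - deviation \<theta> j)))"

lemma laplacian_deviation:
  assumes "stationary a \<theta>" "i \<in> I"
  shows "laplacian info I (deviation \<theta>) i = score \<beta> a i - score_remainder \<theta> i"
proof -
  have "score \<beta> a i = (\<Sum>j\<in>I. real (k i j) * (logistic (\<theta> i - \<theta> j) - logistic (\<beta> i - \<beta> j)))"
    using score_diff[of a i \<theta>] assms by (simp add: stationary_def)
  then show ?thesis
    by (simp add: laplacian_def score_remainder_def info_def sum_subtractf[symmetric] algebra_simps)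
qed

lemma score_remainder_le:
  fixes w :: real
  assumes osc: "osc_le I (deviation \<theta>) w" and i: "i \<in> I"
  shows "\<bar>score_remainder \<theta> i\<bar> \<le> n * (K * w\<^sup>2 / 8)"
proof -
  have "\<bar>score_remainder \<theta> i\<bar> \<le> (\<Sum>j\<in>I. K * w\<^sup>2 / 8)"
    unfolding score_remainder_def
  proof (rule order_trans[OF sum_abs], rule sum_mono)
    fix j assume j: "j \<in> I"
    define h where "h = deviation \<theta> i - deviation \<theta> j"
    define \<rho> where "\<rho> = logistic (\<theta> i - \<theta> j) - logistic (\<beta> i - \<beta> j) - dlogistic (\<beta> i - \<beta> j) * h"
    have \<rho>: "\<bar>\<rho>\<bar> \<le> h\<^sup>2 / 8"
      using logistic_taylor[of "\<beta> i - \<beta> j" h] unfolding \<rho>_def h_def theta_diff[of \<theta>, symmetric] .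
    have "h\<^sup>2 \<le> w\<^sup>2"
      using osc_leD[OF osc i j] by (intro power2_mono order_trans[OF _ abs_ge_self]) (simp add: h_def)
    with \<rho> have "\<bar>\<rho>\<bar> \<le> w\<^sup>2 / 8" by linarith
    have "\<bar>real (k i j) * \<rho>\<bar> \<le> K * (w\<^sup>2 / 8)"
    proof (cases "i = j")
      case False
      show ?thesis unfolding abs_mult
        using k_bounds[OF i j False] \<open>\<bar>\<rho>\<bar> \<le> w\<^sup>2 / 8\<close> by (intro mult_mono) auto
    qed (simp add: \<rho>_def h_def)
    then show "\<bar>real (k i j) * (logistic (\<theta> i - \<theta> j) - logistic (\<beta> i - \<beta> j)
        - dlogistic (\<beta> i - \<beta> j) * (deviation \<theta> i - deviation \<theta> j))\<bar> \<le> K * w\<^sup>2 / 8"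
      by (simp add: \<rho>_def h_def)
  qed
  then show ?thesis by simp
qed

lemma deviation_centred_eq:
  assumes "stationary a \<theta>" and i: "i \<in> R"
  defines "g \<equiv> \<lambda>m. score \<beta> a m - score_remainder \<theta> m"
  shows "deviation \<theta> i - (\<Sum>m\<in>I. deviation \<theta> m) / n = (\<Sum>m\<in>I. corrector i m * g m) + g i / cross_info i"
proof -
  let ?f = "\<lambda>m. corrector i m + bump i m" and ?e = "deviation \<theta>"
  have iI: "i \<in> I" using i R_sub by auto
  have "?e i - (\<Sum>m\<in>I. ?e m) / n = (\<Sum>m\<in>I. ?e m * ((if m = i then 1 else 0) - 1 / n))"
    using iI by (simp add: right_diff_distrib sum_subtractf sum_divide_distrib if_distrib[of "\<lambda>x. _ * x"] cong: if_cong)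
  also have "\<dots> = (\<Sum>m\<in>I. ?e m * laplacian info I ?f m)"
    using corrector(3)[OF i] by (intro sum.cong refl) simp
  also have "\<dots> = (\<Sum>m\<in>I. ?f m * laplacian info I ?e m)"
    by (rule laplacian_self_adjoint[OF info_sym])
  also have "\<dots> = (\<Sum>m\<in>I. ?f m * g m)"
    unfolding g_def using laplacian_deviation[OF assms(1)] by (intro sum.cong refl) simp
  also have "\<dots> = (\<Sum>m\<in>I. corrector i m * g m) + (\<Sum>m\<in>I. bump i m * g m)"
    by (simp add: distrib_right sum.distrib)
  also have "(\<Sum>m\<in>I. bump i m * g m) = g i / cross_info i"
    using iI by (simp add: bump_def if_distrib[of "\<lambda>x. x * _"] cong: if_cong)
  finally show ?thesis .
qed

lemma residual_le:
  assumes "outcome a" "i \<in> I" "j \<in> I"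
  shows "\<bar>residual \<theta> a i j\<bar> \<le> K"
proof (cases "i = j")
  case False
  have "0 \<le> real (k i j) * logistic (\<theta> i - \<theta> j)" "real (k i j) * logistic (\<theta> i - \<theta> j) \<le> real (k i j) * 1"
    using logistic_bounds[of "\<theta> i - \<theta> j"] by (auto intro!: mult_left_le)
  moreover have "residual \<theta> a i j = real (bt_win k a i j) - real (k i j) * logistic (\<theta> i - \<theta> j)"
    using False by (simp add: residual_def)
  ultimately show ?thesis
    using win_complement[OF assms False] k_bounds[OF assms(2,3) False]
      of_nat_0_le_iff[of "bt_win k a i j"] of_nat_0_le_iff[of "bt_win k a j i"] by linarith
qed (use K_ge_1 in \<open>simp add: residual_def\<close>)

lemma score_minus_cross_score_le:
  assumes a: "outcome a" and i: "i \<in> R"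
  shows "\<bar>(score \<beta> a i - cross_score a i) / cross_info i\<bar> \<le> 2 * real r * K * b / n"
proof -
  have "score \<beta> a i - cross_score a i = (\<Sum>j\<in>R. residual \<beta> a i j)"
    unfolding score_def cross_score_def using sum.subset_diff[OF R_sub, of "residual \<beta> a i"] by simp
  also have "\<bar>\<dots>\<bar> \<le> (\<Sum>j\<in>R. real K)"
    using residual_le[OF a] i R_sub by (intro order_trans[OF sum_abs] sum_mono) auto
  also have "\<dots> \<le> real r * K" by (auto intro!: mult_right_mono)
  finally have "\<bar>score \<beta> a i - cross_score a i\<bar> * (1 / cross_info i) \<le> real r * K * (2 * b / n)"
    using inverse_cross_info_bounds[OF i] by (intro mult_mono) auto
  then show ?thesis using cross_info_bounds(3)[OF i] by (simp add: mult_ac)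
qed

lemma deviation_expansion:
  fixes w :: real
  assumes a: "outcome a" and \<theta>: "stationary a \<theta>" and osc: "osc_le I (deviation \<theta>) w" and i: "i \<in> R"
  shows "\<bar>deviation \<theta> i - (\<Sum>m\<in>I. deviation \<theta> m) / n - cross_score a i / cross_info i\<bar>
    \<le> \<bar>\<Sum>m\<in>I. corrector i m * score \<beta> a m\<bar> + 2 * real r * K * b / n + real r * (real K)\<^sup>2 * b\<^sup>2 * w\<^sup>2 / 2 + K * b * w\<^sup>2 / 4"
proof -
  let ?\<rho> = "score_remainder \<theta>" and ?z = "corrector i"
  define \<zeta> where "\<zeta> = 4 * real r * K * b\<^sup>2 / (real n)\<^sup>2"
  have iI: "i \<in> I" using i R_sub by auto
  have z: "\<bar>?z m\<bar> \<le> \<zeta>" if "m \<in> I" for m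
    using osc_leD[OF corrector(2)[OF i] that one_in(1)] unfolding corrector(1)[OF i] \<zeta>_def by simp
  have "\<bar>\<Sum>m\<in>I. ?z m * ?\<rho> m\<bar> \<le> (\<Sum>m\<in>I. \<zeta> * (n * (K * w\<^sup>2 / 8)))"
  proof (rule order_trans[OF sum_abs], rule sum_mono)
    fix m assume "m \<in> I"
    then show "\<bar>?z m * ?\<rho> m\<bar> \<le> \<zeta> * (n * (K * w\<^sup>2 / 8))"
      unfolding abs_mult using z score_remainder_le[OF osc] by (intro mult_mono) (auto simp: \<zeta>_def)
  qed
  also have "\<dots> = real r * (real K)\<^sup>2 * b\<^sup>2 * w\<^sup>2 / 2" using n_pos by (simp add: \<zeta>_def power2_eq_square)
  finally have corrector_part: "\<bar>\<Sum>m\<in>I. ?z m * ?\<rho> m\<bar> \<le> real r * (real K)\<^sup>2 * b\<^sup>2 * w\<^sup>2 / 2" .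
  have "\<bar>?\<rho> i\<bar> * (1 / cross_info i) \<le> n * (K * w\<^sup>2 / 8) * (2 * b / n)"
    using score_remainder_le[OF osc iI] inverse_cross_info_bounds[OF i] by (intro mult_mono) auto
  then have bump_part: "\<bar>?\<rho> i / cross_info i\<bar> \<le> K * b * w\<^sup>2 / 4"
    using n_pos cross_info_bounds(3)[OF i] by (simp add: mult_ac)
  have "deviation \<theta> i - (\<Sum>m\<in>I. deviation \<theta> m) / n - cross_score a i / cross_info i
      = (\<Sum>m\<in>I. ?z m * score \<beta> a m) + (score \<beta> a i - cross_score a i) / cross_info i
        - (\<Sum>m\<in>I. ?z m * ?\<rho> m) - ?\<rho> i / cross_info i"
    unfolding deviation_centred_eq[OF \<theta> i] by (simp add: right_diff_distrib sum_subtractf diff_divide_distrib)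
  then show ?thesis using score_minus_cross_score_le[OF a i] corrector_part bump_part by linarith
qed

section \<open>Quadratic approximation of the likelihood ratio\<close>

definition quad_stat :: "(nat \<times> nat \<Rightarrow> nat) \<Rightarrow> real" where
  "quad_stat a = weighted_var cross_info R (\<lambda>i. cross_score a i / cross_info i)"

definition typical :: "real \<Rightarrow> (nat \<times> nat \<Rightarrow> nat) \<Rightarrow> bool" where
  "typical w a \<longleftrightarrow> (\<forall>i\<in>I. \<bar>score \<beta> a i\<bar> \<le> real n * w / (4 * b)) \<and>
     (\<forall>i\<in>R. \<bar>\<Sum>m\<in>I. corrector i m * score \<beta> a m\<bar> \<le> real r * K * b * w\<^sup>2)"

lemma typical_deviation_expansion:
  fixes w :: real
  assumes a: "outcome a" "typical w a" and \<theta>: "stationary a \<theta>" "osc_le I (deviation \<theta>) w"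
    and w: "1 \<le> n * w\<^sup>2" and i: "i \<in> R"
  shows "\<bar>deviation \<theta> i - cross_score a i / cross_info i - (\<Sum>m\<in>I. deviation \<theta> m) / n\<bar> \<le> 4 * real r * (real K)\<^sup>2 * b\<^sup>2 * w\<^sup>2"
proof -
  have monomial: "real r ^ i * real K ^ 1 * b ^ 1 * w\<^sup>2 \<le> real r ^ 1 * real K ^ 2 * b ^ 2 * w\<^sup>2" if "i \<le> 1" for i
    using that r3 by (intro monomial_mono b1 K_ge_1) auto
  have "2 * real r * K * b / n * 1 \<le> 2 * real r * K * b / n * (n * w\<^sup>2)"
    using w b_pos by (intro mult_left_mono) auto
  then have "2 * real r * K * b / n \<le> 2 * (real r * K * b * w\<^sup>2)" using n_pos by simp
  moreover have "\<bar>\<Sum>m\<in>I. corrector i m * score \<beta> a m\<bar> \<le> real r * K * b * w\<^sup>2"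
    using a(2) i by (simp add: typical_def)
  moreover have "real r * K * b * w\<^sup>2 \<le> real r * (real K)\<^sup>2 * b\<^sup>2 * w\<^sup>2" "K * b * w\<^sup>2 \<le> real r * (real K)\<^sup>2 * b\<^sup>2 * w\<^sup>2"
    using monomial[of 1] monomial[of 0] by simp_all
  ultimately show ?thesis using deviation_expansion[OF a(1) \<theta> i] by linarith
qed

lemma weighted_var_minus_quad_stat_le:
  fixes w c :: real
  assumes "0 < w" and osc: "osc_le R \<theta> w" and small: "20 * real r * (real K)\<^sup>2 * b\<^sup>2 * w \<le> 1"
    and close: "\<And>i. i \<in> R \<Longrightarrow> \<bar>\<theta> i - cross_score a i / cross_info i - c\<bar> \<le> 4 * real r * (real K)\<^sup>2 * b\<^sup>2 * w\<^sup>2"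
  shows "\<bar>weighted_var cross_info R \<theta> - quad_stat a\<bar> \<le> 3 * ((real r)\<^sup>2 * real K ^ 3 * b\<^sup>2 * (n * w ^ 3))"
proof -
  let ?x = "\<lambda>i. cross_score a i / cross_info i"
  define d where "d = 4 * real r * (real K)\<^sup>2 * b\<^sup>2 * w\<^sup>2"
  have d: "0 \<le> d" "d \<le> w / 5"
    using mult_right_mono[OF small, of w] \<open>0 < w\<close> by (simp_all add: d_def power2_eq_square[of w] mult_ac)
  have osc_x: "osc_le R ?x (w + 2 * d)"
    unfolding osc_le_def
  proof (intro ballI)
    fix i j assume ij: "i \<in> R" "j \<in> R"
    show "\<bar>?x i - ?x j\<bar> \<le> w + 2 * d"
      using osc_leD[OF osc ij] close[OF ij(1)] close[OF ij(2)] unfolding d_def[symmetric] by linarith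
  qed
  have "quad_stat a \<le> weighted_var cross_info R \<theta> + sum cross_info R * (2 * w * d + d\<^sup>2)"
    unfolding quad_stat_def
  proof (rule weighted_var_perturb_le[where c = "- c", OF cross_info_nonneg sum_cross_info(1) osc])
    fix i assume "i \<in> R"
    from close[OF this] show "\<bar>?x i - \<theta> i - - c\<bar> \<le> d" unfolding d_def[symmetric] by linarith
  qed
  moreover have "weighted_var cross_info R \<theta> \<le> quad_stat a + sum cross_info R * (2 * (w + 2 * d) * d + d\<^sup>2)"
    unfolding quad_stat_def d_def
    by (rule weighted_var_perturb_le[where c = c, OF cross_info_nonneg sum_cross_info(1) osc_x[unfolded d_def] close])
  moreover have "sum cross_info R * (2 * (w + y * d) * d + d\<^sup>2) \<le> 3 * ((real r)\<^sup>2 * real K ^ 3 * b\<^sup>2 * (n * w ^ 3))"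
    if "0 \<le> y" "y \<le> 2" for y
  proof -
    have "y * d \<le> 2 * (w / 5)" using that d by (intro mult_mono) auto
    then have "2 * (w + y * d) + d \<le> 3 * w" using d by (simp add: distrib_left)
    then have "(2 * (w + y * d) + d) * d \<le> 3 * w * d" using d by (intro mult_right_mono)
    then have "2 * (w + y * d) * d + d\<^sup>2 \<le> 3 * w * d" by (simp add: power2_eq_square algebra_simps)
    moreover have "0 \<le> 2 * (w + y * d) * d + d\<^sup>2" using that d \<open>0 < w\<close> by simp
    ultimately have "sum cross_info R * (2 * (w + y * d) * d + d\<^sup>2) \<le> real r * real n * K / 4 * (3 * w * d)"
      by (intro mult_mono sum_cross_info) auto
    then show ?thesis by (simp add: d_def power2_eq_square power3_eq_cube mult_ac)
  qed
  from this[of 0] this[of 2]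
  have "sum cross_info R * (2 * w * d + d\<^sup>2) \<le> 3 * ((real r)\<^sup>2 * real K ^ 3 * b\<^sup>2 * (n * w ^ 3))"
    "sum cross_info R * (2 * (w + 2 * d) * d + d\<^sup>2) \<le> 3 * ((real r)\<^sup>2 * real K ^ 3 * b\<^sup>2 * (n * w ^ 3))" by simp_all
  ultimately show ?thesis by linarith
qed

lemma small_radius_bounds:
  fixes w :: real
  assumes w: "0 < w" and small: "20 * real r * (real K)\<^sup>2 * b\<^sup>2 * w \<le> 1"
  shows "w \<le> 1 / 20" "w + 2 * real r * K * b * w \<le> 1"
proof -
  have "real r ^ i * real K ^ j * b ^ j * w \<le> real r ^ 1 * real K ^ 2 * b ^ 2 * w" if "i \<le> 1" "j \<le> 2" for i j
    using w r3 that by (intro monomial_mono b1 K_ge_1) auto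
  from this[of 0 0] this[of 1 1]
  have "w \<le> real r * (real K)\<^sup>2 * b\<^sup>2 * w" "real r * K * b * w \<le> real r * (real K)\<^sup>2 * b\<^sup>2 * w" by simp_all
  with small show "w \<le> 1 / 20" "w + 2 * real r * K * b * w \<le> 1" using w by linarith+
qed

lemma lr_stat_approx:
  fixes w :: real
  assumes a: "outcome a" "typical w a"
    and w: "0 < w" "1 \<le> n * w\<^sup>2" and small: "20 * real r * (real K)\<^sup>2 * b\<^sup>2 * w \<le> 1"
  shows "\<bar>bt_lr_stat n r k a - quad_stat a\<bar> \<le> 7 * ((real r)\<^sup>2 * real K ^ 3 * b\<^sup>2 * (n * w ^ 3))"
proof -
  note step = small_radius_bounds[OF w(1) small]
  then have "w \<le> 1" by simp
  then obtain \<theta> where \<theta>: "\<theta> 1 = 0" "osc_le I (deviation \<theta>) w" "stationary a \<theta>"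
    using mle_exists[OF a(1)] a(2) unfolding typical_def by blast
  let ?W = "weighted_var cross_info R \<theta>" and ?U = "(real r)\<^sup>2 * real K ^ 3 * b\<^sup>2 * (n * w ^ 3)"
  have osc_R: "osc_le R \<theta> w"
    unfolding osc_le_R_iff_deviation[of \<theta>] by (rule osc_le_subset[OF \<theta>(2) R_sub])
  have r1: "1 \<le> real r" using r3 by simp
  note errors = weighted_var_cross_info_nonneg weighted_var_cross_info_le[OF osc_R]
  have "bt_lr_stat n r k a - ?W \<le> 4 * ?U"
    by (rule upper_error_le[OF r1 K_ge_1 b1 w(1) step(1) w(2) n_pos errors lr_stat_upper[OF a(1) \<theta>(3,1,2)]])
  moreover have "?W - bt_lr_stat n r k a \<le> 4 * ?U"
    by (rule lower_error_le[OF r1 K_ge_1 b1 w(1) step(1) w(2) n_pos errors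
          lr_stat_lower[OF a(1) \<theta>(3,1,2) w(1) step(2)]])
  moreover have "\<bar>?W - quad_stat a\<bar> \<le> 3 * ?U"
    unfolding weighted_var_deviation[of \<theta>]
    by (rule weighted_var_minus_quad_stat_le[OF w(1) osc_le_subset[OF \<theta>(2) R_sub] small
          typical_deviation_expansion[OF a \<theta>(3,2) w(2)]])
  ultimately show ?thesis by linarith
qed


section \<open>Probability of typical outcomes\<close>

lemma prob_abs_score_ge:
  fixes \<epsilon> :: real
  assumes i: "i \<in> I" and \<epsilon>: "0 \<le> \<epsilon>"
  shows "measure_pmf.prob (bt_data n k \<beta>) {a. \<epsilon> \<le> \<bar>score \<beta> a i\<bar>} \<le> 2 * exp (- 2 * \<epsilon>\<^sup>2 / ((real K)\<^sup>2 * n))"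
proof -
  let ?e = "\<lambda>m. if m = i then 1 else 0 :: real" and ?u = "\<lambda>(x, y). (if x = i then 1 else 0) + (if y = i then 1 else 0) :: real"
  have "(\<Sum>p\<in>bt_pairs n. (?u p)\<^sup>2) = (\<Sum>(x, y)\<in>bt_pairs n. ?e x + ?e y)"
    by (intro sum.cong refl) (auto simp: bt_pairs_def)
  also have "\<dots> = (\<Sum>x\<in>I. \<Sum>y\<in>I - {x}. ?e x)" by (rule sum_bt_pairs_symmetrized)
  also have "\<dots> = (\<Sum>x\<in>I. if x = i then real n - 1 else 0)" using n_pos by (intro sum.cong refl) auto
  also have "\<dots> = real n - 1" using i by simp
  finally have U: "(\<Sum>p\<in>bt_pairs n. (?u p)\<^sup>2) = real n - 1" .
  have "(\<Sum>m\<in>I. ?e m * score \<beta> a m) = score \<beta> a i" for a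
    using i by (simp add: if_distrib[of "\<lambda>x. x * _"] cong: if_cong)
  moreover have "measure_pmf.prob (bt_data n k \<beta>) {a. \<epsilon> \<le> \<bar>\<Sum>m\<in>I. ?e m * score \<beta> a m\<bar>} \<le> 2 * exp (- 2 * \<epsilon>\<^sup>2 / ((real K)\<^sup>2 * n))"
    by (rule prob_abs_weighted_score_ge[where u = ?u, OF _ _ _ \<epsilon>]) (use U n2r r3 in auto)
  ultimately show ?thesis by simp
qed

lemma prob_abs_corrector_score_ge:
  fixes \<epsilon> :: real
  assumes i: "i \<in> R" and \<epsilon>: "0 \<le> \<epsilon>"
  shows "measure_pmf.prob (bt_data n k \<beta>) {a. \<epsilon> \<le> \<bar>\<Sum>m\<in>I. corrector i m * score \<beta> a m\<bar>}
    \<le> 2 * exp (- 2 * \<epsilon>\<^sup>2 / ((real K)\<^sup>2 * (16 * (real r)\<^sup>2 * (real K)\<^sup>2 * b ^ 4 / (real n)\<^sup>2)))"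
proof (rule prob_abs_weighted_score_ge[OF _ _ _ \<epsilon>])
  define \<zeta> where "\<zeta> = 4 * real r * K * b\<^sup>2 / (real n)\<^sup>2"
  show "\<bar>corrector i x - corrector i y\<bar> \<le> (\<lambda>_. \<zeta>) (x, y)" if "(x, y) \<in> bt_pairs n" for x y
    unfolding \<zeta>_def using that by (intro osc_leD[OF corrector(2)[OF i]]) (auto simp: bt_pairs_def)
  have "(1, 2) \<in> bt_pairs n" using n2r r3 by (simp add: bt_pairs_def)
  moreover have "\<zeta> > 0" using r3 K_ge_1 b_pos n_pos by (simp add: \<zeta>_def)
  ultimately show "0 < (\<Sum>p\<in>bt_pairs n. ((\<lambda>_. \<zeta>) p)\<^sup>2)" by (intro sum_pos2[OF finite_bt_pairs]) auto
  have "card (bt_pairs n) \<le> card (I \<times> I)" by (intro card_mono) (auto simp: bt_pairs_def)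
  then have "real (card (bt_pairs n)) \<le> (real n)\<^sup>2" by (simp add: power2_eq_square flip: of_nat_mult)
  then have "(\<Sum>p\<in>bt_pairs n. ((\<lambda>_. \<zeta>) p)\<^sup>2) \<le> (real n)\<^sup>2 * \<zeta>\<^sup>2" by (simp add: mult_right_mono)
  also have "\<dots> = 16 * (real r)\<^sup>2 * (real K)\<^sup>2 * b ^ 4 / (real n)\<^sup>2"
    using n_pos by (simp add: \<zeta>_def power_mult_distrib power_divide power2_eq_square power4_eq_xxxx)
  finally show "(\<Sum>p\<in>bt_pairs n. ((\<lambda>_. \<zeta>) p)\<^sup>2) \<le> 16 * (real r)\<^sup>2 * (real K)\<^sup>2 * b ^ 4 / (real n)\<^sup>2" .
qed

lemma prob_not_typical_le:
  fixes w :: real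
  assumes w: "0 < w" "1 \<le> n * w\<^sup>2"
  shows "measure_pmf.prob (bt_data n k \<beta>) {a. \<not> typical w a} \<le> 2 * (real n + r) * exp (- (n * w\<^sup>2 / (8 * (real K)\<^sup>2 * b\<^sup>2)))"
proof -
  define q where "q = n * w\<^sup>2 / (8 * (real K)\<^sup>2 * b\<^sup>2)"
  let ?P = "measure_pmf.prob (bt_data n k \<beta>)"
  define E where "E i = {a. real n * w / (4 * b) \<le> \<bar>score \<beta> a i\<bar>}" for i
  define F where "F i = {a. real r * K * b * w\<^sup>2 \<le> \<bar>\<Sum>m\<in>I. corrector i m * score \<beta> a m\<bar>}" for i
  have E: "?P (E i) \<le> 2 * exp (- q)" if "i \<in> I" for i
  proof -
    have "2 * (real n * w / (4 * b))\<^sup>2 / ((real K)\<^sup>2 * n) = q"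
      using n_pos by (simp add: q_def power_mult_distrib power_divide power2_eq_square mult_ac)
    then show ?thesis
      unfolding E_def using prob_abs_score_ge[OF that, of "real n * w / (4 * b)"] w b_pos by simp
  qed
  have F: "?P (F i) \<le> 2 * exp (- q)" if "i \<in> R" for i
  proof -
    have "2 * (real r * K * b * w\<^sup>2)\<^sup>2 / ((real K)\<^sup>2 * (16 * (real r)\<^sup>2 * (real K)\<^sup>2 * b ^ 4 / (real n)\<^sup>2)) = q * (n * w\<^sup>2)"
      using b_pos r3 K_ge_1 by (simp add: q_def power_mult_distrib power2_eq_square power4_eq_xxxx mult_ac)
    moreover have "q * 1 \<le> q * (n * w\<^sup>2)" using w by (intro mult_left_mono) (auto simp: q_def)
    moreover have "?P (F i) \<le> 2 * exp (- 2 * (real r * K * b * w\<^sup>2)\<^sup>2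
        / ((real K)\<^sup>2 * (16 * (real r)\<^sup>2 * (real K)\<^sup>2 * b ^ 4 / (real n)\<^sup>2)))"
      unfolding F_def using b_pos by (intro prob_abs_corrector_score_ge that) simp
    ultimately show ?thesis by (simp add: order_trans[OF _ mult_left_mono])
  qed
  have "?P {a. \<not> typical w a} \<le> ?P ((\<Union>i\<in>I. E i) \<union> (\<Union>i\<in>R. F i))"
    by (intro measure_pmf.finite_measure_mono) (auto simp: typical_def E_def F_def)
  also have "\<dots> \<le> ?P (\<Union>i\<in>I. E i) + ?P (\<Union>i\<in>R. F i)" by (intro measure_Un_le) auto
  also have "\<dots> \<le> (\<Sum>i\<in>I. ?P (E i)) + (\<Sum>i\<in>R. ?P (F i))"
    by (intro add_mono measure_pmf.finite_measure_subadditive_finite) auto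
  also have "\<dots> \<le> (\<Sum>i\<in>I. 2 * exp (- q)) + (\<Sum>i\<in>R. 2 * exp (- q))"
    by (intro add_mono sum_mono E F)
  also have "\<dots> \<le> 2 * (real n + r) * exp (- q)" by (simp add: distrib_right mult_right_mono)
  finally show ?thesis by (simp add: q_def)
qed

section \<open>The Laplace transform of the likelihood ratio\<close>

definition cross_pairs :: "(nat \<times> nat) set" where
  "cross_pairs = {(i, j)\<in>bt_pairs n. i \<in> R \<longleftrightarrow> j \<in> S}"

definition null_end :: "nat \<times> nat \<Rightarrow> nat" where
  "null_end p = (if fst p \<in> R then fst p else snd p)"

definition other_end :: "nat \<times> nat \<Rightarrow> nat" where
  "other_end p = (if fst p \<in> R then snd p else fst p)"

lemma finite_cross_pairs: "finite cross_pairs"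
  by (rule finite_subset[OF _ finite_bt_pairs[of n]]) (auto simp: cross_pairs_def)

lemma cross_pairsD:
  assumes "p \<in> cross_pairs"
  shows "p \<in> bt_pairs n" "null_end p \<in> R" "other_end p \<in> S"
  using assms by (auto simp: cross_pairs_def bt_pairs_def null_end_def other_end_def split: if_splits)

lemma fibre_sum_cross_pairs:
  assumes i: "i \<in> R"
  shows "fibre_sum null_end cross_pairs (\<lambda>p. F (null_end p) (other_end p)) i = (\<Sum>j\<in>S. F i j)"
  unfolding fibre_sum_def
proof (rule sum.reindex_bij_witness[where i = "\<lambda>j. (min i j, max i j)" and j = other_end])
  fix j assume j: "j \<in> S"
  then have "i \<noteq> j" using i by auto
  then show "other_end (min i j, max i j) = j" "(min i j, max i j) \<in> {p \<in> cross_pairs. null_end p = i}"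
    using i j R_sub by (auto simp: cross_pairs_def bt_pairs_def other_end_def null_end_def min_def max_def)
next
  fix p assume p: "p \<in> {p \<in> cross_pairs. null_end p = i}"
  then show "other_end p \<in> S" using cross_pairsD(3) by simp
  show "(min i (other_end p), max i (other_end p)) = p"
    using p by (auto simp: cross_pairs_def bt_pairs_def other_end_def null_end_def min_def max_def split: if_splits)
qed simp

definition cross_noise :: "nat \<times> nat \<Rightarrow> nat \<Rightarrow> real" where
  "cross_noise p x = (if fst p \<in> R then 1 else - 1) * noise \<beta> p x / cross_info (null_end p)"

lemma residual_cross_pair:
  assumes "outcome a" "p \<in> cross_pairs"
  shows "residual \<beta> a (null_end p) (other_end p) / cross_info (null_end p) = cross_noise p (a p)"
proof -
  have "residual \<beta> a (snd p) (fst p) = - residual \<beta> a (fst p) (snd p)"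
    using cross_pairsD(1)[OF assms(2)] by (intro residual_antisym[OF assms(1)]) (auto simp: bt_pairs_def)
  then show ?thesis
    using residual_eq_noise[of "fst p" "snd p" \<beta> a] cross_pairsD(1)[OF assms(2)]
    by (simp add: cross_noise_def null_end_def other_end_def)
qed

lemma quad_stat_eq:
  assumes "outcome a"
  shows "quad_stat a = weighted_var cross_info R (fibre_sum null_end cross_pairs (\<lambda>p. cross_noise p (a p)))"
  unfolding quad_stat_def
proof (rule weighted_var_cong)
  fix i assume i: "i \<in> R"
  have "cross_score a i / cross_info i = (\<Sum>j\<in>S. residual \<beta> a i j / cross_info i)"
    by (simp add: cross_score_def sum_divide_distrib)
  also have "\<dots> = fibre_sum null_end cross_pairs (\<lambda>p. residual \<beta> a (null_end p) (other_end p) / cross_info (null_end p)) i"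
    by (rule fibre_sum_cross_pairs[OF i, symmetric])
  also have "\<dots> = fibre_sum null_end cross_pairs (\<lambda>p. cross_noise p (a p)) i"
    by (rule fibre_sum_cong) (rule residual_cross_pair[OF assms])
  finally show "cross_score a i / cross_info i = \<dots>" .
qed

lemma cross_noise_variance:
  "measure_pmf.expectation (comparison_pmf \<beta> p) (\<lambda>x. (cross_noise p x)\<^sup>2)
    = info (null_end p) (other_end p) / (cross_info (null_end p))\<^sup>2"
proof -
  have "(cross_noise p x)\<^sup>2 = (noise \<beta> p x)\<^sup>2 / (cross_info (null_end p))\<^sup>2" for x
    by (simp add: cross_noise_def power_mult_distrib power_divide)
  moreover have "info (fst p) (snd p) = info (null_end p) (other_end p)"
    by (simp add: null_end_def other_end_def info_sym)
  ultimately show ?thesis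
    using variance_noise[of \<beta> "fst p" "snd p"] by (simp add: info_def)
qed

lemma sqrt_mult_abs_cross_noise_le:
  assumes l: "0 < l" and p: "p \<in> cross_pairs" and x: "x \<in> set_pmf (comparison_pmf \<beta> p)"
  shows "sqrt (l * cross_info (null_end p)) * \<bar>cross_noise p x\<bar> \<le> K * sqrt (2 * l * b / n)"
proof -
  note i = cross_pairsD(2)[OF p]
  define A where "A = cross_info (null_end p)"
  have A: "0 < A" "1 / A \<le> 2 * b / n"
    using cross_info_bounds(3)[OF i] inverse_cross_info_bounds(1)[OF i] by (simp_all add: A_def)
  have "sqrt (l * A) * \<bar>cross_noise p x\<bar> = \<bar>noise \<beta> p x\<bar> * (sqrt l * (sqrt A / A))"
    using A by (simp add: cross_noise_def A_def[symmetric] abs_mult real_sqrt_mult)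
  also have "sqrt l * (sqrt A / A) = sqrt (l * (1 / A))"
    using A by (simp add: real_sqrt_mult real_sqrt_divide field_simps)
  also have "\<bar>noise \<beta> p x\<bar> * sqrt (l * (1 / A)) \<le> K * sqrt (l * (2 * b / n))"
    using abs_noise_le[OF cross_pairsD(1)[OF p] x] A l by (intro mult_mono real_sqrt_le_mono mult_left_mono) auto
  finally show ?thesis by (simp add: A_def mult_ac)
qed

lemma expectation_quad_stat:
  "measure_pmf.expectation (bt_data n k \<beta>) (\<lambda>a. f (quad_stat a))
    = measure_pmf.expectation (Pi_pmf cross_pairs 0 (comparison_pmf \<beta>))
        (\<lambda>a. f (weighted_var cross_info R (fibre_sum null_end cross_pairs (\<lambda>p. cross_noise p (a p)))) :: real)"
proof -
  let ?V = "\<lambda>a. weighted_var cross_info R (fibre_sum null_end cross_pairs (\<lambda>p. cross_noise p (a p)))"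
    and ?restrict = "\<lambda>a p. if p \<in> cross_pairs then a p else 0 :: nat"
  have "quad_stat a = ?V (?restrict a)" if "a \<in> set_pmf (bt_data n k \<beta>)" for a
    unfolding quad_stat_eq[OF outcome_bt_data[OF that]] by (intro weighted_var_cong fibre_sum_cong) auto
  then have "measure_pmf.expectation (bt_data n k \<beta>) (\<lambda>a. f (quad_stat a))
      = measure_pmf.expectation (bt_data n k \<beta>) (\<lambda>a. f (?V (?restrict a)))"
    by (intro integral_cong_AE) (auto simp: AE_measure_pmf_iff)
  also have "\<dots> = measure_pmf.expectation (Pi_pmf cross_pairs 0 (comparison_pmf \<beta>)) (\<lambda>a. f (?V a))"
    unfolding bt_data_eq using cross_pairsD(1) by (subst Pi_pmf_subset[of "bt_pairs n" cross_pairs]) auto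
  finally show ?thesis .
qed

lemma quad_stat_laplace:
  fixes l :: real
  assumes l: "0 < l"
  defines "B \<equiv> K * sqrt (2 * l * b / n)"
  shows "\<bar>measure_pmf.expectation (bt_data n k \<beta>) (\<lambda>a. exp (- l * quad_stat a)) - (1 + 2 * l) powr (- real (r - 2) / 2)\<bar>
    \<le> (4 * B + 12 * B\<^sup>2) * (l * r)"
proof -
  let ?v = "\<lambda>p. info (null_end p) (other_end p) / (cross_info (null_end p))\<^sup>2"
  have "\<bar>measure_pmf.expectation (bt_data n k \<beta>) (\<lambda>a. exp (- l * quad_stat a))
      - (1 + 2 * l) powr (- real (card R - 1) / 2)\<bar> \<le> (4 * B + 12 * B\<^sup>2) * (l * card R)"
    unfolding expectation_quad_stat[of "\<lambda>x. exp (- l * x)"]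
  proof (rule weighted_var_laplace_approx[where v = ?v])
    show "measure_pmf.expectation (comparison_pmf \<beta> p) (cross_noise p) = 0" for p
      unfolding cross_noise_def using expectation_noise[of \<beta> p] by simp
    show "fibre_sum null_end cross_pairs ?v i = 1 / cross_info i" if i: "i \<in> R" for i
    proof -
      have "fibre_sum null_end cross_pairs ?v i = (\<Sum>j\<in>S. info i j / (cross_info i)\<^sup>2)"
        by (rule fibre_sum_cross_pairs[OF i])
      also have "\<dots> = cross_info i / (cross_info i)\<^sup>2" by (simp add: cross_info_def sum_divide_distrib)
      also have "\<dots> = 1 / cross_info i" by (simp add: power2_eq_square)
      finally show ?thesis .
    qed
  qed (use l r3 cross_info_bounds(3) finite_cross_pairs cross_pairsD(2) finite_set_comparison_pmf cross_noise_variance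
      sqrt_mult_abs_cross_noise_le[OF l] in \<open>auto simp: B_def\<close>)
  moreover have "card R - 1 = r - 2" by simp
  moreover have "(4 * B + 12 * B\<^sup>2) * (l * card R) \<le> (4 * B + 12 * B\<^sup>2) * (l * r)"
    using l b_pos by (intro mult_left_mono) (auto simp: B_def)
  ultimately show ?thesis by simp
qed

lemma quad_stat_nonneg: "0 \<le> quad_stat a"
  unfolding quad_stat_def by (rule weighted_var_cross_info_nonneg)

lemma lr_stat_laplace:
  fixes l w :: real
  assumes l: "0 < l" and w: "0 < w" "1 \<le> n * w\<^sup>2" and small: "20 * real r * (real K)\<^sup>2 * b\<^sup>2 * w \<le> 1"
  defines "B \<equiv> K * sqrt (2 * l * b / n)"
  shows "\<bar>measure_pmf.expectation (bt_data n k \<beta>) (\<lambda>a. exp (- l * bt_lr_stat n r k a)) - (1 + 2 * l) powr (- real (r - 2) / 2)\<bar>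
    \<le> l * (7 * ((real r)\<^sup>2 * real K ^ 3 * b\<^sup>2 * (n * w ^ 3)))
      + 2 * (real n + r) * exp (- (n * w\<^sup>2 / (8 * (real K)\<^sup>2 * b\<^sup>2))) + (4 * B + 12 * B\<^sup>2) * (l * r)"
proof -
  have "\<bar>measure_pmf.expectation (bt_data n k \<beta>) (\<lambda>a. exp (- l * bt_lr_stat n r k a))
      - measure_pmf.expectation (bt_data n k \<beta>) (\<lambda>a. exp (- l * quad_stat a))\<bar>
    \<le> l * (7 * ((real r)\<^sup>2 * real K ^ 3 * b\<^sup>2 * (n * w ^ 3))) + measure_pmf.prob (bt_data n k \<beta>) {a. \<not> typical w a}"
    using l w by (intro expectation_exp_diff_le finite_set_bt_data lr_stat_nonneg outcome_bt_data quad_stat_nonneg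
        lr_stat_approx[OF _ _ w small]) auto
  then show ?thesis
    using prob_not_typical_le[OF w] quad_stat_laplace[OF l] unfolding B_def by linarith
qed

end

section \<open>The limit theorem\<close>

definition error_scale :: "nat \<Rightarrow> real \<Rightarrow> real" where
  "error_scale n b = b ^ 5 * sqrt (ln n) ^ 3 / sqrt n"

lemma ln_ge_1: "3 \<le> n \<Longrightarrow> 1 \<le> ln (real n)"
  using exp_le by (subst ln_ge_iff) auto

lemma monomial_le_error_scale:
  assumes "1 \<le> b" "3 \<le> n" "i \<le> 5" "j \<le> 3" "1 \<le> m"
  shows "b ^ i * sqrt (ln n) ^ j / sqrt n ^ m \<le> error_scale n b"
proof -
  have "b ^ i * sqrt (ln n) ^ j / sqrt n ^ m \<le> b ^ 5 * sqrt (ln n) ^ 3 / sqrt n ^ 1"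
    using assms ln_ge_1[OF assms(2)] by (intro frac_le mult_mono power_increasing) auto
  then show ?thesis by (simp add: error_scale_def)
qed

context bradley_terry
begin

definition window :: real where
  "window = 4 * K * b * sqrt (ln n) / sqrt n"

lemma n_ge_3: "3 \<le> n" using n2r r3 by simp

lemmas monomial_le = monomial_le_error_scale[OF b1 n_ge_3]

lemma n_mult_window_sq: "n * window\<^sup>2 = 16 * (real K)\<^sup>2 * b\<^sup>2 * ln n"
  using n_pos ln_ge_1[OF n_ge_3] by (simp add: window_def power_mult_distrib power_divide)

lemma window_bounds: "0 < window" "1 \<le> n * window\<^sup>2"
proof -
  show "0 < window"
    unfolding window_def using n_ge_3 b_pos K_ge_1 by (intro divide_pos_pos mult_pos_pos) auto
  have "1 * 1\<^sup>2 * 1\<^sup>2 * 1 \<le> 16 * (real K)\<^sup>2 * b\<^sup>2 * ln n"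
    using K_ge_1 b1 ln_ge_1[OF n_ge_3] by (intro mult_mono power_mono) auto
  then show "1 \<le> n * window\<^sup>2" by (simp add: n_mult_window_sq)
qed

lemma window_error_scale:
  "b\<^sup>2 * window \<le> 4 * K * error_scale n b" "b\<^sup>2 * (n * window ^ 3) = 64 * real K ^ 3 * error_scale n b"
proof -
  have "b\<^sup>2 * window = 4 * K * (b ^ 3 * sqrt (ln n) ^ 1 / sqrt n ^ 1)"
    by (simp add: window_def power2_eq_square power3_eq_cube)
  also have "\<dots> \<le> 4 * K * error_scale n b" by (intro mult_left_mono monomial_le) auto
  finally show "b\<^sup>2 * window \<le> 4 * K * error_scale n b" .
  have "b\<^sup>2 * (n * window ^ 3) = 64 * real K ^ 3 * (b ^ 5 * sqrt (ln n) ^ 3 * (n / sqrt n ^ 3))"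
    by (simp add: window_def power_mult_distrib power_divide flip: power_add)
  also have "n / sqrt n ^ 3 = 1 / sqrt n" using n_pos by (simp add: power3_eq_cube)
  finally show "b\<^sup>2 * (n * window ^ 3) = 64 * real K ^ 3 * error_scale n b" by (simp add: error_scale_def)
qed

lemma tail_error_le:
  "2 * (real n + r) * exp (- (n * window\<^sup>2 / (8 * (real K)\<^sup>2 * b\<^sup>2))) \<le> 4 * error_scale n b"
proof -
  have "n * window\<^sup>2 / (8 * (real K)\<^sup>2 * b\<^sup>2) = 2 * ln n"
    using b_pos K_ge_1 by (simp add: n_mult_window_sq)
  then have "exp (- (n * window\<^sup>2 / (8 * (real K)\<^sup>2 * b\<^sup>2))) = 1 / (real n)\<^sup>2"
    using n_pos by (simp add: exp_minus exp_double inverse_eq_divide)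
  then have "2 * (real n + r) * exp (- (n * window\<^sup>2 / (8 * (real K)\<^sup>2 * b\<^sup>2))) = 2 * (real n + r) / (real n)\<^sup>2" by simp
  also have "\<dots> \<le> 2 * (real n + n) / (real n)\<^sup>2" using n2r by (intro divide_right_mono) auto
  also have "\<dots> = 4 * (b ^ 0 * sqrt (ln n) ^ 0 / sqrt n ^ 2)" using n_pos by (simp add: power2_eq_square)
  also have "\<dots> \<le> 4 * error_scale n b" by (intro mult_left_mono monomial_le) auto
  finally show ?thesis .
qed

lemma replacement_error_le:
  fixes l :: real
  assumes "0 < l"
  defines "B \<equiv> K * sqrt (2 * l * b / n)"
  shows "4 * B + 12 * B\<^sup>2 \<le> (4 * K * sqrt (2 * l) + 24 * (real K)\<^sup>2 * l) * error_scale n b"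
proof -
  have "sqrt b \<le> b" using b1 by (intro real_le_lsqrt) (auto simp: power2_eq_square)
  then have "K * sqrt (2 * l) * (sqrt b / sqrt n) \<le> K * sqrt (2 * l) * (b / sqrt n)"
    using assms by (intro mult_left_mono divide_right_mono) auto
  then have "B \<le> K * sqrt (2 * l) * (b ^ 1 * sqrt (ln n) ^ 0 / sqrt n ^ 1)"
    by (simp add: B_def real_sqrt_mult real_sqrt_divide mult.assoc)
  also have "\<dots> \<le> K * sqrt (2 * l) * error_scale n b"
    using assms by (intro mult_left_mono monomial_le) auto
  finally have B: "B \<le> K * sqrt (2 * l) * error_scale n b" .
  have "B\<^sup>2 = 2 * (real K)\<^sup>2 * l * (b ^ 1 * sqrt (ln n) ^ 0 / sqrt n ^ 2)"
    using assms b_pos by (simp add: B_def power_mult_distrib)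
  also have "\<dots> \<le> 2 * (real K)\<^sup>2 * l * error_scale n b"
    using assms by (intro mult_left_mono monomial_le) auto
  finally show ?thesis using B by (simp add: distrib_right)
qed

lemma lr_stat_laplace_error_scale:
  fixes l :: real
  assumes l: "0 < l" and small: "80 * real r * real K ^ 3 * error_scale n b \<le> 1"
  shows "\<bar>measure_pmf.expectation (bt_data n k \<beta>) (\<lambda>a. exp (- l * bt_lr_stat n r k a)) - (1 + 2 * l) powr (- real (r - 2) / 2)\<bar>
    \<le> (448 * l * (real r)\<^sup>2 * real K ^ 6 + 4 + (4 * K * sqrt (2 * l) + 24 * (real K)\<^sup>2 * l) * (l * r)) * error_scale n b"
proof -
  have "20 * real r * (real K)\<^sup>2 * b\<^sup>2 * window = 20 * real r * (real K)\<^sup>2 * (b\<^sup>2 * window)" by simp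
  also have "\<dots> \<le> 20 * real r * (real K)\<^sup>2 * (4 * K * error_scale n b)"
    using window_error_scale(1) by (intro mult_left_mono) auto
  also have "\<dots> \<le> 1" using small by (simp add: power2_eq_square power3_eq_cube mult_ac)
  finally have w: "20 * real r * (real K)\<^sup>2 * b\<^sup>2 * window \<le> 1" .
  have expansion: "l * (7 * ((real r)\<^sup>2 * real K ^ 3 * b\<^sup>2 * (n * window ^ 3))) = 448 * l * (real r)\<^sup>2 * real K ^ 6 * error_scale n b"
    unfolding mult.assoc window_error_scale(2) by (simp add: mult_ac flip: power_add)
  have "(4 * (K * sqrt (2 * l * b / n)) + 12 * (K * sqrt (2 * l * b / n))\<^sup>2) * (l * r)
      \<le> (4 * K * sqrt (2 * l) + 24 * (real K)\<^sup>2 * l) * error_scale n b * (l * r)"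
    using replacement_error_le[OF l] l by (intro mult_right_mono) auto
  also have "\<dots> = (4 * K * sqrt (2 * l) + 24 * (real K)\<^sup>2 * l) * (l * r) * error_scale n b" by (simp add: mult_ac)
  finally show ?thesis
    using lr_stat_laplace[OF l window_bounds w] tail_error_le
    unfolding expansion distrib_right[of _ _ "error_scale n b"] by linarith
qed

end

lemma lr_stat_laplace_tendsto:
  fixes l :: real
  assumes model: "\<And>n. 2 * r \<le> n \<Longrightarrow> bradley_terry n K (k n) r (\<beta> n) (b n)"
    and scale: "(\<lambda>n. error_scale n (b n)) \<longlonglongrightarrow> 0" and l: "0 < l"
  shows "(\<lambda>n. measure_pmf.expectation (bt_data n (k n) (\<beta> n)) (\<lambda>a. exp (- l * bt_lr_stat n r (k n) a)))
    \<longlonglongrightarrow> (1 + 2 * l) powr (- real (r - 2) / 2)"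
proof -
  define C where "C = 448 * l * (real r)\<^sup>2 * real K ^ 6 + 4 + (4 * K * sqrt (2 * l) + 24 * (real K)\<^sup>2 * l) * (l * r)"
  have "(\<lambda>n. 80 * real r * real K ^ 3 * error_scale n (b n)) \<longlonglongrightarrow> 0"
    using tendsto_mult_right_zero[OF scale] .
  then have "eventually (\<lambda>n. 80 * real r * real K ^ 3 * error_scale n (b n) < 1) sequentially"
    by (rule order_tendstoD) simp
  then have "eventually (\<lambda>n. norm (measure_pmf.expectation (bt_data n (k n) (\<beta> n)) (\<lambda>a. exp (- l * bt_lr_stat n r (k n) a))
      - (1 + 2 * l) powr (- real (r - 2) / 2)) \<le> C * error_scale n (b n)) sequentially"
    using eventually_ge_at_top[of "2 * r"]
  proof eventually_elim
    case (elim n)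
    then show ?case
      unfolding C_def real_norm_def by (intro bradley_terry.lr_stat_laplace_error_scale[OF model] l) auto
  qed
  then have "(\<lambda>n. measure_pmf.expectation (bt_data n (k n) (\<beta> n)) (\<lambda>a. exp (- l * bt_lr_stat n r (k n) a))
      - (1 + 2 * l) powr (- real (r - 2) / 2)) \<longlonglongrightarrow> 0"
    by (rule Lim_null_comparison) (rule tendsto_mult_right_zero[OF scale])
  then show ?thesis by (rule LIM_zero_cancel)
qed

lemma inverse_dlogistic: "(1 + exp t)\<^sup>2 / exp t = 1 / dlogistic t"
  by (simp add: dlogistic_def)

lemma finite_bt_ratios:
  "finite {(1 + exp (\<beta> i - \<beta> j))\<^sup>2 / exp (\<beta> i - \<beta> j) | i j. i \<in> {1..n} \<and> j \<in> {1..n} \<and> i \<noteq> (j::nat)}"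
  by (rule finite_subset[where B = "(\<lambda>(i, j). (1 + exp (\<beta> i - \<beta> j))\<^sup>2 / exp (\<beta> i - \<beta> j)) ` ({1..n} \<times> {1..n})"]) auto

lemma
  assumes "i \<in> {1..n}" "j \<in> {1..n}" "i \<noteq> j"
  shows bt_b_ge: "1 / dlogistic (\<beta> i - \<beta> j) \<le> bt_b n \<beta>"
    and bt_c_le: "bt_c n \<beta> \<le> 1 / dlogistic (\<beta> i - \<beta> j)"
    and bt_c_pos: "0 < bt_c n \<beta>"
proof -
  let ?X = "{(1 + exp (\<beta> i - \<beta> j))\<^sup>2 / exp (\<beta> i - \<beta> j) | i j. i \<in> {1..n} \<and> j \<in> {1..n} \<and> i \<noteq> j}"
  have mem: "1 / dlogistic (\<beta> i - \<beta> j) \<in> ?X"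
    unfolding inverse_dlogistic[symmetric] using assms by blast
  show "1 / dlogistic (\<beta> i - \<beta> j) \<le> bt_b n \<beta>" unfolding bt_b_def by (rule Max_ge[OF finite_bt_ratios mem])
  show "bt_c n \<beta> \<le> 1 / dlogistic (\<beta> i - \<beta> j)" unfolding bt_c_def by (rule Min_le[OF finite_bt_ratios mem])
  have "bt_c n \<beta> \<in> ?X" unfolding bt_c_def by (rule Min_in[OF finite_bt_ratios]) (use mem in blast)
  then show "0 < bt_c n \<beta>" by (auto intro!: divide_pos_pos zero_less_power)
qed

lemma bt_b_ge_4: "2 \<le> n \<Longrightarrow> 4 \<le> bt_b n \<beta>"
proof -
  assume "2 \<le> n"
  have "4 \<le> 1 / dlogistic (\<beta> 1 - \<beta> 2)"
    using dlogistic_le[of "\<beta> 1 - \<beta> 2"] dlogistic_pos[of "\<beta> 1 - \<beta> 2"] by (simp add: field_simps)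
  also have "\<dots> \<le> bt_b n \<beta>" using \<open>2 \<le> n\<close> by (intro bt_b_ge) auto
  finally show ?thesis .
qed

lemma (in bt_design) bradley_terry_bt_b:
  assumes "2 < r" "2 * r \<le> n" "\<beta> 1 = 0" "\<And>i. i \<in> {2..r} \<Longrightarrow> \<beta> i = \<beta> 2"
  shows "bradley_terry n K k r \<beta> (bt_b n \<beta>)"
proof unfold_locales
  have b: "4 \<le> bt_b n \<beta>" using assms(1,2) by (intro bt_b_ge_4) simp
  then show "1 \<le> bt_b n \<beta>" by simp
  show "1 / bt_b n \<beta> \<le> dlogistic (\<beta> i - \<beta> j)" if "i \<in> {1..n}" "j \<in> {1..n}" "i \<noteq> j" for i j
    using bt_b_ge[OF that, of \<beta>] b dlogistic_pos[of "\<beta> i - \<beta> j"] by (simp add: pos_divide_le_eq mult.commute)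
  show "3 \<le> r" using assms(1) by simp
qed (fact assms)+

text \<open>Two merits coincide under the null hypothesis, so the smallest inverse variance is exactly \<open>4\<close> and the
  denominator \<open>bt_c n \<beta> ^ 6\<close> of the rate condition is bounded.\<close>

lemma error_scale_le_rate:
  assumes "3 \<le> n" "\<beta> 3 = \<beta> (2::nat)"
  shows "error_scale n (bt_b n \<beta>) \<le> 4096 * \<bar>bt_b n \<beta> ^ 11 / bt_c n \<beta> ^ 6 / (sqrt n / ln n powr (5 / 2))\<bar>"
proof -
  define b c where "b = bt_b n \<beta>" and "c = bt_c n \<beta>"
  have b: "1 \<le> b" using bt_b_ge_4[of n \<beta>] assms by (simp add: b_def)
  have c: "0 < c" "c \<le> 4"
    using bt_c_pos[of 2 n 3 \<beta>] bt_c_le[of 2 n 3 \<beta>] assms by (auto simp: c_def dlogistic_def)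
  then have "c ^ 6 \<le> 4 ^ 6" by (intro power_mono) auto
  then have "1 \<le> 4096 / c ^ 6" using c by simp
  then have "b ^ 5 * 1 \<le> b ^ 11 * (4096 / c ^ 6)" using b by (intro mult_mono power_increasing) auto
  moreover have "sqrt (ln n) ^ 3 \<le> ln n powr (5 / 2)"
  proof -
    have "sqrt (ln n) ^ 3 = ln n powr (3 / 2)"
      using ln_ge_1[OF assms(1)] by (simp add: powr_half_sqrt[symmetric] powr_powr flip: powr_realpow)
    also have "\<dots> \<le> ln n powr (5 / 2)" using ln_ge_1[OF assms(1)] by (intro powr_mono) auto
    finally show ?thesis .
  qed
  ultimately have "error_scale n b \<le> b ^ 11 * (4096 / c ^ 6) * ln n powr (5 / 2) / sqrt n"
    unfolding error_scale_def using b c ln_ge_1[OF assms(1)] by (intro divide_right_mono mult_mono) auto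
  also have "\<dots> = 4096 * (b ^ 11 / c ^ 6 / (sqrt n / ln n powr (5 / 2)))" by simp
  also have "\<dots> \<le> 4096 * \<bar>b ^ 11 / c ^ 6 / (sqrt n / ln n powr (5 / 2))\<bar>" by (intro mult_left_mono abs_ge_self) simp
  finally show ?thesis by (simp add: b_def c_def)
qed

lemma error_scale_tendsto_0:
  assumes null: "\<And>n. \<beta> n 3 = \<beta> n (2::nat)"
    and rate: "(\<lambda>n. bt_b n (\<beta> n) ^ 11 / bt_c n (\<beta> n) ^ 6) \<in> o(\<lambda>n. sqrt (real n) / ln (real n) powr (5 / 2))"
  shows "(\<lambda>n. error_scale n (bt_b n (\<beta> n))) \<longlonglongrightarrow> 0"
proof (rule tendsto_sandwich[OF _ _ tendsto_const])
  show "eventually (\<lambda>n. 0 \<le> error_scale n (bt_b n (\<beta> n))) sequentially"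
  proof (rule eventually_sequentiallyI)
    fix n :: nat assume "3 \<le> n"
    then show "0 \<le> error_scale n (bt_b n (\<beta> n))"
      using bt_b_ge_4[of n "\<beta> n"] ln_ge_1[of n] by (simp add: error_scale_def)
  qed
  show "eventually (\<lambda>n. error_scale n (bt_b n (\<beta> n))
      \<le> 4096 * \<bar>bt_b n (\<beta> n) ^ 11 / bt_c n (\<beta> n) ^ 6 / (sqrt n / ln n powr (5 / 2))\<bar>) sequentially"
    by (rule eventually_sequentiallyI) (rule error_scale_le_rate[OF _ null])
  show "(\<lambda>n. 4096 * \<bar>bt_b n (\<beta> n) ^ 11 / bt_c n (\<beta> n) ^ 6 / (sqrt n / ln n powr (5 / 2))\<bar>) \<longlonglongrightarrow> 0"
    by (rule tendsto_mult_right_zero[OF tendsto_rabs_zero[OF smalloD_tendsto[OF rate]]])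
qed

theorem theorem4:
  fixes K r :: nat
    and k :: "nat \<Rightarrow> nat \<Rightarrow> nat \<Rightarrow> nat"
    and \<beta> :: "nat \<Rightarrow> nat \<Rightarrow> real"
  assumes r_gt: "r > 2"
    and k_sym: "\<And>n i j. k n i j = k n j i"
    and k_range: "\<And>n i j. 1 \<le> i \<Longrightarrow> i < j \<Longrightarrow> j \<le> n \<Longrightarrow> k n i j \<in> {1..K}"
    and beta1: "\<And>n. \<beta> n 1 = 0"
    and H0: "\<And>n i. i \<in> {2..r} \<Longrightarrow> \<beta> n i = \<beta> n 2"
    and rate: "(\<lambda>n. bt_b n (\<beta> n) ^ 11 / bt_c n (\<beta> n) ^ 6)
               \<in> o(\<lambda>n. sqrt (real n) / ln (real n) powr (5 / 2))"
  shows "weak_conv_m (\<lambda>n. measure_pmf (map_pmf (bt_lr_stat n r (k n)) (bt_data n (k n) (\<beta> n))))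
           (chi_square (r - 2))"
proof (rule weak_conv_m_pmf_of_laplace)
  have design: "bt_design n K (k n)" for n
    using k_sym k_range by unfold_locales
  show "real_distribution (chi_square (r - 2))" using r_gt by (intro real_distribution_chi_square) simp
  show "AE x in chi_square (r - 2). 0 \<le> x" by (rule AE_chi_square_nonneg)
  show "0 \<le> x" if "x \<in> set_pmf (map_pmf (bt_lr_stat n r (k n)) (bt_data n (k n) (\<beta> n)))" for n x
    using that bt_design.lr_stat_nonneg[OF design] bt_design.outcome_bt_data[OF design] by auto
  have scale: "(\<lambda>n. error_scale n (bt_b n (\<beta> n))) \<longlonglongrightarrow> 0"
    using H0[of 3] r_gt by (intro error_scale_tendsto_0 rate) simp
  show "(\<lambda>n. measure_pmf.expectation (map_pmf (bt_lr_stat n r (k n)) (bt_data n (k n) (\<beta> n))) (\<lambda>x. exp (- real l * x)))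
      \<longlonglongrightarrow> integral\<^sup>L (chi_square (r - 2)) (\<lambda>x. exp (- real l * x))" if "l > 0" for l :: nat
    unfolding integral_map_pmf
  proof (subst chi_square_laplace)
    show "(\<lambda>n. measure_pmf.expectation (bt_data n (k n) (\<beta> n)) (\<lambda>a. exp (- real l * bt_lr_stat n r (k n) a)))
        \<longlonglongrightarrow> (1 + 2 * real l) powr (- real (r - 2) / 2)"
      using that by (intro lr_stat_laplace_tendsto[OF bt_design.bradley_terry_bt_b[OF design r_gt] scale] beta1 H0) auto
  qed (use r_gt in auto)
qed

end
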